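(* Let $k\ge1$, let $u\in H^{k+1}(\Omega)$ be the solution of the Poisson problem $-\Delta u=f$ in $\Omega$, $u=u_D$ on $\Gamma=\partial\Omega$, and let $a_h^k$, $l_h$ and $\hat a_h^k$ be as in the context. Then: (i) $\hat a_h^k(v_h,w_h)=a_h^k(v_h,w_h)$ for all $v_h,w_h\in V_h^k(\tilde\Omega_h)$; (ii) (exact consistency) $\hat a_h^k(u,w_h)=l_h(w_h)$ for all $w_h\in V_h^k(\tilde\Omega_h)$. Consequently, if $u_h\in V_h^k(\tilde\Omega_h)$ satisfies $a_h^k(u_h,w_h)=l_h(w_h)$ for all $w_h\in V_h^k(\tilde\Omega_h)$, then the Galerkin orthogonality relation $\hat a_h^k(u_h,w_h)-\hat a_h^k(u,w_h)=0$ holds for all $w_h\in V_h^k(\tilde\Omega_h)$.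
   Context: Geometry. $d\in\{2,3\}$. $\Omega\subset\mathbb R^d$ is a bounded connected open set with Lipschitz boundary $\Gamma=\partial\Omega$. $\mathcal D$ is a closed domain with $\mathrm{clos}(\Omega)\subseteq\mathcal D$, and $\mathcal T_h$ is an admissible (conforming), shape-regular, quasi-uniform simplicial triangulation of $\mathcal D$. Set $\tilde{\mathcal T}_h=\{T\in\mathcal T_h: T\subset\mathrm{clos}(\Omega)\}$, the surrogate domain $\tilde\Omega_h=\mathrm{int}\big(\bigcup_{T\in\tilde{\mathcal T}_h}T\big)\subseteq\Omega$, and the surrogate boundary $\tilde\Gamma_h=\partial\tilde\Omega_h$, with outward unit normal $\tilde{\boldsymbol n}$. A (measurable) map $\boldsymbol M_h:\tilde\Gamma_h\to\Gamma$ is given, and $\boldsymbol\delta(\tilde{\boldsymbol x})=\boldsymbol M_h(\tilde{\boldsymbol x})-\tilde{\boldsymbol x}$. Discrete space. $V_h^k(\tilde\Omega_h)=\{v_h\in C^0(\tilde\Omega_h): v_h|_{\tilde T}\in\mathcal P^k(\tilde T)\ \forall\,\tilde T\in\tilde{\mathcal T}_h\}$, with $\mathcal P^k$ the polynomials of degree at most $k$. Shift operator. For $v_h\in V_h^k(\tilde\Omega_h)$ and $\tilde{\boldsymbol x}$ on a side $\tilde e\subset\tilde\Gamma_h$ of the element $\tilde T\in\tilde{\mathcal T}_h$, $$\mathsf S^k_{\boldsymbol\delta}v_h(\tilde{\boldsymbol x})=v_h(\tilde{\boldsymbol x})+\sum_{i=1}^k\frac{\mathsf D^i_{\boldsymbol\delta}v_h(\tilde{\boldsymbol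 x})}{i!},\qquad \mathsf D^i_{\boldsymbol\delta}v=\sum_{|\boldsymbol\alpha|=i}\frac{i!}{\boldsymbol\alpha!}\frac{\partial^i v}{\partial\boldsymbol x^{\boldsymbol\alpha}}\boldsymbol\delta^{\boldsymbol\alpha},$$ the derivatives being those of the polynomial $v_h|_{\tilde T}$. Forms. With $(\cdot,\cdot)_\omega$ and $\langle\cdot,\cdot\rangle_\gamma$ the $L^2$ inner products on a domain $\omega$ and a boundary portion $\gamma$, and $\bar u_D=u_D\circ\boldsymbol M_h$ on $\tilde\Gamma_h$, $$a_h^k(v_h,w_h)=(\nabla v_h,\nabla w_h)_{\tilde\Omega_h}-\langle\nabla v_h\cdot\tilde{\boldsymbol n},w_h\rangle_{\tilde\Gamma_h}+\langle\mathsf S^k_{\boldsymbol\delta}v_h,\nabla w_h\cdot\tilde{\boldsymbol n}\rangle_{\tilde\Gamma_h},$$ $$l_h(w_h)=(f,w_h)_{\tilde\Omega_h}+\langle\bar u_D,\nabla w_h\cdot\tilde{\boldsymbol n}\rangle_{\tilde\Gamma_h},$$ $$\hat a_h^k(v,w_h)=(\nabla v,\nabla w_h)_{\tilde\Omega_h}-\langle\nabla v\cdot\tilde{\boldsymbol n},w_h\rangle_{\tilde\Gamma_h}+\langle v\circ\boldsymbol M_h,\nabla w_h\cdot\tilde{\boldsymbol n}\rangle_{\tilde\Gamma_h}.$$ The term $v\circ\boldsymbol M_h$ is interpreted as follows. If $v=v_h\in V_h^k(\tilde\Omega_h)$, then on each side $\tilde e\subset\tilde\Gamma_h$ of $\tilde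 T\in\tilde{\mathcal T}_h$ it is $(\mathsf E_{\tilde T}(v_h)\circ\boldsymbol M_h)|_{\tilde e}$, where $\mathsf E_{\tilde T}(v_h)$ is the polynomial $v_h|_{\tilde T}$ viewed as a polynomial on all of $\mathbb R^d$. If $v\in H^{k+1}(\Omega)$, it is the composition of the boundary values of $v$ on $\Gamma$ with $\boldsymbol M_h$. *)

theory Defs
  imports "HOL-Analysis.Analysis"
begin

section \<open>Multi-indices, partial derivatives, polynomials\<close>

type_synonym 'n multiindex = "'n \<Rightarrow> nat"

definition mi_order :: "'n::finite multiindex \<Rightarrow> nat" where
  "mi_order \<alpha> = (\<Sum>i\<in>UNIV. \<alpha> i)"

definition mi_fact :: "'n::finite multiindex \<Rightarrow> real" where
  "mi_fact \<alpha> = (\<Prod>i\<in>UNIV. fact (\<alpha> i))"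

definition mi_power :: "real^'n \<Rightarrow> 'n::finite multiindex \<Rightarrow> real" where
  "mi_power x \<alpha> = (\<Prod>i\<in>UNIV. (x $ i) ^ \<alpha> i)"

definition mi_single :: "'n::finite \<Rightarrow> nat \<Rightarrow> 'n multiindex" where
  "mi_single i m = (\<lambda>j. if j = i then m else 0)"

definition partial_deriv :: "'n::finite \<Rightarrow> (real^'n \<Rightarrow> real) \<Rightarrow> real^'n \<Rightarrow> real" where
  "partial_deriv i f = (\<lambda>x. frechet_derivative f (at x) (axis i 1))"

text \<open>The index type carries no order, so an arbitrary enumeration of the coordinates is fixed.
  Multi-index derivatives are only ever applied to smooth functions (test functions and
  polynomials), for which the order of differentiation is immaterial.\<close>

definition coord_list :: "'n::finite list" where
  "coord_list = (SOME xs. distinct xs \<and> set xs = UNIV)"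

definition mi_deriv :: "'n::finite multiindex \<Rightarrow> (real^'n \<Rightarrow> real) \<Rightarrow> real^'n \<Rightarrow> real" where
  "mi_deriv \<alpha> f = foldr partial_deriv (concat (map (\<lambda>i. replicate (\<alpha> i) i) coord_list)) f"

definition gradient :: "(real^'n::finite \<Rightarrow> real) \<Rightarrow> real^'n \<Rightarrow> real^'n" where
  "gradient f x = (\<chi> i. partial_deriv i f x)"

definition smooth :: "(real^'n::finite \<Rightarrow> real) \<Rightarrow> bool" where
  "smooth f \<longleftrightarrow> (\<forall>js x. foldr partial_deriv js f differentiable (at x))"

definition polys :: "nat \<Rightarrow> (real^'n::finite \<Rightarrow> real) set" where
  "polys k = {p. \<exists>c. \<forall>x. p x = (\<Sum>\<alpha> | mi_order \<alpha> \<le> k. c \<alpha> * mi_power x \<alpha>)}"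


section \<open>Sobolev spaces\<close>

text \<open>Elements of the Lebesgue and Sobolev spaces are represented by functions on the whole space;
  only their values almost everywhere in the domain matter.\<close>

definition L2_fun :: "'a measure \<Rightarrow> ('a \<Rightarrow> real) set" where
  "L2_fun \<mu> = {g. g \<in> borel_measurable \<mu> \<and> integrable \<mu> (\<lambda>x. (g x)\<^sup>2)}"

definition test_fun :: "(real^'n::finite) set \<Rightarrow> (real^'n \<Rightarrow> real) \<Rightarrow> bool" where
  "test_fun \<Omega> \<phi> \<longleftrightarrow> smooth \<phi> \<and> compact (closure {x. \<phi> x \<noteq> 0}) \<and> closure {x. \<phi> x \<noteq> 0} \<subseteq> \<Omega>"

definition is_weak_deriv ::
  "(real^'n::finite) set \<Rightarrow> 'n multiindex \<Rightarrow> (real^'n \<Rightarrow> real) \<Rightarrow> (real^'n \<Rightarrow> real) \<Rightarrow> bool" where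
  "is_weak_deriv \<Omega> \<alpha> v g \<longleftrightarrow>
     (\<forall>\<phi>. test_fun \<Omega> \<phi> \<longrightarrow>
        (LINT x|lebesgue_on \<Omega>. v x * mi_deriv \<alpha> \<phi> x)
          = (- 1) ^ mi_order \<alpha> * (LINT x|lebesgue_on \<Omega>. g x * \<phi> x))"

definition sobolev_H :: "nat \<Rightarrow> (real^'n::finite) set \<Rightarrow> (real^'n \<Rightarrow> real) set" where
  "sobolev_H m \<Omega> = {v \<in> L2_fun (lebesgue_on \<Omega>).
     \<forall>\<alpha>. mi_order \<alpha> \<le> m \<longrightarrow> (\<exists>g\<in>L2_fun (lebesgue_on \<Omega>). is_weak_deriv \<Omega> \<alpha> v g)}"

definition weak_deriv ::
  "(real^'n::finite) set \<Rightarrow> 'n multiindex \<Rightarrow> (real^'n \<Rightarrow> real) \<Rightarrow> real^'n \<Rightarrow> real" where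
  "weak_deriv \<Omega> \<alpha> v = (SOME g. g \<in> L2_fun (lebesgue_on \<Omega>) \<and> is_weak_deriv \<Omega> \<alpha> v g)"

definition weak_gradient ::
  "(real^'n::finite) set \<Rightarrow> (real^'n \<Rightarrow> real) \<Rightarrow> real^'n \<Rightarrow> real^'n" where
  "weak_gradient \<Omega> v x = (\<chi> i. weak_deriv \<Omega> (mi_single i 1) v x)"

definition weak_laplacian ::
  "(real^'n::finite) set \<Rightarrow> (real^'n \<Rightarrow> real) \<Rightarrow> real^'n \<Rightarrow> real" where
  "weak_laplacian \<Omega> v x = (\<Sum>i\<in>UNIV. weak_deriv \<Omega> (mi_single i 2) v x)"

text \<open>Pointwise values on the closed domain, through the continuous representative. For a bounded
  Lipschitz domain in dimension 2 or 3 and \<open>v \<in> sobolev_H m \<Omega>\<close> with \<open>m \<ge> 2\<close>, this representative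
  exists by the Sobolev embedding theorem and is unique on \<open>closure \<Omega>\<close>. Pointwise
  values (rather than values almost everywhere on the boundary) are needed since they are composed
  with a merely measurable map into the boundary.\<close>

definition boundary_value :: "(real^'n::finite) set \<Rightarrow> (real^'n \<Rightarrow> real) \<Rightarrow> real^'n \<Rightarrow> real" where
  "boundary_value \<Omega> v =
     (SOME w. continuous_on (closure \<Omega>) w \<and> (AE x in lebesgue_on \<Omega>. w x = v x))"

definition poisson_solution ::
  "(real^'n::finite) set \<Rightarrow> (real^'n \<Rightarrow> real) \<Rightarrow> (real^'n \<Rightarrow> real) \<Rightarrow> (real^'n \<Rightarrow> real) \<Rightarrow> bool" where
  "poisson_solution \<Omega> f uD u \<longleftrightarrow>
     (AE x in lebesgue_on \<Omega>. - weak_laplacian \<Omega> u x = f x) \<and>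
     (\<forall>x\<in>frontier \<Omega>. boundary_value \<Omega> u x = uD x)"


section \<open>Domains and meshes\<close>

text \<open>Near each boundary point the set is the part of a ball above the graph of a Lipschitz
  function, in the coordinates given by the hyperplane orthogonal to \<open>e\<close> and the height along
  \<open>e\<close>; \<open>y - (y \<bullet> e) *\<^sub>R e\<close> is the orthogonal projection of \<open>y\<close> onto that hyperplane.\<close>

definition lipschitz_boundary :: "(real^'n::finite) set \<Rightarrow> bool" where
  "lipschitz_boundary \<Omega> \<longleftrightarrow>
     (\<forall>x\<in>frontier \<Omega>. \<exists>r>0. \<exists>e L \<gamma>. norm e = 1 \<and> L-lipschitz_on UNIV (\<gamma> :: real^'n \<Rightarrow> real) \<and>
        (\<forall>y\<in>ball x r. y \<in> \<Omega> \<longleftrightarrow> \<gamma> (y - (y \<bullet> e) *\<^sub>R e) < y \<bullet> e))"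

definition closed_domain :: "(real^'n::finite) set \<Rightarrow> bool" where
  "closed_domain D \<longleftrightarrow> (\<exists>G. open G \<and> connected G \<and> G \<noteq> {} \<and> D = closure G)"

definition conforming_mesh :: "(real^'n::finite) set \<Rightarrow> (real^'n) set set \<Rightarrow> bool" where
  "conforming_mesh D \<T> \<longleftrightarrow>
     triangulation \<T> \<and> (\<forall>T\<in>\<T>. int CARD('n) simplex T) \<and> \<Union>\<T> = D"

definition inradius :: "(real^'n::finite) set \<Rightarrow> real" where
  "inradius T = (SUP r\<in>{r. 0 \<le> r \<and> (\<exists>x. cball x r \<subseteq> T)}. r)"

definition shape_regular :: "real \<Rightarrow> (real^'n::finite) set set \<Rightarrow> bool" where
  "shape_regular \<sigma> \<T> \<longleftrightarrow> (\<forall>T\<in>\<T>. diameter T \<le> \<sigma> * inradius T)"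

definition quasi_uniform :: "real \<Rightarrow> (real^'n::finite) set set \<Rightarrow> bool" where
  "quasi_uniform \<kappa> \<T> \<longleftrightarrow> (\<forall>T\<in>\<T>. \<forall>T'\<in>\<T>. diameter T \<le> \<kappa> * diameter T')"

definition surrogate_mesh :: "(real^'n::finite) set \<Rightarrow> (real^'n) set set \<Rightarrow> (real^'n) set set" where
  "surrogate_mesh \<Omega> \<T> = {T \<in> \<T>. T \<subseteq> closure \<Omega>}"

definition surrogate_domain :: "(real^'n::finite) set \<Rightarrow> (real^'n) set set \<Rightarrow> (real^'n) set" where
  "surrogate_domain \<Omega> \<T> = interior (\<Union>(surrogate_mesh \<Omega> \<T>))"

definition surrogate_boundary :: "(real^'n::finite) set \<Rightarrow> (real^'n) set set \<Rightarrow> (real^'n) set" where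
  "surrogate_boundary \<Omega> \<T> = frontier (surrogate_domain \<Omega> \<T>)"

text \<open>The sides forming the surrogate boundary, each paired with the element it belongs to. That
  element is unique, as a side shared by two elements of the surrogate mesh is not contained in the
  surrogate boundary.\<close>

definition boundary_sides ::
  "(real^'n::finite) set \<Rightarrow> (real^'n) set set \<Rightarrow> ((real^'n) set \<times> (real^'n) set) set" where
  "boundary_sides \<Omega> \<T> =
     {(T, F). T \<in> surrogate_mesh \<Omega> \<T> \<and> F facet_of T \<and> F \<subseteq> surrogate_boundary \<Omega> \<T>}"


section \<open>Normals, surface measure and traces on the sides of a simplex\<close>

definition outer_normal :: "(real^'n::finite) set \<Rightarrow> (real^'n) set \<Rightarrow> real^'n" where
  "outer_normal T F =
     (THE n. norm n = 1 \<and> (\<exists>c. (\<forall>x\<in>F. n \<bullet> x = c) \<and> (\<forall>x\<in>T. n \<bullet> x \<le> c)))"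

text \<open>The surface measure of a part \<open>A\<close> of the flat side \<open>F\<close> is the Lebesgue measure of the right
  prism of height 1 over \<open>A\<close>. So the measure on \<open>F\<close> is the image of the Lebesgue measure on
  the prism over \<open>F\<close> under the orthogonal projection onto the hyperplane \<open>{x. n \<bullet> x = c}\<close> of \<open>F\<close>.\<close>

definition side_measure :: "(real^'n::finite) set \<Rightarrow> (real^'n) set \<Rightarrow> (real^'n) measure" where
  "side_measure T F =
     (let n = outer_normal T F;
          c = n \<bullet> (SOME p. p \<in> F);
          P = (\<lambda>x. x - (n \<bullet> x - c) *\<^sub>R n)
      in completion
           (distr (restrict_space lborel {x. c \<le> n \<bullet> x \<and> n \<bullet> x \<le> c + 1 \<and> P x \<in> F}) borel P))"

text \<open>The trace on the side \<open>F\<close> of \<open>g \<in> sobolev_H 1 (interior T)\<close>: the extension by density of the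
  restriction of smooth functions, continuous from \<open>H\<^sup>1(T)\<close> to \<open>L\<^sup>2(F)\<close>.\<close>

definition is_trace ::
  "(real^'n::finite) set \<Rightarrow> (real^'n) set \<Rightarrow> (real^'n \<Rightarrow> real) \<Rightarrow> (real^'n \<Rightarrow> real) \<Rightarrow> bool" where
  "is_trace T F g t \<longleftrightarrow>
     t \<in> L2_fun (side_measure T F) \<and>
     (\<exists>\<phi> :: nat \<Rightarrow> real^'n \<Rightarrow> real.
        (\<forall>m. smooth (\<phi> m)) \<and>
        (\<lambda>m. LINT x|lebesgue_on (interior T). (\<phi> m x - g x)\<^sup>2) \<longlonglongrightarrow> 0 \<and>
        (\<lambda>m. LINT x|lebesgue_on (interior T).
               (norm (gradient (\<phi> m) x - weak_gradient (interior T) g x))\<^sup>2) \<longlonglongrightarrow> 0 \<and>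
        (\<lambda>m. LINT x|side_measure T F. (\<phi> m x - t x)\<^sup>2) \<longlonglongrightarrow> 0)"

definition trace ::
  "(real^'n::finite) set \<Rightarrow> (real^'n) set \<Rightarrow> (real^'n \<Rightarrow> real) \<Rightarrow> real^'n \<Rightarrow> real" where
  "trace T F g = (SOME t. is_trace T F g t)"


section \<open>The discrete space and the shift operator\<close>

text \<open>Discrete functions live on the open surrogate domain. Their values and derivatives on the
  surrogate boundary are those of the polynomials \<open>elem_poly k T v\<close>.\<close>

definition fe_space ::
  "nat \<Rightarrow> (real^'n::finite) set \<Rightarrow> (real^'n) set set \<Rightarrow> (real^'n \<Rightarrow> real) set" where
  "fe_space k \<Omega> \<T> = {v. continuous_on (surrogate_domain \<Omega> \<T>) v \<and>
     (\<forall>T\<in>surrogate_mesh \<Omega> \<T>. \<exists>p\<in>polys k. \<forall>x\<in>T \<inter> surrogate_domain \<Omega> \<T>. v x = p x)}"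

definition elem_poly ::
  "nat \<Rightarrow> (real^'n::finite) set \<Rightarrow> (real^'n \<Rightarrow> real) \<Rightarrow> real^'n \<Rightarrow> real" where
  "elem_poly k T v = (THE p. p \<in> polys k \<and> (\<forall>x\<in>interior T. v x = p x))"

definition dir_deriv ::
  "nat \<Rightarrow> real^'n::finite \<Rightarrow> (real^'n \<Rightarrow> real) \<Rightarrow> real^'n \<Rightarrow> real" where
  "dir_deriv i \<delta> v x =
     (\<Sum>\<alpha> | mi_order \<alpha> = i. fact i / mi_fact \<alpha> * mi_deriv \<alpha> v x * mi_power \<delta> \<alpha>)"

definition shift ::
  "nat \<Rightarrow> (real^'n::finite \<Rightarrow> real^'n) \<Rightarrow> (real^'n) set \<Rightarrow> (real^'n \<Rightarrow> real) \<Rightarrow> real^'n \<Rightarrow> real" where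
  "shift k \<delta> T v x =
     elem_poly k T v x + (\<Sum>i=1..k. dir_deriv i (\<delta> x) (elem_poly k T v) x / fact i)"


section \<open>The forms\<close>

definition inner_vol ::
  "(real^'n::finite) set \<Rightarrow> (real^'n) set set \<Rightarrow>
   (real^'n \<Rightarrow> 'b::euclidean_space) \<Rightarrow> (real^'n \<Rightarrow> 'b) \<Rightarrow> real" where
  "inner_vol \<Omega> \<T> p q = (LINT x|lebesgue_on (surrogate_domain \<Omega> \<T>). p x \<bullet> q x)"

text \<open>Functions on the surrogate boundary are given side by side, as functions of the element \<open>T\<close>,
  its side \<open>F\<close> and the point.\<close>

type_synonym 'n side_fun = "(real^'n) set \<Rightarrow> (real^'n) set \<Rightarrow> real^'n \<Rightarrow> real"

definition inner_bd ::
  "(real^'n::finite) set \<Rightarrow> (real^'n) set set \<Rightarrow> 'n side_fun \<Rightarrow> 'n side_fun \<Rightarrow> real" where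
  "inner_bd \<Omega> \<T> p q =
     (\<Sum>(T, F)\<in>boundary_sides \<Omega> \<T>. LINT x|side_measure T F. p T F x * q T F x)"

definition discrete_bd :: "nat \<Rightarrow> (real^'n::finite \<Rightarrow> real) \<Rightarrow> 'n side_fun" where
  "discrete_bd k v = (\<lambda>T F. elem_poly k T v)"

definition discrete_flux :: "nat \<Rightarrow> (real^'n::finite \<Rightarrow> real) \<Rightarrow> 'n side_fun" where
  "discrete_flux k v = (\<lambda>T F x. gradient (elem_poly k T v) x \<bullet> outer_normal T F)"

definition sobolev_flux :: "(real^'n::finite) set \<Rightarrow> (real^'n \<Rightarrow> real) \<Rightarrow> 'n side_fun" where
  "sobolev_flux \<Omega> v = (\<lambda>T F x.
     (\<chi> i. trace T F (weak_deriv \<Omega> (mi_single i 1) v) x) \<bullet> outer_normal T F)"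

definition a_form ::
  "nat \<Rightarrow> (real^'n::finite) set \<Rightarrow> (real^'n) set set \<Rightarrow> (real^'n \<Rightarrow> real^'n) \<Rightarrow>
   (real^'n \<Rightarrow> real) \<Rightarrow> (real^'n \<Rightarrow> real) \<Rightarrow> real" where
  "a_form k \<Omega> \<T> M v w =
     inner_vol \<Omega> \<T> (gradient v) (gradient w)
     - inner_bd \<Omega> \<T> (discrete_flux k v) (discrete_bd k w)
     + inner_bd \<Omega> \<T> (\<lambda>T F. shift k (\<lambda>x. M x - x) T v) (discrete_flux k w)"

definition l_form ::
  "nat \<Rightarrow> (real^'n::finite) set \<Rightarrow> (real^'n) set set \<Rightarrow> (real^'n \<Rightarrow> real^'n) \<Rightarrow>
   (real^'n \<Rightarrow> real) \<Rightarrow> (real^'n \<Rightarrow> real) \<Rightarrow> (real^'n \<Rightarrow> real) \<Rightarrow> real" where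
  "l_form k \<Omega> \<T> M f uD w =
     inner_vol \<Omega> \<T> f w + inner_bd \<Omega> \<T> (\<lambda>T F. uD \<circ> M) (discrete_flux k w)"

text \<open>The first argument of the extended form is either a discrete function or a Sobolev function
  on \<open>\<Omega>\<close>; the tag selects how its gradient, normal derivative and composition with \<open>M\<close> are
  understood. A tag is necessary: a function on the whole space may belong to both spaces, with
  different compositions with \<open>M\<close> (it may be polynomial on the surrogate domain only). For a
  discrete function \<open>gradient\<close> is the elementwise gradient, defined off the null set of element
  boundaries.\<close>

datatype ('n::finite) trial = Discrete "real^'n \<Rightarrow> real" | Sobolev "real^'n \<Rightarrow> real"

fun trial_gradient :: "(real^'n::finite) set \<Rightarrow> 'n trial \<Rightarrow> real^'n \<Rightarrow> real^'n" where
  "trial_gradient \<Omega> (Discrete v) = gradient v"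
| "trial_gradient \<Omega> (Sobolev v) = weak_gradient \<Omega> v"

fun trial_flux :: "nat \<Rightarrow> (real^'n::finite) set \<Rightarrow> 'n trial \<Rightarrow> 'n side_fun" where
  "trial_flux k \<Omega> (Discrete v) = discrete_flux k v"
| "trial_flux k \<Omega> (Sobolev v) = sobolev_flux \<Omega> v"

fun trial_comp ::
  "nat \<Rightarrow> (real^'n::finite) set \<Rightarrow> (real^'n \<Rightarrow> real^'n) \<Rightarrow> 'n trial \<Rightarrow> 'n side_fun" where
  "trial_comp k \<Omega> M (Discrete v) = (\<lambda>T F. elem_poly k T v \<circ> M)"
| "trial_comp k \<Omega> M (Sobolev v) = (\<lambda>T F. boundary_value \<Omega> v \<circ> M)"

definition ahat_form ::
  "nat \<Rightarrow> (real^'n::finite) set \<Rightarrow> (real^'n) set set \<Rightarrow> (real^'n \<Rightarrow> real^'n) \<Rightarrow>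
   'n trial \<Rightarrow> (real^'n \<Rightarrow> real) \<Rightarrow> real" where
  "ahat_form k \<Omega> \<T> M v w =
     inner_vol \<Omega> \<T> (trial_gradient \<Omega> v) (gradient w)
     - inner_bd \<Omega> \<T> (trial_flux k \<Omega> v) (discrete_bd k w)
     + inner_bd \<Omega> \<T> (trial_comp k \<Omega> M v) (discrete_flux k w)"

end

theory Submission
  imports Defs
begin

text \<open>Part (i) is Taylor's formula, which is exact for polynomials of degree at most \<open>k\<close>.

  For part (ii), \<open>u\<close> is in \<open>H\<^sup>2(\<Omega>)\<close>, so that Green's formula holds on every element of the surrogate
  mesh for \<open>\<nabla>u\<close> and the polynomial \<open>w|\<^sub>T\<close>. It is obtained from the divergence theorem for smooth functions
  (integrate against \<open>\<Prod>\<^sub>F min 1 (m dist(x, F))\<close> and let \<open>m \<rightarrow> \<infinity>\<close>), the density of smooth functions in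
  \<open>H\<^sup>1(T)\<close> (average over dilations of \<open>T\<close> towards interior points) and the trace inequality (divergence
  theorem for \<open>(x - a) \<phi>\<^sup>2\<close> with \<open>a\<close> interior to \<open>T\<close>). In the sum over the elements, a side that is not in
  the surrogate boundary belongs to exactly two elements, with opposite normals. Its two contributions cancel: test
  functions supported in the two elements show that the traces of the weakly differentiable \<open>\<nabla>u\<close> from both
  sides agree. Here \<open>interior (closure \<Omega>) \<subseteq> \<Omega>\<close> is needed, which follows from the Lipschitz
  boundary. The remaining sides give the boundary term, and \<open>u = u\<^sub>D\<close> on \<open>\<Gamma>\<close> yields the rest.\<close>

section \<open>Smooth functions\<close>

text \<open>Weak derivatives and traces are picked by Hilbert choice, so \<open>trace T F\<close>
  and \<open>trace T' F\<close> on a common side are a priori unrelated; only the weak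
  differentiability of \<open>\<nabla>u\<close> across the side connects them. Green's formula is
  therefore proved for arbitrary smooth weights: a weight localised near one side isolates the
  boundary term of that side. Mollification near the boundary of \<open>T\<close> would use values
  outside \<open>T\<close>. An average over dilations towards interior points of a convex set
  evaluates the function only inside, and the shifted kernels are still test functions there. The
  surface measure is defined through prisms of height 1. The derivative of the cutoff lives on
  layers of thickness \<open>1 / m\<close> and carries the factor \<open>m\<close>; stacking
  \<open>m\<close> translates of such a layer fills the prism, which turns volume integrals into
  surface integrals. Functions are changed on null sets throughout. All measures in the forms are
  complete, so this affects neither measurability nor integrals, and a product that is not
  integrable keeps the default integral 0 on both sides of an equation.\<close>

lemma smooth_coinduct:
  assumes "f \<in> S" "\<And>g x. g \<in> S \<Longrightarrow> g differentiable (at x)"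
    and "\<And>g i. g \<in> S \<Longrightarrow> partial_deriv i g \<in> S"
  shows "smooth f"
proof -
  have "foldr partial_deriv js f \<in> S" for js
    by (induction js) (use assms in auto)
  with assms(2) show ?thesis
    unfolding smooth_def by blast
qed

lemma smooth_differentiable: "smooth f \<Longrightarrow> f differentiable (at x)"
  unfolding smooth_def by (metis foldr.simps(1) id_apply)

lemma smooth_partial_deriv: "smooth f \<Longrightarrow> smooth (partial_deriv i f)"
  (is "_ \<Longrightarrow> ?thesis")
proof -
  have "foldr partial_deriv js (partial_deriv i f) = foldr partial_deriv (js @ [i]) f" for js
    by simp
  then show "smooth f \<Longrightarrow> ?thesis"
    unfolding smooth_def by presburger
qed

lemma partial_deriv_eqI:
  assumes "(f has_derivative f') (at x)"
  shows "partial_deriv i f x = f' (axis i 1)"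
  using frechet_derivative_at[OF assms] by (simp add: partial_deriv_def)

lemma differentiable_has_derivative_partial:
  fixes f :: "real^'n::finite \<Rightarrow> real"
  assumes "f differentiable (at x)"
  shows "(f has_derivative (\<lambda>h. \<Sum>i\<in>UNIV. partial_deriv i f x * h $ i)) (at x)"
proof -
  have D: "(f has_derivative frechet_derivative f (at x)) (at x)"
    using assms by (simp add: frechet_derivative_works)
  then have lin: "linear (frechet_derivative f (at x))"
    by (rule has_derivative_linear)
  have "frechet_derivative f (at x) h = (\<Sum>i\<in>UNIV. partial_deriv i f x * h $ i)" for h
  proof -
    have "h = (\<Sum>i\<in>UNIV. h $ i *\<^sub>R axis i 1)"
      by (metis basis_expansion scalar_mult_eq_scaleR)
    then have "frechet_derivative f (at x) h = frechet_derivative f (at x) (\<Sum>i\<in>UNIV. h $ i *\<^sub>R axis i 1)"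
      by simp
    then show ?thesis
      by (simp add: linear_sum[OF lin] linear_cmul[OF lin] partial_deriv_def mult.commute)
  qed
  then have "frechet_derivative f (at x) = (\<lambda>h. \<Sum>i\<in>UNIV. partial_deriv i f x * h $ i)"
    by (rule ext)
  with D show ?thesis
    by simp
qed

lemmas smooth_has_derivative = differentiable_has_derivative_partial[OF smooth_differentiable]

lemma has_derivative_axis_has_real_derivative:
  fixes f :: "real^'n::finite \<Rightarrow> real"
  assumes "f differentiable (at (x + t *\<^sub>R axis i 1))"
  shows "((\<lambda>t. f (x + t *\<^sub>R axis i 1)) has_real_derivative partial_deriv i f (x + t *\<^sub>R axis i 1)) (at t)"
proof -
  let ?y = "x + t *\<^sub>R axis i 1"
  have D: "(f has_derivative frechet_derivative f (at ?y)) (at ?y)"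
    using assms by (simp add: frechet_derivative_works)
  then have lin: "linear (frechet_derivative f (at ?y))"
    by (rule has_derivative_linear)
  have "((\<lambda>t. x + t *\<^sub>R axis i 1) has_derivative (\<lambda>h. h *\<^sub>R axis i 1)) (at t)"
    by (auto intro!: derivative_eq_intros)
  from has_derivative_compose[OF this D] show ?thesis
    by (simp add: has_field_derivative_def linear_cmul[OF lin] partial_deriv_def mult.commute[of _ "partial_deriv _ _ _"]
        mult_commute_abs)
qed

lemma smooth_continuous_on: "smooth f \<Longrightarrow> continuous_on S f"
  by (meson differentiable_imp_continuous_within smooth_differentiable continuous_at_imp_continuous_on)

lemma smooth_borel_measurable: "smooth f \<Longrightarrow> f \<in> borel_measurable borel"
  by (intro borel_measurable_continuous_onI smooth_continuous_on)

lemma partial_deriv_const: "partial_deriv i (\<lambda>x. c) = (\<lambda>x. 0)"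
  by (rule ext, subst partial_deriv_eqI[where f' = "\<lambda>h. 0"]) auto

lemma partial_deriv_add:
  "f differentiable (at x) \<Longrightarrow> g differentiable (at x) \<Longrightarrow>
   partial_deriv i (\<lambda>x. f x + g x) x = partial_deriv i f x + partial_deriv i g x"
  unfolding partial_deriv_def
  by (intro partial_deriv_eqI[unfolded partial_deriv_def, THEN trans] has_derivative_add)
     (auto simp: frechet_derivative_works)

lemma partial_deriv_mult:
  fixes f g :: "real^'n::finite \<Rightarrow> real"
  assumes "f differentiable (at x)" "g differentiable (at x)"
  shows "partial_deriv i (\<lambda>x. f x * g x) x = f x * partial_deriv i g x + partial_deriv i f x * g x"
  unfolding partial_deriv_def using assms
  by (intro partial_deriv_eqI[unfolded partial_deriv_def, THEN trans] has_derivative_mult)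
     (auto simp: frechet_derivative_works)

lemma smooth_const: "smooth (\<lambda>x::real^'n::finite. c)"
  by (rule smooth_coinduct[where S = "range (\<lambda>c x. c)"]) (auto simp: partial_deriv_const)

text \<open>The invariant set for \<open>smooth_coinduct\<close>. The product rule turns a product
  into a sum of products, so products alone are not closed under differentiation, while the ring
  generated by the smooth functions is.\<close>

inductive_set ring_closure :: "(real^'n::finite \<Rightarrow> real) set" where
  "smooth f \<Longrightarrow> f \<in> ring_closure"
| "f \<in> ring_closure \<Longrightarrow> g \<in> ring_closure \<Longrightarrow> (\<lambda>x. f x + g x) \<in> ring_closure"
| "f \<in> ring_closure \<Longrightarrow> g \<in> ring_closure \<Longrightarrow> (\<lambda>x. f x * g x) \<in> ring_closure"

lemma ring_closure_differentiable: "f \<in> ring_closure \<Longrightarrow> f differentiable (at x)"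
  by (induction rule: ring_closure.induct) (auto intro: smooth_differentiable)

lemma smooth_ring_closure:
  assumes "f \<in> ring_closure"
  shows "smooth f"
proof (rule smooth_coinduct[OF assms ring_closure_differentiable])
  fix g :: "real^'n \<Rightarrow> real" and i
  assume "g \<in> ring_closure"
  then show "partial_deriv i g \<in> ring_closure"
  proof (induction rule: ring_closure.induct)
    case (1 f)
    then show ?case by (intro ring_closure.intros smooth_partial_deriv)
  next
    case (2 f g)
    have "partial_deriv i (\<lambda>x. f x + g x) = (\<lambda>x. partial_deriv i f x + partial_deriv i g x)"
      by (rule ext) (intro partial_deriv_add ring_closure_differentiable 2)
    then show ?case using 2 by (auto intro: ring_closure.intros)
  next
    case (3 f g)
    have "partial_deriv i (\<lambda>x. f x * g x) = (\<lambda>x. f x * partial_deriv i g x + partial_deriv i f x * g x)"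
      by (rule ext) (intro partial_deriv_mult ring_closure_differentiable 3)
    then show ?case using 3 by (auto intro!: ring_closure.intros(2,3))
  qed
qed

lemma smooth_add: "smooth f \<Longrightarrow> smooth g \<Longrightarrow> smooth (\<lambda>x. f x + g x)"
  by (intro smooth_ring_closure ring_closure.intros(2)) (auto intro: ring_closure.intros(1))

lemma smooth_mult: "smooth f \<Longrightarrow> smooth g \<Longrightarrow> smooth (\<lambda>x. f x * g x)"
  by (intro smooth_ring_closure ring_closure.intros(3)) (auto intro: ring_closure.intros(1))

lemma smooth_cmult: "smooth f \<Longrightarrow> smooth (\<lambda>x. c * f x)"
  by (intro smooth_mult smooth_const)

lemma smooth_diff:
  assumes "smooth f" "smooth g" shows "smooth (\<lambda>x. f x - g x)"
  using smooth_add[OF assms(1) smooth_cmult[OF assms(2), of "-1"]] by simp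

lemma smooth_sum: "(\<And>j. j \<in> J \<Longrightarrow> smooth (f j)) \<Longrightarrow> smooth (\<lambda>x. \<Sum>j\<in>J. f j x)"
  by (induction J rule: infinite_finite_induct) (auto intro: smooth_const smooth_add)

lemma smooth_prod: "(\<And>j. j \<in> J \<Longrightarrow> smooth (f j)) \<Longrightarrow> smooth (\<lambda>x. \<Prod>j\<in>J. f j x)"
  by (induction J rule: infinite_finite_induct) (auto intro: smooth_const smooth_mult)

lemma smooth_power: "smooth f \<Longrightarrow> smooth (\<lambda>x. f x ^ m)"
  by (induction m) (auto intro: smooth_const smooth_mult)

lemma partial_deriv_coord: "partial_deriv i (\<lambda>x::real^'n::finite. x $ j) = (\<lambda>x. if i = j then 1 else 0)"
  by (rule ext, subst partial_deriv_eqI[where f' = "\<lambda>h. h $ j"])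
     (auto simp: axis_def intro: bounded_linear_imp_has_derivative bounded_linear_vec_nth)

lemma smooth_coord: "smooth (\<lambda>x::real^'n::finite. x $ j)"
proof (rule smooth_coinduct[where S = "insert (\<lambda>x. x $ j) (range (\<lambda>c x. c))"])
  fix g :: "real^'n \<Rightarrow> real" and x
  assume "g \<in> insert (\<lambda>x. x $ j) (range (\<lambda>c x. c))"
  then show "g differentiable at x"
    by (auto intro: bounded_linear_imp_differentiable bounded_linear_vec_nth)
qed (auto simp: partial_deriv_const partial_deriv_coord)

lemma partial_deriv_affine_comp:
  fixes f :: "real^'n::finite \<Rightarrow> real"
  assumes "f differentiable (at (a *\<^sub>R x + b))"
  shows "partial_deriv i (\<lambda>x. f (a *\<^sub>R x + b)) x = a * partial_deriv i f (a *\<^sub>R x + b)"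
proof -
  let ?y = "a *\<^sub>R x + b"
  have D: "(f has_derivative frechet_derivative f (at ?y)) (at ?y)"
    using assms by (simp add: frechet_derivative_works)
  then have lin: "linear (frechet_derivative f (at ?y))"
    by (rule has_derivative_linear)
  have "((\<lambda>x. a *\<^sub>R x + b) has_derivative (\<lambda>h. a *\<^sub>R h)) (at x)"
    by (auto intro!: derivative_eq_intros)
  from has_derivative_compose[OF this D] have
    "partial_deriv i (\<lambda>x. f (a *\<^sub>R x + b)) x = frechet_derivative f (at ?y) (a *\<^sub>R axis i 1)"
    by (rule partial_deriv_eqI)
  then show ?thesis
    by (simp add: linear_cmul[OF lin] partial_deriv_def)
qed

lemma smooth_affine_comp:
  fixes f :: "real^'n::finite \<Rightarrow> real"
  assumes "smooth f"
  shows "smooth (\<lambda>x. f (a *\<^sub>R x + b))"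
\<comment> \<open>The constant \<open>c\<close> collects the powers of \<open>a\<close> that the
  chain rule produces.\<close>
proof (rule smooth_coinduct[where S = "{\<lambda>x. c * g (a *\<^sub>R x + b) | c g. smooth g}"])
  show "(\<lambda>x. f (a *\<^sub>R x + b)) \<in> {\<lambda>x. c * g (a *\<^sub>R x + b) |c g. smooth g}"
    using assms by (intro CollectI exI[of _ 1]) auto
next
  have diff: "(\<lambda>x. g (a *\<^sub>R x + b)) differentiable (at x)" if "smooth g" for g :: "real^'n \<Rightarrow> real" and x
    using differentiable_chain_at[of "\<lambda>x. a *\<^sub>R x + b" x g] smooth_differentiable[OF that]
    by (auto simp: o_def)
  then show "g differentiable (at x)"
    if "g \<in> {\<lambda>x. c * g (a *\<^sub>R x + b) |c g. smooth g}" for g and x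
    using that by auto
  show "partial_deriv i h \<in> {\<lambda>x. c * g (a *\<^sub>R x + b) |c g. smooth g}"
    if h: "h \<in> {\<lambda>x. c * g (a *\<^sub>R x + b) |c g. smooth g}" for h i
  proof -
    obtain c and g :: "real^'n \<Rightarrow> real" where h: "h = (\<lambda>x. c * g (a *\<^sub>R x + b))" and g: "smooth g"
      using h by blast
    have "partial_deriv i h = (\<lambda>x. (c * a) * partial_deriv i g (a *\<^sub>R x + b))"
      by (rule ext) (simp add: h partial_deriv_mult partial_deriv_const partial_deriv_affine_comp
          smooth_differentiable[OF g] diff[OF g])
    with smooth_partial_deriv[OF g] show ?thesis
      by blast
  qed
qed

lemma smooth_mi_power: "smooth (\<lambda>x. mi_power x \<alpha>)"
  unfolding mi_power_def by (intro smooth_prod smooth_power smooth_coord)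

lemma smooth_polys: "p \<in> polys k \<Longrightarrow> smooth p"
proof -
  assume "p \<in> polys k"
  then obtain c where "p = (\<lambda>x. \<Sum>\<alpha> | mi_order \<alpha> \<le> k. c \<alpha> * mi_power x \<alpha>)"
    unfolding polys_def by blast
  then show ?thesis
    by (auto intro!: smooth_sum smooth_cmult smooth_mi_power)
qed

lemma partial_deriv_eq_0_outside:
  assumes "x \<notin> closure {x. f x \<noteq> 0}"
  shows "partial_deriv i f x = 0"
proof -
  have "((\<lambda>x. 0) has_derivative (\<lambda>h. 0)) (at x)" by auto
  then have "(f has_derivative (\<lambda>h. 0)) (at x)"
    by (rule has_derivative_transform_within_open[of _ _ _ _ "- closure {x. f x \<noteq> 0}"])
       (use assms closure_subset[of "{x. f x \<noteq> 0}"] in auto)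
  then show ?thesis
    by (rule partial_deriv_eqI)
qed

lemma closure_support_partial_deriv:
  "closure {x. partial_deriv i f x \<noteq> 0} \<subseteq> closure {x. f x \<noteq> 0}"
  by (rule closure_minimal) (use partial_deriv_eq_0_outside in auto)

lemma closure_support_mono: "(\<And>x. f x = 0 \<Longrightarrow> g x = 0) \<Longrightarrow> closure {x. g x \<noteq> 0} \<subseteq> closure {x. f x \<noteq> 0}"
  by (rule closure_mono) auto

lemma test_fun_partial_deriv: "test_fun \<Omega> \<phi> \<Longrightarrow> test_fun \<Omega> (partial_deriv i \<phi>)"
  unfolding test_fun_def
  using closure_support_partial_deriv[of i \<phi>] closed_Int_compact[of "closure {x. partial_deriv i \<phi> x \<noteq> 0}" "closure {x. \<phi> x \<noteq> 0}"]
  by (auto simp: smooth_partial_deriv Int_absorb2)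

lemma test_fun_mult:
  assumes "test_fun \<Omega> \<phi>" "smooth f"
  shows "test_fun \<Omega> (\<lambda>x. f x * \<phi> x)"
  using assms closure_support_mono[of \<phi> "\<lambda>x. f x * \<phi> x"]
    closed_Int_compact[of "closure {x. f x * \<phi> x \<noteq> 0}" "closure {x. \<phi> x \<noteq> 0}"]
  unfolding test_fun_def
  by (auto simp: smooth_mult Int_absorb2)

lemma test_fun_mono: "test_fun \<Omega> \<phi> \<Longrightarrow> \<Omega> \<subseteq> \<Omega>' \<Longrightarrow> test_fun \<Omega>' \<phi>"
  unfolding test_fun_def by auto

lemma bounded_continuous_compact_support:
  fixes \<phi> :: "'a::euclidean_space \<Rightarrow> real"
  assumes "continuous_on UNIV \<phi>" "compact (closure {x. \<phi> x \<noteq> 0})"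
  obtains B where "B > 0" "\<And>x. \<bar>\<phi> x\<bar> \<le> B"
proof -
  have "bounded (\<phi> ` closure {x. \<phi> x \<noteq> 0})"
    by (intro compact_imp_bounded compact_continuous_image assms continuous_on_subset[OF assms(1)]) auto
  then obtain B where B: "B > 0" "\<And>x. x \<in> closure {x. \<phi> x \<noteq> 0} \<Longrightarrow> \<bar>\<phi> x\<bar> \<le> B"
    by (force simp: bounded_pos)
  have "\<bar>\<phi> x\<bar> \<le> B" for x
    using B closure_subset[of "{x. \<phi> x \<noteq> 0}"] by (cases "\<phi> x = 0") auto
  with B(1) show ?thesis using that by blast
qed

lemma smooth_lipschitz_on_convex:
  fixes \<phi> :: "real^'n::finite \<Rightarrow> real"
  assumes "smooth \<phi>" "convex S" "\<And>i. bounded (partial_deriv i \<phi> ` S)"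
  obtains L where "L > 0" "\<And>x y. x \<in> S \<Longrightarrow> y \<in> S \<Longrightarrow> \<bar>\<phi> x - \<phi> y\<bar> \<le> L * norm (x - y)"
proof -
  have "\<exists>B>0. \<forall>x\<in>S. \<bar>partial_deriv i \<phi> x\<bar> \<le> B" for i
    using assms(3)[of i] by (auto simp: bounded_pos)
  then obtain B where B: "\<And>i. B i > 0" "\<And>i x. x \<in> S \<Longrightarrow> \<bar>partial_deriv i \<phi> x\<bar> \<le> B i" by metis
  define L where "L = (\<Sum>i\<in>UNIV. B i)"
  have "L > 0" unfolding L_def by (intro sum_pos) (use B in auto)
  moreover have "\<bar>\<phi> x - \<phi> y\<bar> \<le> L * norm (x - y)" if "x \<in> S" "y \<in> S" for x y
  proof -
    have "norm (\<phi> x - \<phi> y) \<le> L * norm (x - y)"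
    proof (rule differentiable_bound[OF assms(2) _ _ that])
      fix x assume x: "x \<in> S"
      show "(\<phi> has_derivative (\<lambda>h. \<Sum>i\<in>UNIV. partial_deriv i \<phi> x * h $ i)) (at x within S)"
        by (rule has_derivative_at_withinI[OF smooth_has_derivative[OF assms(1)]])
      show "onorm (\<lambda>h. \<Sum>i\<in>UNIV. partial_deriv i \<phi> x * h $ i) \<le> L"
      proof (rule onorm_bound)
        fix h :: "real^'n"
        have "norm (\<Sum>i\<in>UNIV. partial_deriv i \<phi> x * h $ i) \<le> (\<Sum>i\<in>UNIV. B i * norm h)"
          by (rule order.trans[OF norm_sum sum_mono])
             (auto simp: abs_mult B x less_imp_le component_le_norm_cart intro!: mult_mono)
        then show "norm (\<Sum>i\<in>UNIV. partial_deriv i \<phi> x * h $ i) \<le> L * norm h"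
          by (simp add: L_def sum_distrib_right)
      qed (use \<open>L > 0\<close> in auto)
    qed
    then show ?thesis by simp
  qed
  ultimately show ?thesis using that by blast
qed

lemma bounded_range_compact_support:
  fixes \<phi> :: "'a::euclidean_space \<Rightarrow> real"
  assumes "continuous_on UNIV \<phi>" "compact (closure {x. \<phi> x \<noteq> 0})"
  shows "bounded (range \<phi>)"
  using bounded_continuous_compact_support[OF assms] by (auto simp: bounded_iff)

lemma smooth_compact_support_lipschitz:
  fixes \<phi> :: "real^'n::finite \<Rightarrow> real"
  assumes "smooth \<phi>" "compact (closure {x. \<phi> x \<noteq> 0})"
  obtains L where "L > 0" "\<And>x y. \<bar>\<phi> x - \<phi> y\<bar> \<le> L * norm (x - y)"
proof -
  have "test_fun UNIV (partial_deriv i \<phi>)" for i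
    using assms by (intro test_fun_partial_deriv) (auto simp: test_fun_def)
  then have "bounded (range (partial_deriv i \<phi>))" for i
    by (intro bounded_range_compact_support smooth_continuous_on) (auto simp: test_fun_def)
  then obtain L where "L > 0" "\<And>x y. x \<in> UNIV \<Longrightarrow> y \<in> UNIV \<Longrightarrow> \<bar>\<phi> x - \<phi> y\<bar> \<le> L * norm (x - y)"
    using smooth_lipschitz_on_convex[OF assms(1) convex_UNIV] by metis
  then show ?thesis by (intro that) auto
qed

lemma smooth_lipschitz_on_compact_convex:
  fixes \<phi> :: "real^'n::finite \<Rightarrow> real"
  assumes "smooth \<phi>" "compact S" "convex S"
  obtains L where "L > 0" "\<And>x y. x \<in> S \<Longrightarrow> y \<in> S \<Longrightarrow> \<bar>\<phi> x - \<phi> y\<bar> \<le> L * norm (x - y)"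
proof -
  have "bounded (partial_deriv i \<phi> ` S)" for i
    by (intro compact_imp_bounded compact_continuous_image smooth_continuous_on smooth_partial_deriv assms)
  then show ?thesis
    using smooth_lipschitz_on_convex[OF assms(1,3)] that by metis
qed

lemma partial_deriv_commute:
  fixes f :: "real^'n::finite \<Rightarrow> real"
  assumes "smooth f"
  shows "partial_deriv i (partial_deriv j f) x = partial_deriv j (partial_deriv i f) x"
proof -
  \<comment> \<open>Both mixed derivatives are limits of the second difference quotient.\<close>
  have main: "\<exists>y. norm (y - x) \<le> 2 * h \<and>
      f (x + h *\<^sub>R axis i 1 + h *\<^sub>R axis j 1) - f (x + h *\<^sub>R axis i 1) - f (x + h *\<^sub>R axis j 1) + f x
        = h * h * partial_deriv j (partial_deriv i f) y" if h: "h > 0" for h :: real and i j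
  proof -
    \<comment> \<open>The increment in direction \<open>j\<close> as a function of the displacement
      in direction \<open>i\<close>. The mean value theorem is applied to it in direction
      \<open>i\<close> and then to \<open>partial_deriv i f\<close> in direction \<open>j\<close>;
      both intermediate displacements are below \<open>h\<close>, whence the distance
      \<open>2 * h\<close>.\<close>
    define g where "g = (\<lambda>t. f ((x + h *\<^sub>R axis j 1) + t *\<^sub>R axis i 1) - f (x + t *\<^sub>R axis i 1))"
    have "\<exists>s. 0 < s \<and> s < h \<and> g h - g 0 = (h - 0) *
        (partial_deriv i f ((x + h *\<^sub>R axis j 1) + s *\<^sub>R axis i 1) - partial_deriv i f (x + s *\<^sub>R axis i 1))"
      unfolding g_def using h
      by (intro MVT2) (auto intro!: DERIV_diff has_derivative_axis_has_real_derivative smooth_differentiable assms)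
    then obtain s where s: "0 < s" "s < h" and gs: "g h - g 0 = h *
        (partial_deriv i f ((x + h *\<^sub>R axis j 1) + s *\<^sub>R axis i 1) - partial_deriv i f (x + s *\<^sub>R axis i 1))"
      by auto
    define k where "k = (\<lambda>t. partial_deriv i f ((x + s *\<^sub>R axis i 1) + t *\<^sub>R axis j 1))"
    have "\<exists>r. 0 < r \<and> r < h \<and> k h - k 0 = (h - 0) *
        partial_deriv j (partial_deriv i f) ((x + s *\<^sub>R axis i 1) + r *\<^sub>R axis j 1)"
      unfolding k_def using h
      by (intro MVT2) (auto intro!: has_derivative_axis_has_real_derivative smooth_differentiable smooth_partial_deriv assms)
    then obtain r where r: "0 < r" "r < h" and kr: "k h - k 0 = h *
        partial_deriv j (partial_deriv i f) ((x + s *\<^sub>R axis i 1) + r *\<^sub>R axis j 1)"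
      by auto
    have "norm ((x + s *\<^sub>R axis i 1) + r *\<^sub>R axis j 1 - x) \<le> norm (s *\<^sub>R (axis i 1 :: real^'n)) + norm (r *\<^sub>R (axis j 1 :: real^'n))"
      using norm_triangle_ineq[of "s *\<^sub>R (axis i 1 :: real^'n)" "r *\<^sub>R axis j 1"] by (simp add: algebra_simps)
    also have "\<dots> \<le> 2 * h" using s r by simp
    finally have 1: "norm ((x + s *\<^sub>R axis i 1) + r *\<^sub>R axis j 1 - x) \<le> 2 * h" .
    have "g h - g 0 = h * (k h - k 0)"
      using gs by (simp add: k_def algebra_simps)
    with kr have "g h - g 0 = h * h * partial_deriv j (partial_deriv i f) ((x + s *\<^sub>R axis i 1) + r *\<^sub>R axis j 1)"
      by simp
    with 1 show ?thesis
      by (intro exI[of _ "(x + s *\<^sub>R axis i 1) + r *\<^sub>R axis j 1"]) (simp add: g_def algebra_simps)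
  qed
  define h where "h = (\<lambda>m. 1 / real (Suc m))"
  have h0: "h m > 0" for m by (simp add: h_def)
  have hlim: "h \<longlonglongrightarrow> 0"
    unfolding h_def using LIMSEQ_inverse_real_of_nat by (simp add: inverse_eq_divide)
  define \<Delta> where "\<Delta> = (\<lambda>i j m. f (x + h m *\<^sub>R axis i 1 + h m *\<^sub>R axis j 1) - f (x + h m *\<^sub>R axis i 1) - f (x + h m *\<^sub>R axis j 1) + f x)"
  have lim: "(\<lambda>m. \<Delta> i j m / (h m * h m)) \<longlonglongrightarrow> partial_deriv j (partial_deriv i f) x" for i j
  proof -
    obtain y where y: "\<And>m. norm (y m - x) \<le> 2 * h m"
      and d: "\<And>m. \<Delta> i j m = h m * h m * partial_deriv j (partial_deriv i f) (y m)"
      using main[OF h0, of _ i j] unfolding \<Delta>_def by metis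
    have "(\<lambda>m. y m - x) \<longlonglongrightarrow> 0"
      by (rule Lim_null_comparison[of _ "\<lambda>m. 2 * h m"]) (use y tendsto_mult_right_zero[OF hlim, of 2] in auto)
    then have "y \<longlonglongrightarrow> x" using LIM_zero_iff by blast
    moreover have "isCont (partial_deriv j (partial_deriv i f)) x"
      using assms by (meson differentiable_imp_continuous_within smooth_differentiable smooth_partial_deriv)
    ultimately have "(\<lambda>m. partial_deriv j (partial_deriv i f) (y m)) \<longlonglongrightarrow> partial_deriv j (partial_deriv i f) x"
      by (rule isCont_tendsto_compose[rotated])
    then show ?thesis
      using h0 by (simp add: d less_imp_neq[symmetric])
  qed
  have "\<Delta> i j = \<Delta> j i" by (auto simp: \<Delta>_def algebra_simps)
  with lim[of i j] lim[of j i] show ?thesis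
    by (simp add: LIMSEQ_unique)
qed

section \<open>A bump function and differentiation of convolutions\<close>

text \<open>The derivatives of \<open>t \<mapsto> exp (- 1 / t)\<close> for \<open>t > 0\<close>, all of the form
  polynomial in \<open>1 / t\<close> times \<open>exp (- 1 / t)\<close>, extended by zero.\<close>

definition flat_exp :: "real poly \<Rightarrow> real \<Rightarrow> real" where
  "flat_exp p t = (if t > 0 then poly p (1 / t) * exp (- 1 / t) else 0)"

lemma poly_times_exp_neg_tendsto_0: "((\<lambda>s. poly q s * exp (- s)) \<longlongrightarrow> (0::real)) at_top"
proof -
  have "((\<lambda>s. \<Sum>i\<le>degree q. coeff q i * (s ^ i / exp s)) \<longlongrightarrow> (\<Sum>i\<le>degree q. coeff q i * (0::real))) at_top"
    by (intro tendsto_sum tendsto_mult tendsto_const tendsto_power_div_exp_0)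
  then show ?thesis
    by (simp add: poly_altdef exp_minus sum_distrib_right divide_inverse mult.assoc)
qed

text \<open>With \<open>s = 1 / t\<close> the chain rule gives the derivative
  \<open>s^2 * (p s - p' s) * exp (- s)\<close>, again a polynomial in \<open>s\<close> times
  \<open>exp (- s)\<close>. So the class of these functions is closed under differentiation, and it
  remains to treat \<open>t = 0\<close>.\<close>

lemma flat_exp_has_derivative:
  "(flat_exp p has_real_derivative flat_exp (monom 1 2 * (p - pderiv p)) t) (at t)"
proof -
  consider "t > 0" | "t < 0" | "t = 0" by linarith
  then show ?thesis
  proof cases
    case 1
    have "((\<lambda>t. poly p (1 / t) * exp (- 1 / t)) has_real_derivative
        flat_exp (monom 1 2 * (p - pderiv p)) t) (at t)"
      using 1 by (auto intro!: derivative_eq_intros DERIV_chain'[OF _ poly_DERIV]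
          simp: flat_exp_def poly_monom power2_eq_square field_simps)
    then show ?thesis
      by (rule has_field_derivative_transform_within_open[where S = "{0<..}"])
         (use 1 in \<open>auto simp: flat_exp_def\<close>)
  next
    case 2
    have "((\<lambda>t. 0) has_real_derivative flat_exp (monom 1 2 * (p - pderiv p)) t) (at t)"
      using 2 by (simp add: flat_exp_def)
    then show ?thesis
      by (rule has_field_derivative_transform_within_open[where S = "{..<0}"])
         (use 2 in \<open>auto simp: flat_exp_def\<close>)
  next
    case 3
    \<comment> \<open>Substituting \<open>s = 1 / t\<close> makes the difference quotient
      \<open>s * poly p s * exp (- s)\<close>, which is covered by the limit at infinity for the
      polynomial \<open>monom 1 1 * p\<close>.\<close>
    have "((\<lambda>t. flat_exp p t / t) \<longlongrightarrow> 0) (at_right 0)"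
    proof (subst filterlim_at_right_to_top)
      have "((\<lambda>s. poly (monom 1 1 * p) s * exp (- s)) \<longlongrightarrow> (0::real)) at_top"
        by (rule poly_times_exp_neg_tendsto_0)
      then show "((\<lambda>x. flat_exp p (inverse x) / inverse x) \<longlongrightarrow> 0) at_top"
        by (rule Lim_transform_eventually)
           (use eventually_gt_at_top[of 0] in eventually_elim,
             auto simp: flat_exp_def poly_monom divide_inverse algebra_simps)
    qed
    moreover have "((\<lambda>t. flat_exp p t / t) \<longlongrightarrow> 0) (at_left 0)"
      by (rule Lim_transform_eventually[OF tendsto_const])
         (auto simp: flat_exp_def eventually_at_filter intro: always_eventually)
    ultimately have "((\<lambda>t. flat_exp p t / t) \<longlongrightarrow> 0) (at 0)"
      by (simp add: filterlim_split_at)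
    then show ?thesis
      using 3 by (simp add: has_field_derivative_iff flat_exp_def)
  qed
qed

lemma partial_deriv_flat_exp:
  "((\<lambda>x. flat_exp p (c + d * x $ j)) has_derivative
     (\<lambda>h. d * flat_exp (monom 1 2 * (p - pderiv p)) (c + d * x $ j) * h $ j)) (at x)"
proof -
  have 1: "((\<lambda>x. c + d * x $ j) has_derivative (\<lambda>h. d * h $ j)) (at x)"
    by (auto intro!: derivative_eq_intros bounded_linear_imp_has_derivative bounded_linear_vec_nth)
  from has_derivative_compose[OF 1 flat_exp_has_derivative[unfolded has_field_derivative_def]]
  show ?thesis by (simp add: mult_ac)
qed

lemma smooth_flat_exp: "smooth (\<lambda>x::real^'n::finite. flat_exp p (c + d * x $ j))"
proof (rule smooth_coinduct[where S = "{\<lambda>x. e * flat_exp p (c + d * x $ j) |e p. True}"])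
  show "(\<lambda>x. flat_exp p (c + d * x $ j)) \<in> {\<lambda>x. e * flat_exp p (c + d * x $ j) |e p. True}"
    by (intro CollectI exI[of _ 1] exI[of _ p]) auto
next
  fix g :: "real^'n \<Rightarrow> real" and x
  assume "g \<in> {\<lambda>x. e * flat_exp p (c + d * x $ j) |e p. True}"
  then show "g differentiable at x"
    by (auto intro!: differentiable_mult differentiableI[OF partial_deriv_flat_exp])
next
  fix g :: "real^'n \<Rightarrow> real" and i
  assume "g \<in> {\<lambda>x. e * flat_exp p (c + d * x $ j) |e p. True}"
  then obtain e p where g: "g = (\<lambda>x. e * flat_exp p (c + d * x $ j))" by blast
  have "partial_deriv i g x = (if i = j then e * d else 0) * flat_exp (monom 1 2 * (p - pderiv p)) (c + d * x $ j)" for x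
    unfolding g
    by (subst partial_deriv_eqI[OF has_derivative_mult_right[OF partial_deriv_flat_exp]]) (auto simp: axis_def)
  then show "partial_deriv i g \<in> {\<lambda>x. e * flat_exp p (c + d * x $ j) |e p. True}"
    by blast
qed

lemma continuous_compact_support_integrable:
  fixes \<phi> :: "'a::euclidean_space \<Rightarrow> real"
  assumes "continuous_on UNIV \<phi>" "compact (closure {x. \<phi> x \<noteq> 0})"
  shows "integrable lborel \<phi>"
proof -
  obtain B where B: "\<And>x. \<bar>\<phi> x\<bar> \<le> B" "B > 0"
    using bounded_continuous_compact_support[OF assms] by blast
  let ?S = "closure {x. \<phi> x \<noteq> 0}"
  have "integrable lborel (\<lambda>x. B * indicator ?S x)"
    using emeasure_compact_finite[OF assms(2)]
    by (intro integrable_mult_right integrable_real_indicator) auto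
  then show ?thesis
    by (rule Bochner_Integration.integrable_bound)
       (use B closure_subset[of "{x. \<phi> x \<noteq> 0}"] in
         \<open>auto simp: indicator_def borel_measurable_continuous_onI[OF assms(1)]\<close>)
qed

lemma exists_bump:
  obtains \<rho> :: "real^'n::finite \<Rightarrow> real" where
    "smooth \<rho>" "\<And>x. \<rho> x \<ge> 0" "\<And>x. norm x > 1 \<Longrightarrow> \<rho> x = 0" "closure {x. \<rho> x \<noteq> 0} \<subseteq> cball 0 1"
    "integrable lborel \<rho>" "integral\<^sup>L lborel \<rho> = 1"
proof -
  \<comment> \<open>Half the side of the cube that supports \<open>b\<close>. The norm is at most
    the sum of the moduli of the coordinates, so the cube lies in the unit ball.\<close>
  define r where "r = 1 / real CARD('n)"
  define b :: "real^'n \<Rightarrow> real" where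
    "b = (\<lambda>x. \<Prod>i\<in>UNIV. flat_exp 1 (r + (-1) * x $ i) * flat_exp 1 (r + 1 * x $ i))"
  have r: "r > 0" by (simp add: r_def)
  have smooth: "smooth b"
    unfolding b_def by (intro smooth_prod smooth_mult smooth_flat_exp)
  have nonneg: "b x \<ge> 0" for x
    unfolding b_def by (intro prod_nonneg) (auto simp: flat_exp_def)
  have pos: "b 0 > 0"
    unfolding b_def by (intro prod_pos) (auto simp: flat_exp_def r)
  have zero: "b x = 0" if "norm x > 1" for x
  proof (rule ccontr)
    assume "b x \<noteq> 0"
    then have "\<bar>x $ i\<bar> \<le> r" for i
      by (auto simp: b_def flat_exp_def split: if_splits dest!: spec[of _ i])
    then have "(\<Sum>i\<in>UNIV. \<bar>x $ i\<bar>) \<le> (\<Sum>i\<in>(UNIV::'n set). r)"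
      by (intro sum_mono)
    also have "\<dots> = 1" by (simp add: r_def)
    finally show False
      using norm_le_l1_cart[of x] that by simp
  qed
  have supp: "closure {x. b x \<noteq> 0} \<subseteq> cball 0 1"
    by (rule closure_minimal) (use zero in \<open>auto simp: not_less[symmetric]\<close>)
  have int: "integrable lborel b"
    by (rule continuous_compact_support_integrable[OF smooth_continuous_on[OF smooth]])
       (use supp in \<open>meson bounded_cball bounded_subset closed_closure compact_eq_bounded_closed\<close>)
  \<comment> \<open>Otherwise the nonnegative \<open>b\<close> would vanish almost everywhere,
    although it is nonzero on an open set that contains 0.\<close>
  have "integral\<^sup>L lborel b \<noteq> 0"
  proof
    assume "integral\<^sup>L lborel b = 0"
    then have "AE x in lborel. b x = 0"
      using integral_nonneg_eq_0_iff_AE[OF int] nonneg by auto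
    moreover have "open {x. b x \<noteq> 0}"
      by (intro open_Collect_neq smooth_continuous_on smooth continuous_on_const)
    ultimately have "{x. b x \<noteq> 0} \<in> null_sets lborel"
      by (simp add: AE_iff_null_sets)
    then have "negligible {x. b x \<noteq> 0}"
      by (simp add: negligible_iff_null_sets null_sets_completionI)
    with \<open>open {x. b x \<noteq> 0}\<close> pos show False
      using open_not_negligible by force
  qed
  with Bochner_Integration.integral_nonneg[of lborel b] nonneg have I: "integral\<^sup>L lborel b > 0"
    by (simp add: order_less_le)
  show ?thesis
  proof (rule that[of "\<lambda>x. (1 / integral\<^sup>L lborel b) * b x"])
    show "smooth (\<lambda>x. (1 / integral\<^sup>L lborel b) * b x)" by (rule smooth_cmult[OF smooth])
    show "closure {x. (1 / integral\<^sup>L lborel b) * b x \<noteq> 0} \<subseteq> cball 0 1"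
      using closure_support_mono[of b "\<lambda>x. (1 / integral\<^sup>L lborel b) * b x"] supp by auto
  qed (use I nonneg zero int in auto)
qed

text \<open>Dominated convergence for the difference quotient of the kernel: its remainder is
  bounded uniformly by the Lipschitz constant of \<open>K\<close> and the bounds of its partial
  derivatives, so a multiple of \<open>g\<close> dominates. The coefficients cover two uses:
  \<open>a = 1\<close>, \<open>b = -1\<close> for mollification and \<open>a = - l\<close>,
  \<open>b = 1\<close> for the averages over dilations.\<close>

lemma convolution_has_derivative:
  fixes K g :: "real^'n::finite \<Rightarrow> real"
  assumes K: "smooth K" "compact (closure {x. K x \<noteq> 0})" and g: "integrable lborel g"
  shows "((\<lambda>x. LINT y|lborel. K (a *\<^sub>R x + b *\<^sub>R y) * g y) has_derivative
    (\<lambda>h. \<Sum>i\<in>UNIV. (a * (LINT y|lborel. partial_deriv i K (a *\<^sub>R x + b *\<^sub>R y) * g y)) * h $ i)) (at x)"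
proof -
  obtain L where L: "L > 0" "\<And>x y. \<bar>K x - K y\<bar> \<le> L * norm (x - y)"
    using smooth_compact_support_lipschitz[OF K] by blast
  have bdd: "\<exists>B>0. \<forall>x. \<bar>f x\<bar> \<le> B" if "test_fun UNIV f" for f :: "real^'n \<Rightarrow> real"
    using that unfolding test_fun_def by (metis smooth_continuous_on bounded_continuous_compact_support)
  have meas: "f \<in> borel_measurable borel" if "test_fun UNIV f" for f :: "real^'n \<Rightarrow> real"
    using that by (simp add: test_fun_def smooth_borel_measurable)
  have tK: "test_fun UNIV K" using K by (auto simp: test_fun_def)
  have tdK: "test_fun UNIV (partial_deriv i K)" for i by (rule test_fun_partial_deriv[OF tK])
  obtain B where B: "\<And>i. B i > 0" "\<And>i x. \<bar>partial_deriv i K x\<bar> \<le> B i"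
    using bdd[OF tdK] by metis
  have int: "integrable lborel (\<lambda>y. f (a *\<^sub>R x + b *\<^sub>R y) * g y)" if f: "test_fun UNIV f" for f x
  proof -
    obtain C where C: "\<And>x. \<bar>f x\<bar> \<le> C" using bdd[OF f] by blast
    have "integrable lborel (\<lambda>y. C * g y)" using g by simp
    then show ?thesis
      by (rule Bochner_Integration.integrable_bound)
         (use C borel_measurable_integrable[OF g] meas[OF f] in
           \<open>auto simp: abs_mult intro!: mult_right_mono order.trans[OF C]\<close>)
  qed
  define R where "R = (\<lambda>h y. (K (a *\<^sub>R (x + h) + b *\<^sub>R y) - K (a *\<^sub>R x + b *\<^sub>R y)
      - (\<Sum>i\<in>UNIV. a * partial_deriv i K (a *\<^sub>R x + b *\<^sub>R y) * h $ i)) / norm h)"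
  let ?\<Phi> = "\<lambda>x. LINT y|lborel. K (a *\<^sub>R x + b *\<^sub>R y) * g y"
  let ?D = "\<lambda>h. \<Sum>i\<in>UNIV. (a * (LINT y|lborel. partial_deriv i K (a *\<^sub>R x + b *\<^sub>R y) * g y)) * h $ i"
  have eq: "(?\<Phi> (x + h) - ?\<Phi> x - ?D h) / norm h = (LINT y|lborel. R h y * g y)" for h
  proof -
    have "(LINT y|lborel. R h y * g y) = (LINT y|lborel. (K (a *\<^sub>R (x + h) + b *\<^sub>R y) * g y - K (a *\<^sub>R x + b *\<^sub>R y) * g y
      - (\<Sum>i\<in>UNIV. (a * h $ i) * (partial_deriv i K (a *\<^sub>R x + b *\<^sub>R y) * g y))) / norm h)"
      unfolding R_def by (intro Bochner_Integration.integral_cong refl)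
        (simp add: left_diff_distrib right_diff_distrib sum_distrib_left sum_distrib_right mult_ac)
    also have "\<dots> = (?\<Phi> (x + h) - ?\<Phi> x - (\<Sum>i\<in>UNIV. (a * h $ i) * (LINT y|lborel. partial_deriv i K (a *\<^sub>R x + b *\<^sub>R y) * g y))) / norm h"
      using int[OF tK] int[OF tdK] by simp
    finally show ?thesis by (simp add: mult_ac)
  qed
  have R_bound: "\<bar>R h y\<bar> \<le> L * \<bar>a\<bar> + \<bar>a\<bar> * (\<Sum>i\<in>UNIV. B i)" for h y
  \<comment> \<open>At \<open>h = 0\<close> the quotient is 0 by the convention for division by
    zero.\<close>
  proof (cases "h = 0")
    case False
    have "\<bar>K (a *\<^sub>R (x + h) + b *\<^sub>R y) - K (a *\<^sub>R x + b *\<^sub>R y)\<bar> \<le> L * norm (a *\<^sub>R h)"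
      using L(2)[of "a *\<^sub>R (x + h) + b *\<^sub>R y" "a *\<^sub>R x + b *\<^sub>R y"] by (simp add: algebra_simps)
    moreover have "\<bar>\<Sum>i\<in>UNIV. a * partial_deriv i K (a *\<^sub>R x + b *\<^sub>R y) * h $ i\<bar> \<le> (\<Sum>i\<in>UNIV. \<bar>a\<bar> * B i * norm h)"
      by (rule order.trans[OF sum_abs sum_mono])
         (auto simp: abs_mult B less_imp_le component_le_norm_cart intro!: mult_mono)
    ultimately have "\<bar>K (a *\<^sub>R (x + h) + b *\<^sub>R y) - K (a *\<^sub>R x + b *\<^sub>R y)
      - (\<Sum>i\<in>UNIV. a * partial_deriv i K (a *\<^sub>R x + b *\<^sub>R y) * h $ i)\<bar> \<le> (L * \<bar>a\<bar> + \<bar>a\<bar> * (\<Sum>i\<in>UNIV. B i)) * norm h"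
      by (simp add: algebra_simps sum_distrib_left sum_distrib_right)
    then show ?thesis using False by (simp add: R_def abs_divide field_simps)
  qed (use L(1) B(1)[THEN less_imp_le] in \<open>auto simp: R_def intro!: add_nonneg_nonneg mult_nonneg_nonneg sum_nonneg\<close>)
  have R_lim: "((\<lambda>h. R h y) \<longlongrightarrow> 0) (at 0)" for y
  proof -
    have 1: "((\<lambda>x. a *\<^sub>R x + b *\<^sub>R y) has_derivative (\<lambda>h. a *\<^sub>R h)) (at x)"
      by (auto intro!: derivative_eq_intros)
    have "((\<lambda>x. K (a *\<^sub>R x + b *\<^sub>R y)) has_derivative (\<lambda>h. \<Sum>i\<in>UNIV. a * partial_deriv i K (a *\<^sub>R x + b *\<^sub>R y) * h $ i)) (at x)"
      using has_derivative_compose[OF 1 smooth_has_derivative[OF K(1)]] by (simp add: mult_ac)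
    then have "((\<lambda>h. norm (R h y)) \<longlongrightarrow> 0) (at 0)"
      unfolding R_def has_derivative_at by simp
    then show ?thesis
      by (rule tendsto_norm_zero_cancel)
  qed
  have R_meas: "R h \<in> borel_measurable borel" for h
    unfolding R_def using meas[OF tK] meas[OF tdK] by measurable
  have lim: "((\<lambda>h. LINT y|lborel. R h y * g y) \<longlongrightarrow> 0) (at 0)"
  proof (subst tendsto_at_iff_sequentially, intro allI impI)
    fix X :: "nat \<Rightarrow> real^'n"
    assume "\<forall>i. X i \<in> UNIV - {0}" and X: "X \<longlonglongrightarrow> 0"
    then have "filterlim X (at 0) sequentially" by (auto simp: filterlim_at)
    have "(\<lambda>m. LINT y|lborel. R (X m) y * g y) \<longlonglongrightarrow> (LINT y|(lborel::(real^'n) measure). 0)"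
    proof (rule integral_dominated_convergence[where w = "\<lambda>y. (L * \<bar>a\<bar> + \<bar>a\<bar> * (\<Sum>i\<in>UNIV. B i)) * \<bar>g y\<bar>"])
      show "AE y in lborel. (\<lambda>m. R (X m) y * g y) \<longlonglongrightarrow> 0"
        using filterlim_compose[OF R_lim \<open>filterlim X (at 0) sequentially\<close>] by (auto intro!: tendsto_mult_left_zero)
      show "(\<lambda>y. R (X m) y * g y) \<in> borel_measurable lborel" for m
        using R_meas[of "X m"] borel_measurable_integrable[OF g] by simp
      show "AE y in lborel. norm (R (X m) y * g y) \<le> (L * \<bar>a\<bar> + \<bar>a\<bar> * (\<Sum>i\<in>UNIV. B i)) * \<bar>g y\<bar>" for m
        using R_bound by (auto simp: abs_mult intro!: mult_right_mono)
    qed (use g in auto)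
    then show "((\<lambda>h. LINT y|lborel. R h y * g y) \<circ> X) \<longlonglongrightarrow> 0" by (simp add: o_def)
  qed
  have "bounded_linear ?D"
    by (intro bounded_linear_sum bounded_linear_const_mult bounded_linear_vec_nth)
  moreover have "((\<lambda>h. norm (?\<Phi> (x + h) - ?\<Phi> x - ?D h) / norm h) \<longlongrightarrow> 0) (at 0)"
    using tendsto_norm_zero[OF lim] unfolding eq[symmetric] by simp
  ultimately show ?thesis
    unfolding has_derivative_at by blast
qed

lemma convolution_partial_deriv:
  fixes K g :: "real^'n::finite \<Rightarrow> real"
  assumes "smooth K" "compact (closure {x. K x \<noteq> 0})" "integrable lborel g"
  shows "partial_deriv i (\<lambda>x. LINT y|lborel. K (a *\<^sub>R x + b *\<^sub>R y) * g y) x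
    = a * (LINT y|lborel. partial_deriv i K (a *\<^sub>R x + b *\<^sub>R y) * g y)"
  by (subst partial_deriv_eqI[OF convolution_has_derivative[OF assms]]) (simp add: axis_def if_distrib cong: if_cong)

lemma convolution_smooth:
  fixes K g :: "real^'n::finite \<Rightarrow> real"
  assumes "smooth K" "compact (closure {x. K x \<noteq> 0})" "integrable lborel g"
  shows "smooth (\<lambda>x. LINT y|lborel. K (a *\<^sub>R x + b *\<^sub>R y) * g y)"
proof (rule smooth_coinduct[where S = "{\<lambda>x. c * (LINT y|lborel. K (a *\<^sub>R x + b *\<^sub>R y) * g y) | c K. test_fun UNIV K}"])
  show "(\<lambda>x. LINT y|lborel. K (a *\<^sub>R x + b *\<^sub>R y) * g y)
      \<in> {\<lambda>x. c * (LINT y|lborel. K (a *\<^sub>R x + b *\<^sub>R y) * g y) | c K. test_fun UNIV K}"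
    using assms by (intro CollectI exI[of _ 1] exI[of _ K]) (auto simp: test_fun_def)
next
  fix \<Phi> :: "real^'n \<Rightarrow> real" and x i
  assume "\<Phi> \<in> {\<lambda>x. c * (LINT y|lborel. K (a *\<^sub>R x + b *\<^sub>R y) * g y) | c K. test_fun UNIV K}"
  then obtain c K where \<Phi>: "\<Phi> = (\<lambda>x. c * (LINT y|lborel. K (a *\<^sub>R x + b *\<^sub>R y) * g y))" and K: "test_fun UNIV K"
    by blast
  then have K': "smooth K" "compact (closure {x. K x \<noteq> 0})" by (auto simp: test_fun_def)
  have D: "(\<lambda>x. LINT y|lborel. K (a *\<^sub>R x + b *\<^sub>R y) * g y) differentiable at x" for x
    by (rule differentiableI[OF convolution_has_derivative[OF K' assms(3)]])
  then show "\<Phi> differentiable at x"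
    unfolding \<Phi> by (intro differentiable_mult) auto
  have "partial_deriv i \<Phi> x = (c * a) * (LINT y|lborel. partial_deriv i K (a *\<^sub>R x + b *\<^sub>R y) * g y)" for x
    unfolding \<Phi> by (subst partial_deriv_mult) (auto simp: D partial_deriv_const convolution_partial_deriv[OF K' assms(3)])
  then show "partial_deriv i \<Phi> \<in> {\<lambda>x. c * (LINT y|lborel. K (a *\<^sub>R x + b *\<^sub>R y) * g y) | c K. test_fun UNIV K}"
    using test_fun_partial_deriv[OF K] by blast
qed

section \<open>Square-integrable functions\<close>

text \<open>The preimages under \<open>f\<close> and \<open>g\<close> differ by a subset of a null
  set, which is measurable in a complete measure space.\<close>

lemma borel_measurable_AE_complete:
  fixes f g :: "'a \<Rightarrow> 'b::topological_space"
  assumes "complete_measure M" "f \<in> borel_measurable M" "AE x in M. f x = g x"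
  shows "g \<in> borel_measurable M"
proof (rule measurableI)
  fix A :: "'b set"
  assume A: "A \<in> sets borel"
  show "g -` A \<inter> space M \<in> sets M"
  proof (rule complete_measure.in_sets_AE[OF assms(1)])
    show "f -` A \<inter> space M \<in> sets M" by (rule measurable_sets[OF assms(2) A])
    show "AE x in M. (x \<in> f -` A \<inter> space M) = (x \<in> g -` A \<inter> space M)"
      using assms(3) by eventually_elim auto
  qed auto
qed auto

lemma complete_measure_lebesgue_on:
  assumes "S \<in> sets lebesgue"
  shows "complete_measure (lebesgue_on S)"
proof
  fix A B assume "B \<subseteq> A" "A \<in> null_sets (lebesgue_on S)"
  then have "B \<subseteq> S" "A \<in> null_sets lebesgue"
    using assms by (auto simp: null_sets_restrict_space)
  then have "B \<in> null_sets lebesgue"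
    using \<open>B \<subseteq> A\<close> completion.complete2 by blast
  then show "B \<in> sets (lebesgue_on S)"
    using \<open>B \<subseteq> S\<close> assms by (auto simp: sets_restrict_space_iff)
qed

text \<open>If \<open>f\<close> is not measurable, then neither is \<open>g\<close>, and both
  integrals take the default value 0. Integrands can thus be exchanged without a measurability
  proof, in particular those that contain \<open>uD \<circ> M\<close>.\<close>

lemma integral_cong_AE_complete:
  fixes f g :: "'a \<Rightarrow> 'b::euclidean_space"
  assumes "complete_measure M" "AE x in M. f x = g x"
  shows "integral\<^sup>L M f = integral\<^sup>L M g"
proof (cases "f \<in> borel_measurable M")
  case True
  with borel_measurable_AE_complete[OF assms(1) True assms(2)] assms(2) show ?thesis
    by (intro integral_cong_AE)
next
  case False
  have "AE x in M. g x = f x" using assms(2) by eventually_elim auto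
  then have "g \<notin> borel_measurable M"
    using False borel_measurable_AE_complete[OF assms(1)] by blast
  with False show ?thesis
    by (metis borel_measurable_integrable not_integrable_integral_eq)
qed

lemma integrable_cong_AE_complete:
  fixes f g :: "'a \<Rightarrow> 'b::euclidean_space"
  assumes "complete_measure M" "AE x in M. f x = g x" "integrable M f"
  shows "integrable M g"
  using borel_measurable_AE_complete[OF assms(1) borel_measurable_integrable[OF assms(3)] assms(2)] assms
  by (subst integrable_cong_AE[symmetric, of f M g]) auto

lemma integral_lebesgue_on_borel:
  fixes f :: "'a::euclidean_space \<Rightarrow> real"
  assumes "S \<in> sets borel" "f \<in> borel_measurable borel"
  shows "(LINT x|lebesgue_on S. f x) = (LINT x|lborel. indicator S x * f x)"
  using assms by (subst integral_restrict_space) (auto intro!: integral_completion)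

lemma integrable_lebesgue_on_borel:
  fixes f :: "'a::euclidean_space \<Rightarrow> real"
  assumes "S \<in> sets borel" "f \<in> borel_measurable borel"
  shows "integrable (lebesgue_on S) f \<longleftrightarrow> integrable lborel (\<lambda>x. indicator S x * f x)"
  using assms by (subst integrable_restrict_space) (auto intro!: integrable_completion)

lemma lborel_affine_integral:
  fixes f :: "'a::euclidean_space \<Rightarrow> real"
  assumes "c \<noteq> 0" "f \<in> borel_measurable borel"
  shows "(LINT x|lborel. f (t + c *\<^sub>R x)) = (LINT x|lborel. f x) / \<bar>c\<bar> ^ DIM('a)"
proof -
  have "(LINT x|lborel. f x) = (LINT x|density (distr lborel borel (\<lambda>x. t + c *\<^sub>R x)) (\<lambda>_. \<bar>c\<bar>^DIM('a)). f x)"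
    using lborel_affine[OF assms(1), of t] by simp
  also have "\<dots> = \<bar>c\<bar>^DIM('a) * (LINT x|lborel. f (t + c *\<^sub>R x))"
    using assms by (subst integral_density) (auto simp: integral_distr)
  finally show ?thesis using assms(1) by simp
qed

lemma lborel_affine_integrable:
  fixes f :: "'a::euclidean_space \<Rightarrow> real"
  assumes "c \<noteq> 0" "integrable lborel f"
  shows "integrable lborel (\<lambda>x. f (t + c *\<^sub>R x))"
proof -
  have f: "f \<in> borel_measurable borel" using assms(2) by auto
  have "integrable (density (distr lborel borel (\<lambda>x. t + c *\<^sub>R x)) (\<lambda>_. \<bar>c\<bar>^DIM('a))) f"
    using lborel_affine[OF assms(1), of t] assms(2) by simp
  then have "integrable lborel (\<lambda>x. \<bar>c\<bar>^DIM('a) * f (t + c *\<^sub>R x))"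
    using f by (subst (asm) integrable_density) (auto simp: integrable_distr_eq)
  then show ?thesis using assms(1) by simp
qed

lemma square_sum_le2: "(a + b)\<^sup>2 \<le> 2 * a\<^sup>2 + 2 * (b::real)\<^sup>2"
  using zero_le_power2[of "a - b"] by (simp add: power2_eq_square algebra_simps)

lemma square_sum_le3: "(a + b + c)\<^sup>2 \<le> 3 * a\<^sup>2 + 3 * b\<^sup>2 + 3 * (c::real)\<^sup>2"
  using zero_le_power2[of "a - b"] zero_le_power2[of "a - c"] zero_le_power2[of "b - c"]
  by (simp add: power2_eq_square algebra_simps)

lemma L2_diff_integrable:
  fixes f g :: "'a \<Rightarrow> real"
  assumes "f \<in> L2_fun M" "g \<in> L2_fun M"
  shows "integrable M (\<lambda>x. (f x - g x)\<^sup>2)"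
proof -
  have "integrable M (\<lambda>x. 2 * (f x)\<^sup>2 + 2 * (g x)\<^sup>2)"
    using assms by (auto simp: L2_fun_def)
  then show ?thesis
    by (rule Bochner_Integration.integrable_bound)
       (use assms square_sum_le2[of "f _" "- g _"] in \<open>auto simp: L2_fun_def\<close>)
qed

lemma L2_diff: "f \<in> L2_fun M \<Longrightarrow> g \<in> L2_fun M \<Longrightarrow> (\<lambda>x. f x - g x) \<in> L2_fun M"
  using L2_diff_integrable[of f M g] by (auto simp: L2_fun_def)

lemma L2_mult_integrable:
  fixes f g :: "'a \<Rightarrow> real"
  assumes "f \<in> L2_fun M" "g \<in> L2_fun M"
  shows "integrable M (\<lambda>x. f x * g x)"
proof -
  have *: "\<bar>a * b\<bar> \<le> a\<^sup>2 + b\<^sup>2" for a b :: real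
    using zero_le_power2[of "\<bar>a\<bar> - \<bar>b\<bar>"] zero_le_power2[of a] zero_le_power2[of b]
    unfolding abs_mult power2_diff power2_abs by linarith
  have "integrable M (\<lambda>x. (f x)\<^sup>2 + (g x)\<^sup>2)"
    using assms by (auto simp: L2_fun_def)
  then show ?thesis
    by (rule Bochner_Integration.integrable_bound)
       (use assms * in \<open>auto simp: L2_fun_def\<close>)
qed

lemma bounded_L2:
  assumes "finite_measure M" "f \<in> borel_measurable M" "AE x in M. \<bar>f x\<bar> \<le> B"
  shows "f \<in> L2_fun M"
  unfolding L2_fun_def
proof (intro CollectI conjI assms(2) finite_measure.integrable_const_bound[OF assms(1), where B = "B\<^sup>2"])
  show "AE x in M. norm ((f x)\<^sup>2) \<le> B\<^sup>2"
    using assms(3) by eventually_elim (metis abs_le_square_iff abs_of_nonneg abs_ge_zero order.trans power2_abs real_norm_def zero_le_power2)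
qed (use assms in auto)

lemma Cauchy_Schwarz_integral:
  fixes f g :: "'a \<Rightarrow> real"
  assumes f: "f \<in> L2_fun M" and g: "g \<in> L2_fun M"
  shows "(LINT x|M. f x * g x)\<^sup>2 \<le> (LINT x|M. (f x)\<^sup>2) * (LINT x|M. (g x)\<^sup>2)"
proof -
  let ?a = "LINT x|M. (f x)\<^sup>2" and ?b = "LINT x|M. (g x)\<^sup>2" and ?c = "LINT x|M. f x * g x"
  have int: "integrable M (\<lambda>x. (f x)\<^sup>2)" "integrable M (\<lambda>x. (g x)\<^sup>2)" "integrable M (\<lambda>x. f x * g x)"
    using f g L2_mult_integrable[OF f g] by (auto simp: L2_fun_def)
  \<comment> \<open>Homogeneous in both \<open>s\<close> and \<open>t\<close>, so that the later
    choice \<open>s = ?b\<close>, \<open>t = ?c\<close> involves no division.\<close>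
  have quad: "0 \<le> s\<^sup>2 * ?a - 2 * s * t * ?c + t\<^sup>2 * ?b" for s t
  proof -
    have "0 \<le> (LINT x|M. (s * f x - t * g x)\<^sup>2)" by (rule Bochner_Integration.integral_nonneg) auto
    also have "\<dots> = (LINT x|M. s\<^sup>2 * (f x)\<^sup>2 - (2 * s * t) * (f x * g x) + t\<^sup>2 * (g x)\<^sup>2)"
      by (intro Bochner_Integration.integral_cong) (auto simp: power2_eq_square algebra_simps)
    also have "\<dots> = s\<^sup>2 * ?a - 2 * s * t * ?c + t\<^sup>2 * ?b"
      using int by simp
    finally show ?thesis .
  qed
  have a: "?a \<ge> 0" and b: "?b \<ge> 0" by (auto intro: Bochner_Integration.integral_nonneg)
  show ?thesis
  proof (cases "?b = 0")
    case True
    have "?c = 0"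
    proof (rule ccontr)
      assume "?c \<noteq> 0"
      \<comment> \<open>For \<open>?b = 0\<close> the form is affine in \<open>t\<close>; this value
        of \<open>t\<close> makes it equal to \<open>-1\<close>.\<close>
      with quad[of 1 "(?a + 1) / (2 * ?c)"] True show False by (simp add: field_simps)
    qed
    then show ?thesis using True by simp
  next
    case False
    then have "?b > 0" using b by (metis order_le_less)
    have "0 \<le> ?b\<^sup>2 * ?a - 2 * ?b * ?c * ?c + ?c\<^sup>2 * ?b" by (rule quad)
    also have "\<dots> = ?b * (?a * ?b - ?c\<^sup>2)" by (simp add: power2_eq_square algebra_simps)
    finally show ?thesis using \<open>?b > 0\<close> by (simp add: zero_le_mult_iff)
  qed
qed

lemma L2_convergence_mult:
  fixes g :: "'a \<Rightarrow> real"
  assumes "\<And>m. f m \<in> L2_fun M" "g \<in> L2_fun M" "h \<in> L2_fun M"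
    and lim: "(\<lambda>m. LINT x|M. (f m x - g x)\<^sup>2) \<longlonglongrightarrow> 0"
  shows "(\<lambda>m. LINT x|M. f m x * h x) \<longlonglongrightarrow> (LINT x|M. g x * h x)"
proof -
  have diff: "(LINT x|M. f m x * h x) - (LINT x|M. g x * h x) = (LINT x|M. (f m x - g x) * h x)" for m
    using L2_mult_integrable[OF assms(1,3)] L2_mult_integrable[OF assms(2,3)]
    by (simp add: left_diff_distrib)
  have "(\<lambda>m. ((LINT x|M. f m x * h x) - (LINT x|M. g x * h x))\<^sup>2) \<longlonglongrightarrow> 0"
  proof (rule tendsto_sandwich[OF _ _ tendsto_const])
    show "(\<lambda>m. (LINT x|M. (f m x - g x)\<^sup>2) * (LINT x|M. (h x)\<^sup>2)) \<longlonglongrightarrow> 0"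
      using tendsto_mult_left_zero[OF lim] by simp
    show "\<forall>\<^sub>F m in sequentially. ((LINT x|M. f m x * h x) - (LINT x|M. g x * h x))\<^sup>2
        \<le> (LINT x|M. (f m x - g x)\<^sup>2) * (LINT x|M. (h x)\<^sup>2)"
      unfolding diff by (intro always_eventually allI Cauchy_Schwarz_integral L2_diff assms)
  qed auto
  then have "(\<lambda>m. sqrt (((LINT x|M. f m x * h x) - (LINT x|M. g x * h x))\<^sup>2)) \<longlonglongrightarrow> sqrt 0"
    by (rule tendsto_real_sqrt)
  then show ?thesis
    by (simp add: tendsto_rabs_zero_iff LIM_zero_iff)
qed

text \<open>Two limits, each by dominated convergence. Truncation at level \<open>N\<close> is
  dominated by \<open>g^2\<close>. The truncated function is an almost everywhere limit of
  continuous functions, and truncating these at the same level keeps the differences below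
  \<open>2 * N\<close>, which is square integrable on the bounded set \<open>S\<close>.\<close>

lemma L2_approx_continuous:
  fixes g :: "'a::euclidean_space \<Rightarrow> real"
  assumes g: "g \<in> borel_measurable borel" "integrable lborel (\<lambda>x. indicator S x * (g x)\<^sup>2)"
    and S: "S \<in> sets borel" "bounded S" and e: "e > 0"
  obtains h where "continuous_on UNIV h" "integrable lborel (\<lambda>x. indicator S x * (g x - h x)\<^sup>2)"
    "(LINT x|lborel. indicator S x * (g x - h x)\<^sup>2) < e"
proof -
  have S_fin: "emeasure lborel S < \<infinity>" by (rule emeasure_bounded_finite[OF S(2)])
  define tr where "tr = (\<lambda>N t. max (- real N) (min (real N) t))"
  have tr_meas: "tr N \<in> borel_measurable borel" for N unfolding tr_def by measurable
  have tr_lim: "(\<lambda>N. tr N t) \<longlonglongrightarrow> t" for t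
  proof (rule tendsto_eventually)
    obtain N0 where "\<bar>t\<bar> \<le> real N0" using real_arch_simple by blast
    then show "\<forall>\<^sub>F N in sequentially. tr N t = t"
      by (auto simp: eventually_sequentially tr_def intro!: exI[of _ N0])
  qed
  have tr_le: "\<bar>t - tr N t\<bar> \<le> \<bar>t\<bar>" for N t by (auto simp: tr_def)
  have tr_bd: "\<bar>tr N t\<bar> \<le> real N" for N t by (auto simp: tr_def)
  have "(\<lambda>N. LINT x|lborel. indicator S x * (g x - tr N (g x))\<^sup>2) \<longlonglongrightarrow> (LINT x|(lborel::'a measure). 0)"
  proof (rule integral_dominated_convergence[where w = "\<lambda>x. indicator S x * (g x)\<^sup>2"])
    show "AE x in lborel. (\<lambda>N. indicator S x * (g x - tr N (g x))\<^sup>2) \<longlonglongrightarrow> 0"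
      by (auto intro!: always_eventually tendsto_mult_right_zero tendsto_eq_intros tr_lim)
    show "AE x in lborel. norm (indicator S x * (g x - tr N (g x))\<^sup>2) \<le> indicator S x * (g x)\<^sup>2" for N
      by (auto simp: indicator_def abs_le_square_iff[symmetric] tr_le)
  qed (use g S tr_meas in measurable)
  then have "\<forall>\<^sub>F N in sequentially. (LINT x|lborel. indicator S x * (g x - tr N (g x))\<^sup>2) < e / 4"
    using e by (intro order_tendstoD) auto
  then obtain N where N: "(LINT x|lborel. indicator S x * (g x - tr N (g x))\<^sup>2) < e / 4"
    by (auto simp: eventually_sequentially)
  let ?gN = "\<lambda>x. tr N (g x)"
  have "g measurable_on UNIV"
    using g(1) by (intro lebesgue_measurable_imp_measurable_on measurable_completion) auto
  then obtain Z k where Z: "negligible Z" and k: "\<And>m. continuous_on UNIV (k m)"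
    "\<And>x. x \<notin> Z \<Longrightarrow> (\<lambda>m. k m x) \<longlonglongrightarrow> g x"
    unfolding measurable_on_def by auto
  have tr_cont: "continuous_on UNIV (tr N)" unfolding tr_def by (intro continuous_intros)
  have k_cont: "continuous_on UNIV (\<lambda>x. tr N (k m x))" for m
    using continuous_on_compose2[OF tr_cont k(1)] by auto
  have AE_Z: "AE x in lborel. x \<notin> Z"
    using AE_not_in[of Z lebesgue] Z unfolding negligible_iff_null_sets AE_completion_iff by blast
  have "(\<lambda>m. LINT x|lborel. indicator S x * (tr N (g x) - tr N (k m x))\<^sup>2) \<longlonglongrightarrow> (LINT x|(lborel::'a measure). 0)"
  proof (rule integral_dominated_convergence[where w = "\<lambda>x. indicator S x * (2 * real N)\<^sup>2"])
    show "integrable lborel (\<lambda>x. indicator S x * (2 * real N)\<^sup>2)"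
      using S_fin S by (intro integrable_mult_left integrable_real_indicator) auto
    show "AE x in lborel. (\<lambda>m. indicator S x * (tr N (g x) - tr N (k m x))\<^sup>2) \<longlonglongrightarrow> 0"
      using AE_Z
    proof eventually_elim
      case (elim x)
      have "(\<lambda>m. tr N (k m x)) \<longlonglongrightarrow> tr N (g x)"
        by (rule continuous_on_tendsto_compose[OF tr_cont k(2)[OF elim]]) auto
      then show ?case
        by (auto intro!: tendsto_mult_right_zero tendsto_eq_intros)
    qed
    show "AE x in lborel. norm (indicator S x * (tr N (g x) - tr N (k m x))\<^sup>2) \<le> indicator S x * (2 * real N)\<^sup>2" for m
    proof (rule AE_I2)
      fix x
      have "\<bar>tr N (g x) - tr N (k m x)\<bar> \<le> \<bar>2 * real N\<bar>"
        using tr_bd[of N "g x"] tr_bd[of N "k m x"] by linarith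
      then have "(tr N (g x) - tr N (k m x))\<^sup>2 \<le> (2 * real N)\<^sup>2"
        by (simp only: abs_le_square_iff)
      then show "norm (indicator S x * (tr N (g x) - tr N (k m x))\<^sup>2) \<le> indicator S x * (2 * real N)\<^sup>2"
        by (simp add: indicator_def)
    qed
  qed (use g S tr_meas borel_measurable_continuous_onI[OF k_cont] in measurable)
  then have "\<forall>\<^sub>F m in sequentially. (LINT x|lborel. indicator S x * (tr N (g x) - tr N (k m x))\<^sup>2) < e / 4"
    using e by (intro order_tendstoD) auto
  then obtain m where m: "(LINT x|lborel. indicator S x * (tr N (g x) - tr N (k m x))\<^sup>2) < e / 4"
    by (auto simp: eventually_sequentially)
  let ?h = "\<lambda>x. tr N (k m x)"
  note meas = borel_measurable_continuous_onI[OF k_cont[of m]]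
  have I1: "integrable lborel (\<lambda>x. indicator S x * (g x - tr N (g x))\<^sup>2)"
    by (rule Bochner_Integration.integrable_bound[OF g(2)])
       (use g S tr_meas in \<open>auto simp: indicator_def abs_le_square_iff[symmetric] tr_le\<close>)
  have "integrable lborel (\<lambda>x. indicator S x * (2 * real N)\<^sup>2)"
    using S_fin S by (intro integrable_mult_left integrable_real_indicator) auto
  then have I2: "integrable lborel (\<lambda>x. indicator S x * (tr N (g x) - ?h x)\<^sup>2)"
  proof (rule Bochner_Integration.integrable_bound)
    show "AE x in lborel. norm (indicator S x * (tr N (g x) - tr N (k m x))\<^sup>2) \<le> norm (indicator S x * (2 * real N)\<^sup>2)"
    proof (rule AE_I2)
      fix x
      have "\<bar>tr N (g x) - tr N (k m x)\<bar> \<le> \<bar>2 * real N\<bar>"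
        using tr_bd[of N "g x"] tr_bd[of N "k m x"] by linarith
      then have "(tr N (g x) - tr N (k m x))\<^sup>2 \<le> (2 * real N)\<^sup>2"
        by (simp only: abs_le_square_iff)
      then show "norm (indicator S x * (tr N (g x) - tr N (k m x))\<^sup>2) \<le> norm (indicator S x * (2 * real N)\<^sup>2)"
        by (simp add: indicator_def)
    qed
  qed (use g S tr_meas meas in measurable)
  have le: "indicator S x * (g x - ?h x)\<^sup>2 \<le> 2 * (indicator S x * (g x - tr N (g x))\<^sup>2) + 2 * (indicator S x * (tr N (g x) - ?h x)\<^sup>2)" for x
    using square_sum_le2[of "g x - tr N (g x)" "tr N (g x) - ?h x"] by (auto simp: indicator_def)
  have I12: "integrable lborel (\<lambda>x. 2 * (indicator S x * (g x - tr N (g x))\<^sup>2) + 2 * (indicator S x * (tr N (g x) - ?h x)\<^sup>2))"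
    using I1 I2 by simp
  have I3: "integrable lborel (\<lambda>x. indicator S x * (g x - ?h x)\<^sup>2)"
  proof (rule Bochner_Integration.integrable_bound[OF I12])
    show "AE x in lborel. norm (indicator S x * (g x - ?h x)\<^sup>2)
       \<le> norm (2 * (indicator S x * (g x - tr N (g x))\<^sup>2) + 2 * (indicator S x * (tr N (g x) - ?h x)\<^sup>2))"
      using le by (intro AE_I2) (auto simp: indicator_def)
  qed (use g S tr_meas meas in measurable)
  have "(LINT x|lborel. indicator S x * (g x - ?h x)\<^sup>2)
      \<le> (LINT x|lborel. 2 * (indicator S x * (g x - tr N (g x))\<^sup>2) + 2 * (indicator S x * (tr N (g x) - ?h x)\<^sup>2))"
    by (rule integral_mono[OF I3 I12 le])
  also have "\<dots> < e" using I1 I2 N m by simp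
  finally show ?thesis using that[OF k_cont I3] by blast
qed

section \<open>Density of smooth functions on bounded convex domains\<close>

lemma exists_bump_in:
  fixes C :: "(real^'n::finite) set"
  assumes "open C" "C \<noteq> {}"
  obtains \<rho> where "test_fun C \<rho>" "\<And>x. \<rho> x \<ge> 0" "(LINT x|lborel. \<rho> x) = 1"
proof -
  obtain a where "a \<in> C" using assms by auto
  with assms(1) obtain r where r: "r > 0" "cball a r \<subseteq> C"
    by (auto simp: open_contains_cball)
  obtain \<rho> :: "real^'n \<Rightarrow> real" where \<rho>: "smooth \<rho>" "\<And>x. \<rho> x \<ge> 0" "\<And>x. norm x > 1 \<Longrightarrow> \<rho> x = 0"
    "closure {x. \<rho> x \<noteq> 0} \<subseteq> cball 0 1" "integrable lborel \<rho>" "integral\<^sup>L lborel \<rho> = 1"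
    by (rule exists_bump, rule that) auto
  define \<rho>' where "\<rho>' = (\<lambda>x. (1 / r) ^ CARD('n) * \<rho> ((1 / r) *\<^sub>R x + (- (1 / r) *\<^sub>R a)))"
  have smooth: "smooth \<rho>'"
    unfolding \<rho>'_def by (rule smooth_cmult, rule smooth_affine_comp, rule \<rho>(1))
  have "closure {x. \<rho>' x \<noteq> 0} \<subseteq> cball a r"
  proof (rule closure_minimal, safe)
    fix x assume "\<rho>' x \<noteq> 0"
    then have "\<rho> ((1 / r) *\<^sub>R x + (- (1 / r) *\<^sub>R a)) \<noteq> 0"
      by (auto simp: \<rho>'_def)
    then have "norm ((1 / r) *\<^sub>R x + (- (1 / r) *\<^sub>R a)) \<le> 1"
      using \<rho>(3) not_le by blast
    moreover have "(1 / r) *\<^sub>R x + (- (1 / r) *\<^sub>R a) = (1 / r) *\<^sub>R (x - a)"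
      by (simp add: algebra_simps)
    ultimately have "norm (x - a) / r \<le> 1" using r by simp
    then show "x \<in> cball a r" using r by (simp add: dist_norm norm_minus_commute)
  qed
  then have "test_fun C \<rho>'"
    using smooth r by (auto simp: test_fun_def compact_eq_bounded_closed intro: bounded_subset[OF bounded_cball])
  moreover have "\<rho>' x \<ge> 0" for x using \<rho>(2) r by (auto simp: \<rho>'_def)
  moreover have "(LINT x|lborel. \<rho>' x) = 1"
  proof -
    have "(LINT x|lborel. \<rho> ((- (1 / r) *\<^sub>R a) + (1 / r) *\<^sub>R x)) = (LINT x|lborel. \<rho> x) / \<bar>1 / r\<bar> ^ CARD('n)"
      using lborel_affine_integral[of "1 / r" \<rho> "- (1 / r) *\<^sub>R a"] r smooth_borel_measurable[OF \<rho>(1)] by simp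
    then show ?thesis
      using r \<rho>(6) by (simp add: \<rho>'_def add.commute)
  qed
  ultimately show ?thesis using that by blast
qed

lemma dilation_in_convex:
  fixes C :: "'a::real_vector set"
  assumes "convex C" "x \<in> C" "b \<in> C" "0 < l" "l < 1"
  shows "l *\<^sub>R x + (1 - l) *\<^sub>R b \<in> C"
  using assms by (simp add: convexD)

text \<open>Compare with a continuous \<open>h\<close>: the change of variables enlarges the dilated
  error \<open>g - h\<close> by a bounded factor only, and \<open>h\<close> is uniformly continuous
  on \<open>closure C\<close>. The bound is uniform in \<open>b\<close>, which permits averaging
  over \<open>b\<close>. The nonnegative integral is used so that Tonelli's theorem applies to the
  average without prior integrability.\<close>

lemma L2_dilation_continuous:
  fixes g :: "'a::euclidean_space \<Rightarrow> real"
  assumes g: "g \<in> borel_measurable borel" "integrable lborel (\<lambda>x. indicator C x * (g x)\<^sup>2)"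
    and C: "open C" "convex C" "bounded C" and e: "e > 0"
  obtains d where "0 < d" "d < 1"
    "\<And>l b. 1 - d < l \<Longrightarrow> l < 1 \<Longrightarrow> b \<in> C \<Longrightarrow>
       (\<integral>\<^sup>+x. ennreal (indicator C x * (g (l *\<^sub>R x + (1 - l) *\<^sub>R b) - g x)\<^sup>2) \<partial>lborel) \<le> ennreal e"
proof -
  define V where "V = measure lborel C"
  \<comment> \<open>The estimate ends with
    \<open>3 * \<eta> * (2 ^ n + 1) + 3 * \<omega>^2 * V\<close> for \<open>n = DIM('a)\<close>; the
    constants make each of the two terms at most \<open>e / 2\<close>. In \<open>V + 1\<close> the
    summand 1 avoids a zero denominator.\<close>
  define \<eta> where "\<eta> = e / (6 * (2 ^ DIM('a) + 1))"
  define \<omega> where "\<omega> = sqrt (e / (6 * (V + 1)))"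
  have \<eta>: "\<eta> > 0" using e by (simp add: \<eta>_def add_pos_pos)
  have "V \<ge> 0" by (simp add: V_def)
  have "e / (6 * (V + 1)) > 0" using e \<open>V \<ge> 0\<close> by simp
  then have \<omega>: "\<omega> > 0" "\<omega>\<^sup>2 = e / (6 * (V + 1))" unfolding \<omega>_def by auto
  have Cb: "C \<in> sets borel" using C by auto
  have C_fin: "emeasure lborel C < \<infinity>" by (rule emeasure_bounded_finite[OF C(3)])
  obtain h where h: "continuous_on UNIV h" "integrable lborel (\<lambda>x. indicator C x * (g x - h x)\<^sup>2)"
    "(LINT x|lborel. indicator C x * (g x - h x)\<^sup>2) < \<eta>"
    using L2_approx_continuous[OF g Cb C(3) \<eta>] by blast
  have "uniformly_continuous_on (closure C) h"
    using C(3) by (intro compact_uniformly_continuous continuous_on_subset[OF h(1)]) (auto simp: compact_closure)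
  then obtain \<delta> where \<delta>: "\<delta> > 0" "\<And>x y. x \<in> closure C \<Longrightarrow> y \<in> closure C \<Longrightarrow> dist y x < \<delta> \<Longrightarrow> dist (h y) (h x) < \<omega>"
    using \<omega>(1) unfolding uniformly_continuous_on_def by metis
  obtain R where R: "R > 0" "\<And>x. x \<in> C \<Longrightarrow> norm x \<le> R" using C(3) bounded_pos by blast
  \<comment> \<open>The bound \<open>1 / 2\<close> keeps \<open>l > 1 / 2\<close>, hence the
    Jacobian factor \<open>1 / l ^ DIM('a)\<close> at most \<open>2 ^ DIM('a)\<close>. The other
    bound keeps every displacement \<open>(1 - l) * norm (b - x)\<close> below
    \<open>\<delta>\<close>, since points of \<open>C\<close> are at most \<open>2 * R\<close>
    apart.\<close>
  define d where "d = min (1/2) (\<delta> / (2 * R))"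
  have d: "0 < d" "d < 1" "d \<le> 1/2" "d * (2 * R) \<le> \<delta>"
    using \<delta> R by (auto simp: d_def min_def field_simps)
  have h_meas: "h \<in> borel_measurable borel" by (rule borel_measurable_continuous_onI[OF h(1)])
  have bound: "(\<integral>\<^sup>+x. ennreal (indicator C x * (g (l *\<^sub>R x + (1 - l) *\<^sub>R b) - g x)\<^sup>2) \<partial>lborel) \<le> ennreal e"
    if l: "1 - d < l" "l < 1" and b: "b \<in> C" for l b
  proof -
    have l0: "l > 1/2" using l d by linarith
    let ?F = "\<lambda>y. indicator C y * (g y - h y)\<^sup>2"
    let ?G = "\<lambda>x. ?F ((1 - l) *\<^sub>R b + l *\<^sub>R x)"
    have F_meas: "?F \<in> borel_measurable borel" using g h_meas Cb by measurable
    have G_int: "integrable lborel ?G" using l0 h(2) by (intro lborel_affine_integrable) auto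
    have "(LINT x|lborel. ?G x) = (LINT x|lborel. ?F x) / l ^ DIM('a)"
      using lborel_affine_integral[OF _ F_meas, of l "(1 - l) *\<^sub>R b"] l0 by simp
    also have "\<dots> \<le> \<eta> * 2 ^ DIM('a)"
    proof -
      have "1 / l ^ DIM('a) \<le> 2 ^ DIM('a)"
        using power_mono[of "1 / l" 2 "DIM('a)"] l0 by (simp add: power_divide field_simps)
      then have "(LINT x|lborel. ?F x) * (1 / l ^ DIM('a)) \<le> \<eta> * 2 ^ DIM('a)"
        using h(3) \<eta> l0 by (intro mult_mono) auto
      then show ?thesis by simp
    qed
    finally have G_le: "(LINT x|lborel. ?G x) \<le> \<eta> * 2 ^ DIM('a)" .
    have le: "indicator C x * (g (l *\<^sub>R x + (1 - l) *\<^sub>R b) - g x)\<^sup>2 \<le> 3 * ?G x + 3 * (\<omega>\<^sup>2 * indicator C x) + 3 * ?F x" for x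
    proof (cases "x \<in> C")
      case True
      let ?z = "l *\<^sub>R x + (1 - l) *\<^sub>R b"
      have z: "?z \<in> C" using l0 l by (intro dilation_in_convex C True b) auto
      have "?z - x = (1 - l) *\<^sub>R (b - x)" by (simp add: algebra_simps)
      then have "dist ?z x = (1 - l) * norm (b - x)" using l by (simp add: dist_norm)
      also have "\<dots> \<le> (1 - l) * (2 * R)"
        using l norm_triangle_ineq4[of b x] R(2)[OF b] R(2)[OF True] by (intro mult_left_mono) auto
      also have "\<dots> < d * (2 * R)" using l R by (intro mult_strict_right_mono) auto
      also have "\<dots> \<le> \<delta>" by (rule d)
      finally have "dist (h ?z) (h x) < \<omega>"
        using z True closure_subset by (intro \<delta>(2)) auto
      then have "(h ?z - h x)\<^sup>2 \<le> \<omega>\<^sup>2"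
        using \<omega>(1) by (simp add: dist_real_def abs_le_square_iff[symmetric])
      moreover have "(g ?z - g x)\<^sup>2 \<le> 3 * (g ?z - h ?z)\<^sup>2 + 3 * (h ?z - h x)\<^sup>2 + 3 * (h x - g x)\<^sup>2"
        using square_sum_le3[of "g ?z - h ?z" "h ?z - h x" "h x - g x"] by simp
      ultimately show ?thesis using True z by (simp add: add.commute power2_commute[of "h x" "g x"])
    qed (auto simp: indicator_def)
    have int: "integrable lborel (\<lambda>x. 3 * ?G x + 3 * (\<omega>\<^sup>2 * indicator C x) + 3 * ?F x)"
      using G_int h(2) C_fin Cb by (intro Bochner_Integration.integrable_add integrable_mult_right integrable_real_indicator) auto
    have "(\<integral>\<^sup>+x. ennreal (indicator C x * (g (l *\<^sub>R x + (1 - l) *\<^sub>R b) - g x)\<^sup>2) \<partial>lborel)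
       \<le> (\<integral>\<^sup>+x. ennreal (3 * ?G x + 3 * (\<omega>\<^sup>2 * indicator C x) + 3 * ?F x) \<partial>lborel)"
      by (intro nn_integral_mono ennreal_leI le)
    also have "\<dots> = ennreal (LINT x|lborel. 3 * ?G x + 3 * (\<omega>\<^sup>2 * indicator C x) + 3 * ?F x)"
      by (rule nn_integral_eq_integral[OF int]) (auto simp: indicator_def)
    also have "(LINT x|lborel. 3 * ?G x + 3 * (\<omega>\<^sup>2 * indicator C x) + 3 * ?F x)
        = 3 * (LINT x|lborel. ?G x) + 3 * (\<omega>\<^sup>2 * V) + 3 * (LINT x|lborel. ?F x)"
      using G_int h(2) C_fin Cb by (simp add: V_def)
    also have "\<dots> \<le> 3 * (\<eta> * 2 ^ DIM('a)) + 3 * (\<omega>\<^sup>2 * V) + 3 * \<eta>"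
      using G_le h(3) by simp
    also have "\<dots> = 3 * (\<eta> * (2 ^ DIM('a) + 1)) + 3 * (\<omega>\<^sup>2 * V)"
      by (simp add: algebra_simps)
    also have "\<dots> \<le> e"
    proof -
      have "(2::real) ^ DIM('a) + 1 \<noteq> 0" by (metis add_pos_pos less_irrefl zero_less_numeral zero_less_one zero_less_power)
      then have "\<eta> * (2 ^ DIM('a) + 1) = e / 6"
        unfolding \<eta>_def times_divide_eq_left by (rule nonzero_mult_divide_mult_cancel_right)
      moreover have "\<omega>\<^sup>2 * V \<le> \<omega>\<^sup>2 * (V + 1)" by (intro mult_left_mono) auto
      moreover have "\<omega>\<^sup>2 * (V + 1) = e / 6" using \<open>V \<ge> 0\<close> by (simp add: \<omega>(2) field_simps)
      ultimately show ?thesis by simp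
    qed
    finally show ?thesis by (simp add: ennreal_leI)
  qed
  show ?thesis using that[OF d(1,2)] bound by blast
qed

text \<open>Averaging \<open>g\<close> over dilations towards points \<open>b\<close> of \<open>C\<close>, \<open>x \<mapsto> \<integral> \<rho> b * g (l x + (1 - l) b) db\<close>,
  written as a convolution so that it is defined and smooth on the whole space.\<close>

definition dilation_mean :: "(real^'n::finite \<Rightarrow> real) \<Rightarrow> real \<Rightarrow> (real^'n \<Rightarrow> real) \<Rightarrow> real^'n \<Rightarrow> real" where
  "dilation_mean \<rho> l g x =
     (1 / (1 - l)) ^ CARD('n) * (LINT y|lborel. \<rho> ((1 / (1 - l)) *\<^sub>R ((- l) *\<^sub>R x + 1 *\<^sub>R y)) * g y)"

lemma compact_support_scale:
  fixes f :: "'a::euclidean_space \<Rightarrow> real"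
  assumes "compact (closure {x. f x \<noteq> 0})" "c \<noteq> 0"
  shows "compact (closure {x. f (c *\<^sub>R x + b) \<noteq> 0})"
    "closure {x. f (c *\<^sub>R x + b) \<noteq> 0} \<subseteq> (\<lambda>y. (1 / c) *\<^sub>R (y - b)) ` closure {x. f x \<noteq> 0}"
proof -
  let ?K = "(\<lambda>y. (1 / c) *\<^sub>R (y - b)) ` closure {x. f x \<noteq> 0}"
  have K: "compact ?K"
    by (intro compact_continuous_image continuous_intros assms)
  have "{x. f (c *\<^sub>R x + b) \<noteq> 0} \<subseteq> ?K"
  proof safe
    fix x assume "f (c *\<^sub>R x + b) \<noteq> 0"
    then have "c *\<^sub>R x + b \<in> closure {x. f x \<noteq> 0}"
      using closure_subset[of "{x. f x \<noteq> 0}"] by auto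
    moreover have "x = (1 / c) *\<^sub>R ((c *\<^sub>R x + b) - b)" using assms(2) by simp
    ultimately show "x \<in> ?K" by blast
  qed
  then show *: "closure {x. f (c *\<^sub>R x + b) \<noteq> 0} \<subseteq> ?K"
    using K by (intro closure_minimal compact_imp_closed)
  show "compact (closure {x. f (c *\<^sub>R x + b) \<noteq> 0})"
    using * K by (metis bounded_subset closed_closure compact_eq_bounded_closed)
qed

lemma smooth_compact_support_scale:
  assumes "smooth \<rho>" "compact (closure {x. \<rho> x \<noteq> 0})" "c \<noteq> 0"
  shows "smooth (\<lambda>z. \<rho> (c *\<^sub>R z))" "compact (closure {z. \<rho> (c *\<^sub>R z) \<noteq> 0})"
  using smooth_affine_comp[OF assms(1), of c 0] compact_support_scale(1)[OF assms(2,3), of 0] by auto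

lemma dilation_mean_smooth:
  assumes \<rho>: "test_fun C \<rho>" and "l < 1" "integrable lborel g"
  shows "smooth (dilation_mean \<rho> l g)"
  unfolding dilation_mean_def[abs_def]
  using assms
  by (intro smooth_cmult convolution_smooth[where K = "\<lambda>z. \<rho> ((1 / (1 - l)) *\<^sub>R z)"] smooth_compact_support_scale)
     (auto simp: test_fun_def)

text \<open>The substitution \<open>y = l x + (1 - l) b\<close> turns the convolution into the
  average over \<open>b\<close>; the power of \<open>1 / (1 - l)\<close> in the definition of
  \<open>dilation_mean\<close> compensates its Jacobian.\<close>

lemma dilation_mean_eq:
  fixes g :: "real^'n::finite \<Rightarrow> real"
  assumes \<rho>: "test_fun C \<rho>" and l: "l < 1" and g: "integrable lborel g"
  shows "integrable lborel (\<lambda>b. \<rho> b * g (l *\<^sub>R x + (1 - l) *\<^sub>R b))"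
    and "dilation_mean \<rho> l g x = (LINT b|lborel. \<rho> b * g (l *\<^sub>R x + (1 - l) *\<^sub>R b))"
proof -
  define F where "F = (\<lambda>y. \<rho> ((1 / (1 - l)) *\<^sub>R ((- l) *\<^sub>R x + 1 *\<^sub>R y)) * g y)"
  have \<rho>_meas: "\<rho> \<in> borel_measurable borel"
    using \<rho> by (simp add: test_fun_def smooth_borel_measurable)
  have F_meas: "F \<in> borel_measurable borel"
    unfolding F_def using \<rho>_meas borel_measurable_integrable[OF g] by measurable
  obtain B where B: "\<And>x. \<bar>\<rho> x\<bar> \<le> B"
    using bounded_continuous_compact_support[of \<rho>] \<rho> unfolding test_fun_def by (metis smooth_continuous_on)
  have F_int: "integrable lborel F"
  proof (rule Bochner_Integration.integrable_bound)
    show "integrable lborel (\<lambda>y. B * g y)" using g by simp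
    show "AE y in lborel. norm (F y) \<le> norm (B * g y)"
      using B by (auto simp: F_def abs_mult intro!: mult_right_mono order.trans[OF B])
  qed (use F_meas in auto)
  have F_eq: "F (l *\<^sub>R x + (1 - l) *\<^sub>R b) = \<rho> b * g (l *\<^sub>R x + (1 - l) *\<^sub>R b)" for b
    using l by (simp add: F_def)
  show "integrable lborel (\<lambda>b. \<rho> b * g (l *\<^sub>R x + (1 - l) *\<^sub>R b))"
    using lborel_affine_integrable[OF _ F_int, of "1 - l" "l *\<^sub>R x"] l by (simp add: F_eq)
  have "(LINT b|lborel. \<rho> b * g (l *\<^sub>R x + (1 - l) *\<^sub>R b)) = (LINT y|lborel. F y) / (1 - l) ^ CARD('n)"
    using lborel_affine_integral[OF _ F_meas, of "1 - l" "l *\<^sub>R x"] l by (simp add: F_eq)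
  then show "dilation_mean \<rho> l g x = (LINT b|lborel. \<rho> b * g (l *\<^sub>R x + (1 - l) *\<^sub>R b))"
    by (simp add: dilation_mean_def F_def power_one_over)
qed

text \<open>Jensen's inequality for the square and the probability density \<open>\<rho>\<close>,
  obtained from the nonnegativity of the variance. If the right-hand side is not integrable, it is
  infinite and nothing is to be shown.\<close>

lemma dilation_mean_square_le:
  fixes g :: "real^'n::finite \<Rightarrow> real"
  assumes \<rho>: "test_fun C \<rho>" "\<And>x. \<rho> x \<ge> 0" "(LINT x|lborel. \<rho> x) = 1"
    and l: "l < 1" and g: "integrable lborel g"
  shows "ennreal ((dilation_mean \<rho> l g x - g x)\<^sup>2)
    \<le> (\<integral>\<^sup>+b. ennreal (\<rho> b * (g (l *\<^sub>R x + (1 - l) *\<^sub>R b) - g x)\<^sup>2) \<partial>lborel)"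
proof (cases "integrable lborel (\<lambda>b. \<rho> b * (g (l *\<^sub>R x + (1 - l) *\<^sub>R b) - g x)\<^sup>2)")
  case False
  have "\<rho> \<in> borel_measurable borel" "g \<in> borel_measurable borel"
    using \<rho> g by (auto simp: test_fun_def smooth_borel_measurable)
  then have "(\<lambda>b. \<rho> b * (g (l *\<^sub>R x + (1 - l) *\<^sub>R b) - g x)\<^sup>2) \<in> borel_measurable lborel"
    by measurable
  then have "(\<integral>\<^sup>+b. ennreal (\<rho> b * (g (l *\<^sub>R x + (1 - l) *\<^sub>R b) - g x)\<^sup>2) \<partial>lborel) = \<infinity>"
    using False \<rho>(2) by (subst (asm) integrable_iff_bounded) (auto simp: abs_mult less_top[symmetric])
  then show ?thesis by simp
next
  case True
  have \<rho>_int: "integrable lborel \<rho>"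
    using \<rho>(3) by (metis not_integrable_integral_eq zero_neq_one)
  let ?d = "\<lambda>b. g (l *\<^sub>R x + (1 - l) *\<^sub>R b) - g x"
  have int1: "integrable lborel (\<lambda>b. \<rho> b * ?d b)"
    using dilation_mean_eq(1)[OF \<rho>(1) l g, of x] \<rho>_int by (simp add: right_diff_distrib)
  define m where "m = dilation_mean \<rho> l g x - g x"
  have m: "(LINT b|lborel. \<rho> b * ?d b) = m"
    using dilation_mean_eq[OF \<rho>(1) l g, of x] \<rho>_int \<rho>(3) by (simp add: right_diff_distrib m_def)
  have "0 \<le> (LINT b|lborel. \<rho> b * (?d b - m)\<^sup>2)"
    using \<rho>(2) by (intro Bochner_Integration.integral_nonneg) auto
  also have "\<dots> = (LINT b|lborel. \<rho> b * (?d b)\<^sup>2 - (2 * m) * (\<rho> b * ?d b) + m\<^sup>2 * \<rho> b)"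
    by (intro Bochner_Integration.integral_cong refl) (simp add: power2_eq_square algebra_simps)
  also have "\<dots> = (LINT b|lborel. \<rho> b * (?d b)\<^sup>2) - (2 * m) * m + m\<^sup>2 * 1"
    using True int1 \<rho>_int \<rho>(3) m
    by (simp del: integral_mult_right_zero add: integral_mult_right)
  finally have "m\<^sup>2 \<le> (LINT b|lborel. \<rho> b * (?d b)\<^sup>2)" by (simp add: power2_eq_square)
  also have "ennreal \<dots> = (\<integral>\<^sup>+b. ennreal (\<rho> b * (?d b)\<^sup>2) \<partial>lborel)"
    using True \<rho>(2) by (intro nn_integral_eq_integral[symmetric]) auto
  finally show ?thesis by (simp add: m_def ennreal_leI)
qed

text \<open>Jensen's inequality at each \<open>x\<close>, then Tonelli's theorem to integrate over
  \<open>x\<close> first. Every \<open>b\<close> with \<open>\<rho> b \<noteq> 0\<close> lies in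
  \<open>C\<close>, where the dilation error is uniformly small, and \<open>\<rho>\<close> has total
  mass 1.\<close>

lemma dilation_mean_L2_tendsto:
  fixes g :: "real^'n::finite \<Rightarrow> real"
  assumes \<rho>: "test_fun C \<rho>" "\<And>x. \<rho> x \<ge> 0" "(LINT x|lborel. \<rho> x) = 1"
    and C: "open C" "convex C" "bounded C"
    and g: "integrable lborel g" "integrable lborel (\<lambda>x. indicator C x * (g x)\<^sup>2)"
    and l: "\<And>m. l m < 1" "l \<longlonglongrightarrow> 1"
  shows "(\<lambda>m. LINT x|lborel. indicator C x * (dilation_mean \<rho> (l m) g x - g x)\<^sup>2) \<longlonglongrightarrow> 0"
proof (rule LIMSEQ_I)
  fix e :: real assume e: "e > 0"
  have g_meas[measurable]: "g \<in> borel_measurable borel" using g by auto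
  have \<rho>_meas[measurable]: "\<rho> \<in> borel_measurable borel"
    using \<rho> by (simp add: test_fun_def smooth_borel_measurable)
  have C_meas[measurable]: "C \<in> sets borel" using C by auto
  obtain d where d: "0 < d" "d < 1" "\<And>l b. 1 - d < l \<Longrightarrow> l < 1 \<Longrightarrow> b \<in> C \<Longrightarrow>
       (\<integral>\<^sup>+x. ennreal (indicator C x * (g (l *\<^sub>R x + (1 - l) *\<^sub>R b) - g x)\<^sup>2) \<partial>lborel) \<le> ennreal (e / 2)"
    using L2_dilation_continuous[OF g_meas g(2) C, of "e / 2"] e by auto
  have bound: "(LINT x|lborel. indicator C x * (dilation_mean \<rho> l g x - g x)\<^sup>2) \<le> e / 2"
    if l: "1 - d < l" "l < 1" for l
  proof -
    have D_meas: "dilation_mean \<rho> l g \<in> borel_measurable borel"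
      by (intro smooth_borel_measurable dilation_mean_smooth[OF \<rho>(1) l(2) g(1)])
    have "(\<integral>\<^sup>+x. ennreal (indicator C x * (dilation_mean \<rho> l g x - g x)\<^sup>2) \<partial>lborel)
       \<le> (\<integral>\<^sup>+x. (\<integral>\<^sup>+b. ennreal (\<rho> b) * ennreal (indicator C x * (g (l *\<^sub>R x + (1 - l) *\<^sub>R b) - g x)\<^sup>2) \<partial>lborel) \<partial>lborel)"
    proof (rule nn_integral_mono)
      fix x
      show "ennreal (indicator C x * (dilation_mean \<rho> l g x - g x)\<^sup>2)
        \<le> (\<integral>\<^sup>+b. ennreal (\<rho> b) * ennreal (indicator C x * (g (l *\<^sub>R x + (1 - l) *\<^sub>R b) - g x)\<^sup>2) \<partial>lborel)"
        using dilation_mean_square_le[OF \<rho> l(2) g(1), of x] \<rho>(2)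
        by (cases "x \<in> C") (auto simp: ennreal_mult')
    qed
    also have "\<dots> = (\<integral>\<^sup>+b. (\<integral>\<^sup>+x. ennreal (\<rho> b) * ennreal (indicator C x * (g (l *\<^sub>R x + (1 - l) *\<^sub>R b) - g x)\<^sup>2) \<partial>lborel) \<partial>lborel)"
      by (rule lborel_pair.Fubini') measurable
    also have "\<dots> = (\<integral>\<^sup>+b. ennreal (\<rho> b) * (\<integral>\<^sup>+x. ennreal (indicator C x * (g (l *\<^sub>R x + (1 - l) *\<^sub>R b) - g x)\<^sup>2) \<partial>lborel) \<partial>lborel)"
      by (intro nn_integral_cong nn_integral_cmult) measurable
    also have "\<dots> \<le> (\<integral>\<^sup>+b. ennreal (\<rho> b) * ennreal (e / 2) \<partial>lborel)"
    proof (intro nn_integral_mono)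
      fix b
      show "ennreal (\<rho> b) * (\<integral>\<^sup>+x. ennreal (indicator C x * (g (l *\<^sub>R x + (1 - l) *\<^sub>R b) - g x)\<^sup>2) \<partial>lborel)
          \<le> ennreal (\<rho> b) * ennreal (e / 2)"
      proof (cases "\<rho> b = 0")
        case False
        then have "b \<in> C" using \<rho>(1) closure_subset[of "{x. \<rho> x \<noteq> 0}"] by (auto simp: test_fun_def)
        then show ?thesis by (intro mult_left_mono d l) auto
      qed auto
    qed
    also have "\<dots> = (\<integral>\<^sup>+b. ennreal (\<rho> b) \<partial>lborel) * ennreal (e / 2)"
      by (rule nn_integral_multc) measurable
    also have "(\<integral>\<^sup>+b. ennreal (\<rho> b) \<partial>lborel) = 1"
    proof -
      have "integrable lborel \<rho>" using \<rho>(3) by (metis not_integrable_integral_eq zero_neq_one)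
      then show ?thesis using \<rho>(2,3) by (subst nn_integral_eq_integral) auto
    qed
    finally have "(\<integral>\<^sup>+x. ennreal (indicator C x * (dilation_mean \<rho> l g x - g x)\<^sup>2) \<partial>lborel) \<le> ennreal (e / 2)"
      by simp
    then have "enn2real (\<integral>\<^sup>+x. ennreal (indicator C x * (dilation_mean \<rho> l g x - g x)\<^sup>2) \<partial>lborel) \<le> e / 2"
      using e by (intro enn2real_leI) auto
    moreover have "(LINT x|lborel. indicator C x * (dilation_mean \<rho> l g x - g x)\<^sup>2)
       = enn2real (\<integral>\<^sup>+x. ennreal (indicator C x * (dilation_mean \<rho> l g x - g x)\<^sup>2) \<partial>lborel)"
      by (rule integral_eq_nn_integral) (use D_meas in \<open>auto simp: indicator_def\<close>)
    ultimately show ?thesis by simp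
  qed
  have "\<forall>\<^sub>F m in sequentially. 1 - d < l m"
    using l(2) d(1) by (intro order_tendstoD(1)[of l 1]) auto
  then obtain m0 where m0: "\<And>m. m \<ge> m0 \<Longrightarrow> 1 - d < l m" by (auto simp: eventually_sequentially)
  have "norm ((LINT x|lborel. indicator C x * (dilation_mean \<rho> (l m) g x - g x)\<^sup>2) - 0) < e" if "m \<ge> m0" for m
  proof -
    have "0 \<le> (LINT x|lborel. indicator C x * (dilation_mean \<rho> (l m) g x - g x)\<^sup>2)"
      by (rule Bochner_Integration.integral_nonneg) auto
    then show ?thesis
      using bound[OF m0[OF that] l(1)] e by simp
  qed
  then show "\<exists>m0. \<forall>m\<ge>m0. norm ((LINT x|lborel. indicator C x * (dilation_mean \<rho> (l m) g x - g x)\<^sup>2) - 0) < e"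
    by blast
qed

section \<open>First-order weak derivatives and smooth approximation in \<open>H^1\<close>\<close>

lemma coord_list: "distinct (coord_list :: 'n::finite list)" "set (coord_list :: 'n list) = UNIV"
proof -
  obtain xs :: "'n list" where "set xs = UNIV" "distinct xs"
    using finite_distinct_list[of "UNIV :: 'n set"] by auto
  then have "\<exists>xs :: 'n list. distinct xs \<and> set xs = UNIV" by blast
  from someI_ex[OF this] show "distinct (coord_list :: 'n list)" "set (coord_list :: 'n list) = UNIV"
    unfolding coord_list_def by auto
qed

lemma concat_map_single:
  assumes "distinct xs"
  shows "concat (map (\<lambda>j. if j = i then ys else []) xs) = (if i \<in> set xs then ys else [])"
  using assms
proof (induction xs)
  case (Cons x xs)
  then show ?case by (cases "x = i") auto
qed auto

lemma mi_deriv_single: "mi_deriv (mi_single i m) f = (partial_deriv i ^^ m) f"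
proof -
  have "(\<lambda>j. replicate (mi_single i m j) j) = (\<lambda>j. if j = i then replicate m i else [])"
    by (auto simp: mi_single_def)
  then have "mi_deriv (mi_single i m) f = foldr partial_deriv (replicate m i) f"
    by (simp add: mi_deriv_def concat_map_single[OF coord_list(1)] coord_list(2))
  also have "\<dots> = (partial_deriv i ^^ m) f" by (induction m) auto
  finally show ?thesis .
qed

lemma mi_order_single [simp]: "mi_order (mi_single i m) = m"
  by (simp add: mi_order_def mi_single_def)

lemma is_weak_deriv_single:
  "is_weak_deriv \<Omega> (mi_single i 1) v g \<longleftrightarrow>
    (\<forall>\<phi>. test_fun \<Omega> \<phi> \<longrightarrow> (LINT x|lebesgue_on \<Omega>. v x * partial_deriv i \<phi> x)
          = - (LINT x|lebesgue_on \<Omega>. g x * \<phi> x))"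
  by (simp add: is_weak_deriv_def mi_deriv_single)

lemma borel_representative:
  fixes f :: "'a::euclidean_space \<Rightarrow> real"
  assumes f: "f \<in> borel_measurable (lebesgue_on S)" and S: "S \<in> sets borel"
  obtains f0 where "f0 \<in> borel_measurable borel" "\<And>x. x \<notin> S \<Longrightarrow> f0 x = 0" "AE x in lebesgue_on S. f x = f0 x"
proof -
  have "(\<lambda>x. indicator S x *\<^sub>R f x) \<in> borel_measurable lebesgue"
    using f S by (subst borel_measurable_restrict_space_iff[symmetric]) auto
  from completion_ex_borel_measurable_real[OF this]
  obtain f1 where f1: "f1 \<in> borel_measurable lborel" "AE x in lborel. indicator S x *\<^sub>R f x = f1 x" by blast
  from AE_completion[OF f1(2)] have "AE x in lebesgue_on S. f x = indicator S x * f1 x"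
    using S by (subst AE_restrict_space_iff) (auto elim!: eventually_mono simp: indicator_def split: if_splits)
  with f1(1) S show ?thesis
    by (intro that[of "\<lambda>x. indicator S x * f1 x"]) auto
qed

text \<open>Extension by 0 allows integration over the whole space, where the affine substitutions
  and Tonelli's theorem are available. Integrability of \<open>f0\<close> itself, which the
  convolutions use, comes from \<open>\<bar>t\<bar> \<le> t^2 + 1\<close> on a set of finite
  measure.\<close>

lemma L2_borel_representative:
  fixes f :: "'a::euclidean_space \<Rightarrow> real"
  assumes f: "f \<in> L2_fun (lebesgue_on S)" and S: "S \<in> sets borel" "bounded S"
  obtains f0 where "f0 \<in> borel_measurable borel" "\<And>x. x \<notin> S \<Longrightarrow> f0 x = 0" "AE x in lebesgue_on S. f x = f0 x"
    "integrable lborel f0" "integrable lborel (\<lambda>x. indicator S x * (f0 x)\<^sup>2)"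
proof -
  obtain f0 where f0: "f0 \<in> borel_measurable borel" "\<And>x. x \<notin> S \<Longrightarrow> f0 x = 0" "AE x in lebesgue_on S. f x = f0 x"
    using borel_representative[OF _ S(1), of f] f unfolding L2_fun_def by blast
  have cm: "complete_measure (lebesgue_on S)" by (rule complete_measure_lebesgue_on) (use S in auto)
  have "AE x in lebesgue_on S. (f x)\<^sup>2 = (f0 x)\<^sup>2" using f0(3) by eventually_elim simp
  then have "integrable (lebesgue_on S) (\<lambda>x. (f0 x)\<^sup>2)"
    by (rule integrable_cong_AE_complete[OF cm]) (use f in \<open>simp add: L2_fun_def\<close>)
  then have 1: "integrable lborel (\<lambda>x. indicator S x * (f0 x)\<^sup>2)"
    using f0(1) S by (subst (asm) integrable_lebesgue_on_borel) auto
  have "emeasure lborel S < \<infinity>" by (rule emeasure_bounded_finite[OF S(2)])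
  then have "integrable lborel (\<lambda>x. indicator S x * (f0 x)\<^sup>2 + indicator S x)"
    using 1 S by (intro Bochner_Integration.integrable_add integrable_real_indicator) auto
  then have "integrable lborel f0"
  proof (rule Bochner_Integration.integrable_bound)
    have "\<bar>t\<bar> \<le> t\<^sup>2 + 1" for t :: real
      using zero_le_power2[of "\<bar>t\<bar> - 1"] unfolding power2_diff power2_abs by simp
    then show "AE x in lborel. norm (f0 x) \<le> norm (indicator S x * (f0 x)\<^sup>2 + indicator S x)"
      using f0(2) by (intro AE_I2) (auto simp: indicator_def)
  qed (use f0 in auto)
  with f0 1 that show ?thesis by blast
qed

text \<open>For \<open>x\<close> in \<open>C\<close> the kernel, as a function of \<open>y\<close>,
  is supported in \<open>l x + (1 - l) b\<close> with \<open>b\<close> in the support of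
  \<open>\<rho>\<close>. By convexity this lies in \<open>C\<close>, so the kernel is a test
  function and its derivative can be moved onto \<open>g\<close>. The factor \<open>l\<close> is the
  inner derivative with respect to \<open>x\<close>; its minus sign cancels that of the weak
  derivative.\<close>

lemma dilation_mean_partial_deriv:
  fixes g G :: "real^'n::finite \<Rightarrow> real"
  assumes \<rho>: "test_fun C \<rho>" and C: "convex C" and l: "0 < l" "l < 1"
    and g: "integrable lborel g"
    and wd: "\<And>\<phi>. test_fun C \<phi> \<Longrightarrow> (LINT y|lborel. g y * partial_deriv i \<phi> y) = - (LINT y|lborel. G y * \<phi> y)"
    and x: "x \<in> C"
  shows "partial_deriv i (dilation_mean \<rho> l g) x = l * dilation_mean \<rho> l G x"
proof -
  define K where "K = (\<lambda>z. \<rho> ((1 / (1 - l)) *\<^sub>R z))"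
  have \<rho>': "smooth \<rho>" "compact (closure {x. \<rho> x \<noteq> 0})" "closure {x. \<rho> x \<noteq> 0} \<subseteq> C"
    using \<rho> by (auto simp: test_fun_def)
  have K: "smooth K" "compact (closure {x. K x \<noteq> 0})"
    unfolding K_def using smooth_compact_support_scale[OF \<rho>'(1,2), of "1 / (1 - l)"] l by auto
  define \<phi> where "\<phi> = (\<lambda>y. K (1 *\<^sub>R y + (- l) *\<^sub>R x))"
  have \<phi>_eq: "\<phi> = (\<lambda>y. \<rho> ((1 / (1 - l)) *\<^sub>R y + (- l / (1 - l)) *\<^sub>R x))"
    by (auto simp: \<phi>_def K_def scaleR_diff_right)
  have "test_fun C \<phi>"
    unfolding test_fun_def
  proof (intro conjI)
    show "smooth \<phi>" unfolding \<phi>_def by (rule smooth_affine_comp[OF K(1)])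
    show "compact (closure {x. \<phi> x \<noteq> 0})"
      unfolding \<phi>_eq by (rule compact_support_scale(1)) (use \<rho>' l in auto)
    have "closure {x. \<phi> x \<noteq> 0} \<subseteq> (\<lambda>y. (1 / (1 / (1 - l))) *\<^sub>R (y - (- l / (1 - l)) *\<^sub>R x)) ` closure {x. \<rho> x \<noteq> 0}"
      unfolding \<phi>_eq by (rule compact_support_scale(2)) (use \<rho>' l in auto)
    also have "\<dots> \<subseteq> C"
    proof safe
      fix b assume "b \<in> closure {x. \<rho> x \<noteq> 0}"
      then have "l *\<^sub>R x + (1 - l) *\<^sub>R b \<in> C"
        using \<rho>'(3) by (intro dilation_in_convex C x l) auto
      moreover have "(1 / (1 / (1 - l))) *\<^sub>R (b - (- l / (1 - l)) *\<^sub>R x) = l *\<^sub>R x + (1 - l) *\<^sub>R b"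
        using l by (simp add: scaleR_add_right)
      ultimately show "(1 / (1 / (1 - l))) *\<^sub>R (b - (- l / (1 - l)) *\<^sub>R x) \<in> C" by simp
    qed
    finally show "closure {x. \<phi> x \<noteq> 0} \<subseteq> C" .
  qed
  have d\<phi>: "partial_deriv i \<phi> y = partial_deriv i K ((- l) *\<^sub>R x + 1 *\<^sub>R y)" for y
    unfolding \<phi>_def using partial_deriv_affine_comp[OF smooth_differentiable[OF K(1)], of i 1 "(- l) *\<^sub>R x" y]
    by (simp add: add.commute)
  let ?c = "(1 / (1 - l)) ^ CARD('n)"
  have diff: "(\<lambda>x. LINT y|lborel. K ((- l) *\<^sub>R x + 1 *\<^sub>R y) * g y) differentiable (at x)"
    by (rule differentiableI[OF convolution_has_derivative[OF K g]])
  have "partial_deriv i (dilation_mean \<rho> l g) x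
      = partial_deriv i (\<lambda>x. ?c * (LINT y|lborel. K ((- l) *\<^sub>R x + 1 *\<^sub>R y) * g y)) x"
    by (simp add: dilation_mean_def[abs_def] K_def)
  also have "\<dots> = ?c * ((- l) * (LINT y|lborel. partial_deriv i K ((- l) *\<^sub>R x + 1 *\<^sub>R y) * g y))"
    by (subst partial_deriv_mult[OF differentiable_const diff])
       (simp only: partial_deriv_const convolution_partial_deriv[OF K g] mult_zero_left add_0_right)
  also have "(LINT y|lborel. partial_deriv i K ((- l) *\<^sub>R x + 1 *\<^sub>R y) * g y) = (LINT y|lborel. g y * partial_deriv i \<phi> y)"
    by (simp add: d\<phi> mult.commute)
  also have "\<dots> = - (LINT y|lborel. G y * \<phi> y)"
    by (rule wd[OF \<open>test_fun C \<phi>\<close>])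
  also have "(LINT y|lborel. G y * \<phi> y) = (LINT y|lborel. \<rho> ((1 / (1 - l)) *\<^sub>R ((- l) *\<^sub>R x + 1 *\<^sub>R y)) * G y)"
    by (simp add: \<phi>_def K_def mult.commute add.commute)
  finally show ?thesis
    by (simp add: dilation_mean_def[of \<rho> l G])
qed

text \<open>Splitting \<open>l D - G = l (D - G) + (l - 1) G\<close> reduces the extra factor
  \<open>l\<close> to the convergence of the dilation means and to
  \<open>l \<longlonglongrightarrow> 1\<close>.\<close>

lemma dilation_mean_deriv_L2_tendsto:
  fixes G :: "real^'n::finite \<Rightarrow> real"
  assumes \<rho>: "test_fun C \<rho>" "\<And>x. \<rho> x \<ge> 0" "(LINT x|lborel. \<rho> x) = 1"
    and C: "open C" "convex C" "bounded C"
    and G: "integrable lborel G" "integrable lborel (\<lambda>x. indicator C x * (G x)\<^sup>2)"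
    and l: "\<And>m. 0 < l m" "\<And>m. l m < 1" "l \<longlonglongrightarrow> 1"
  shows "(\<lambda>m. LINT x|lborel. indicator C x * (l m * dilation_mean \<rho> (l m) G x - G x)\<^sup>2) \<longlonglongrightarrow> 0"
proof (rule tendsto_sandwich[OF _ _ tendsto_const])
  let ?D = "\<lambda>m. dilation_mean \<rho> (l m) G"
  have C_meas: "C \<in> sets borel" using C by auto
  have C_fin: "emeasure lborel C < \<infinity>" by (rule emeasure_bounded_finite[OF C(3)])
  let ?J = "\<lambda>m. 2 * (LINT x|lborel. indicator C x * (?D m x - G x)\<^sup>2) + (2 * (l m - 1)\<^sup>2) * (LINT x|lborel. indicator C x * (G x)\<^sup>2)"
  have D_smooth: "smooth (?D m)" for m by (rule dilation_mean_smooth[OF \<rho>(1) l(2) G(1)])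
  have int: "integrable lborel (\<lambda>x. indicator C x * (?D m x - G x)\<^sup>2)" for m
  proof -
    have "bounded (?D m ` closure C)"
      using C(3) by (intro compact_imp_bounded compact_continuous_image smooth_continuous_on D_smooth) (auto simp: compact_closure)
    then obtain B where B: "\<And>x. x \<in> closure C \<Longrightarrow> \<bar>?D m x\<bar> \<le> B" by (auto simp: bounded_iff)
    have "integrable lborel (\<lambda>x. 2 * (B\<^sup>2 * indicator C x) + 2 * (indicator C x * (G x)\<^sup>2))"
      using C_fin C_meas G(2) by (intro Bochner_Integration.integrable_add integrable_mult_right integrable_real_indicator) auto
    then show ?thesis
    proof (rule Bochner_Integration.integrable_bound)
      show "AE x in lborel. norm (indicator C x * (?D m x - G x)\<^sup>2) \<le> norm (2 * (B\<^sup>2 * indicator C x) + 2 * (indicator C x * (G x)\<^sup>2))"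
      proof (rule AE_I2)
        fix x
        show "norm (indicator C x * (?D m x - G x)\<^sup>2) \<le> norm (2 * (B\<^sup>2 * indicator C x) + 2 * (indicator C x * (G x)\<^sup>2))"
        proof (cases "x \<in> C")
          case True
          then have "\<bar>?D m x\<bar> \<le> \<bar>B\<bar>" using B[of x] closure_subset[of C] by force
          then have "(?D m x)\<^sup>2 \<le> B\<^sup>2" by (simp only: abs_le_square_iff)
          with square_sum_le2[of "?D m x" "- G x"] True show ?thesis by simp
        qed auto
      qed
    qed (use smooth_borel_measurable[OF D_smooth] C_meas G(1) in measurable)
  qed
  have le: "indicator C x * (l m * ?D m x - G x)\<^sup>2
      \<le> 2 * (indicator C x * (?D m x - G x)\<^sup>2) + (2 * (l m - 1)\<^sup>2) * (indicator C x * (G x)\<^sup>2)" for m x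
  proof -
    have "(l m * (?D m x - G x) + (l m - 1) * G x)\<^sup>2 \<le> 2 * (l m * (?D m x - G x))\<^sup>2 + 2 * ((l m - 1) * G x)\<^sup>2"
      by (rule square_sum_le2)
    also have "(l m * (?D m x - G x))\<^sup>2 \<le> (?D m x - G x)\<^sup>2"
      using l(1)[of m] l(2)[of m] by (simp add: power_mult_distrib mult_left_le_one_le power_le_one)
    finally have "(l m * (?D m x - G x) + (l m - 1) * G x)\<^sup>2 \<le> 2 * (?D m x - G x)\<^sup>2 + 2 * (l m - 1)\<^sup>2 * (G x)\<^sup>2"
      by (simp add: power_mult_distrib)
    moreover have "l m * (?D m x - G x) + (l m - 1) * G x = l m * ?D m x - G x"
      by (simp add: algebra_simps)
    ultimately have "(l m * ?D m x - G x)\<^sup>2 \<le> 2 * (?D m x - G x)\<^sup>2 + 2 * (l m - 1)\<^sup>2 * (G x)\<^sup>2"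
      by simp
    then show ?thesis by (auto simp: indicator_def)
  qed
  show "\<forall>\<^sub>F m in sequentially. (LINT x|lborel. indicator C x * (l m * ?D m x - G x)\<^sup>2) \<le> ?J m"
  proof (intro always_eventually allI)
    fix m
    have int2: "integrable lborel (\<lambda>x. 2 * (indicator C x * (?D m x - G x)\<^sup>2) + (2 * (l m - 1)\<^sup>2) * (indicator C x * (G x)\<^sup>2))"
      using int[of m] G(2) by simp
    have "(LINT x|lborel. indicator C x * (l m * ?D m x - G x)\<^sup>2)
      \<le> (LINT x|lborel. 2 * (indicator C x * (?D m x - G x)\<^sup>2) + (2 * (l m - 1)\<^sup>2) * (indicator C x * (G x)\<^sup>2))"
    proof (rule integral_mono[OF _ int2 le])
      show "integrable lborel (\<lambda>x. indicator C x * (l m * ?D m x - G x)\<^sup>2)"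
        by (rule Bochner_Integration.integrable_bound[OF int2])
           (use smooth_borel_measurable[OF D_smooth] C_meas G(1) le in \<open>auto intro!: AE_I2 simp: abs_of_nonneg\<close>)
    qed
    also have "\<dots> = ?J m" using int[of m] G(2) by simp
    finally show "(LINT x|lborel. indicator C x * (l m * ?D m x - G x)\<^sup>2) \<le> ?J m" .
  qed
  have "?J \<longlonglongrightarrow> 2 * 0 + (2 * (1 - 1)\<^sup>2) * (LINT x|lborel. indicator C x * (G x)\<^sup>2)"
    by (intro tendsto_intros l dilation_mean_L2_tendsto[OF \<rho> C G])
  then show "?J \<longlonglongrightarrow> 0" by simp
qed auto

text \<open>The dilation means depend on \<open>g\<close> alone, so one sequence serves all
  directions and all representatives \<open>G\<close> of the weak derivatives at once. Green's
  formula uses this for derivatives chosen on an element and for restrictions of derivatives chosen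
  on \<open>\<Omega>\<close>.\<close>

lemma H1_smooth_density:
  fixes C :: "(real^'n::finite) set"
  assumes C: "open C" "convex C" "bounded C" "C \<noteq> {}" and g: "g \<in> L2_fun (lebesgue_on C)"
  obtains \<psi> where "\<And>m. smooth (\<psi> m)"
    "(\<lambda>m. LINT x|lebesgue_on C. (\<psi> m x - g x)\<^sup>2) \<longlonglongrightarrow> 0"
    "\<And>i G. G \<in> L2_fun (lebesgue_on C) \<Longrightarrow> is_weak_deriv C (mi_single i 1) g G \<Longrightarrow>
       (\<lambda>m. LINT x|lebesgue_on C. (partial_deriv i (\<psi> m) x - G x)\<^sup>2) \<longlonglongrightarrow> 0"
proof -
  have C_meas: "C \<in> sets borel" using C by auto
  have cm: "complete_measure (lebesgue_on C)" by (rule complete_measure_lebesgue_on) (use C_meas in auto)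
  obtain \<rho> where \<rho>: "test_fun C \<rho>" "\<And>x. \<rho> x \<ge> 0" "(LINT x|lborel. \<rho> x) = 1"
    using exists_bump_in[OF C(1,4)] by blast
  \<comment> \<open>The summand 2 keeps \<open>l m\<close> positive already for
    \<open>m = 0\<close>.\<close>
  define l where "l = (\<lambda>m. 1 - 1 / (real m + 2))"
  have l: "0 < l m" "l m < 1" for m by (auto simp: l_def field_simps)
  have "(\<lambda>m. 1 / (real m + 2)) \<longlonglongrightarrow> 0" by real_asymp
  then have l_lim: "l \<longlonglongrightarrow> 1" unfolding l_def using tendsto_diff[OF tendsto_const[of 1]] by fastforce
  obtain g0 where g0: "g0 \<in> borel_measurable borel" "\<And>x. x \<notin> C \<Longrightarrow> g0 x = 0" "AE x in lebesgue_on C. g x = g0 x"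
    "integrable lborel g0" "integrable lborel (\<lambda>x. indicator C x * (g0 x)\<^sup>2)"
    using L2_borel_representative[OF g C_meas C(3)] by blast
  define \<psi> where "\<psi> = (\<lambda>m. dilation_mean \<rho> (l m) g0)"
  have smooth: "smooth (\<psi> m)" for m
    unfolding \<psi>_def by (rule dilation_mean_smooth[OF \<rho>(1) l(2) g0(4)])
  have transfer: "(LINT x|lebesgue_on C. f x * h x) = (LINT x|lborel. f0 x * h x)"
    if "AE x in lebesgue_on C. f x = f0 x" "f0 \<in> borel_measurable borel" "\<And>x. x \<notin> C \<Longrightarrow> f0 x = 0"
      "h \<in> borel_measurable borel" for f f0 h :: "real^'n \<Rightarrow> real"
  proof -
    have "AE x in lebesgue_on C. f x * h x = f0 x * h x" using that(1) by eventually_elim simp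
    from integral_cong_AE_complete[OF cm this]
    have "(LINT x|lebesgue_on C. f x * h x) = (LINT x|lebesgue_on C. f0 x * h x)" .
    also have "\<dots> = (LINT x|lborel. indicator C x * (f0 x * h x))"
      using that C_meas by (intro integral_lebesgue_on_borel) auto
    also have "\<dots> = (LINT x|lborel. f0 x * h x)"
      using that(3) by (intro Bochner_Integration.integral_cong) (auto simp: indicator_def)
    finally show ?thesis .
  qed
  have transfer2: "(LINT x|lebesgue_on C. (h x - f x)\<^sup>2) = (LINT x|lborel. indicator C x * (h x - f0 x)\<^sup>2)"
    if "AE x in lebesgue_on C. f x = f0 x" "f0 \<in> borel_measurable borel" "h \<in> borel_measurable borel"
    for f f0 h :: "real^'n \<Rightarrow> real"
  proof -
    have "AE x in lebesgue_on C. (h x - f x)\<^sup>2 = (h x - f0 x)\<^sup>2" using that(1) by eventually_elim simp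
    from integral_cong_AE_complete[OF cm this]
    have "(LINT x|lebesgue_on C. (h x - f x)\<^sup>2) = (LINT x|lebesgue_on C. (h x - f0 x)\<^sup>2)" .
    also have "\<dots> = (LINT x|lborel. indicator C x * (h x - f0 x)\<^sup>2)"
      using that C_meas by (intro integral_lebesgue_on_borel) auto
    finally show ?thesis .
  qed
  show ?thesis
  proof (rule that[of \<psi>])
    show "smooth (\<psi> m)" for m by (rule smooth)
    show "(\<lambda>m. LINT x|lebesgue_on C. (\<psi> m x - g x)\<^sup>2) \<longlonglongrightarrow> 0"
      using dilation_mean_L2_tendsto[OF \<rho> C(1-3) g0(4,5) l(2) l_lim]
        transfer2[OF g0(3,1) smooth_borel_measurable[OF smooth]]
      by (simp add: \<psi>_def)
  next
    fix i G
    assume G: "G \<in> L2_fun (lebesgue_on C)" and wd: "is_weak_deriv C (mi_single i 1) g G"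
    obtain G0 where G0: "G0 \<in> borel_measurable borel" "\<And>x. x \<notin> C \<Longrightarrow> G0 x = 0" "AE x in lebesgue_on C. G x = G0 x"
      "integrable lborel G0" "integrable lborel (\<lambda>x. indicator C x * (G0 x)\<^sup>2)"
      using L2_borel_representative[OF G C_meas C(3)] by blast
    have wd0: "(LINT y|lborel. g0 y * partial_deriv i \<phi> y) = - (LINT y|lborel. G0 y * \<phi> y)"
      if \<phi>: "test_fun C \<phi>" for \<phi>
    proof -
      have "smooth \<phi>" using \<phi> by (simp add: test_fun_def)
      then show ?thesis
        using wd[unfolded is_weak_deriv_single, rule_format, OF \<phi>]
          transfer[OF g0(3,1,2) smooth_borel_measurable[OF smooth_partial_deriv], of \<phi> i]
          transfer[OF G0(3,1,2) smooth_borel_measurable, of \<phi>] by simp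
    qed
    have "(LINT x|lebesgue_on C. (partial_deriv i (\<psi> m) x - G x)\<^sup>2)
        = (LINT x|lborel. indicator C x * (l m * dilation_mean \<rho> (l m) G0 x - G0 x)\<^sup>2)" for m
    proof -
      have "(LINT x|lebesgue_on C. (partial_deriv i (\<psi> m) x - G x)\<^sup>2)
        = (LINT x|lborel. indicator C x * (partial_deriv i (\<psi> m) x - G0 x)\<^sup>2)"
        by (rule transfer2[OF G0(3,1) smooth_borel_measurable[OF smooth_partial_deriv[OF smooth]]])
      also have "\<dots> = (LINT x|lborel. indicator C x * (l m * dilation_mean \<rho> (l m) G0 x - G0 x)\<^sup>2)"
        using dilation_mean_partial_deriv[OF \<rho>(1) C(2) l g0(4) wd0]
        by (intro Bochner_Integration.integral_cong) (auto simp: indicator_def \<psi>_def)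
      finally show ?thesis .
    qed
    then show "(\<lambda>m. LINT x|lebesgue_on C. (partial_deriv i (\<psi> m) x - G x)\<^sup>2) \<longlonglongrightarrow> 0"
      using dilation_mean_deriv_L2_tendsto[OF \<rho> C(1-3) G0(4,5) l l_lim] by simp
  qed
qed

section \<open>Facets of solid polytopes\<close>

text \<open>The abstraction of a mesh element: the arguments rest on the facet inequalities of a
  full-dimensional polytope.\<close>

locale solid_polytope =
  fixes T :: "(real^'n::finite) set"
  assumes polytope: "polytope T" and interior_nonempty: "interior T \<noteq> {}"
begin

abbreviation normal :: "(real^'n) set \<Rightarrow> real^'n" where
  "normal F \<equiv> outer_normal T F"

text \<open>The constant \<open>c\<close> in \<open>side_measure\<close>. The choice of the point is
  immaterial, since a facet lies in one level set of its normal functional.\<close>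

definition offset :: "(real^'n) set \<Rightarrow> real" where
  "offset F = normal F \<bullet> (SOME p. p \<in> F)"

lemma compact: "compact T" and convex: "convex T" and closed: "closed T" and bounded: "bounded T"
  using polytope polytope_imp_compact polytope_imp_convex compact_imp_closed compact_imp_bounded by blast+

lemma finite_facets: "finite {F. F facet_of T}"
  by (rule finite_polytope_facets[OF polytope])

lemma closure_interior: "closure (interior T) = T"
  by (simp add: convex_closure_interior[OF convex interior_nonempty] closed)

text \<open>A minimal representation by half-spaces has no redundant member, so some
  \<open>z\<close> violates exactly one of the inequalities. The segment from an interior point to
  \<open>z\<close> crosses that hyperplane at a point strictly inside all other half-spaces. Such
  points also show that different half-spaces cut out different facets, so that inequalities can be
  indexed by facets.\<close>

lemma exists_facet_inequalities:
  obtains n c where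
    "\<And>F. F facet_of T \<Longrightarrow> norm (n F) = 1" "\<And>F. F facet_of T \<Longrightarrow> F = T \<inter> {x. n F \<bullet> x = c F}"
    "T = {x. \<forall>F. F facet_of T \<longrightarrow> n F \<bullet> x \<le> c F}"
    "\<And>F. F facet_of T \<Longrightarrow> \<exists>y. n F \<bullet> y = c F \<and> (\<forall>F'. F' facet_of T \<longrightarrow> F' \<noteq> F \<longrightarrow> n F' \<bullet> y < c F')"
proof -
  have aff: "affine hull T = UNIV"
    by (rule affine_hull_nonempty_interior[OF interior_nonempty])
  obtain H where H: "finite H" "T = affine hull T \<inter> \<Inter>H"
    "\<forall>h\<in>H. \<exists>a b. a \<noteq> 0 \<and> h = {x. a \<bullet> x \<le> b}" "\<forall>H'. H' \<subset> H \<longrightarrow> T \<subset> affine hull T \<inter> \<Inter>H'"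
    using polytope_imp_polyhedron[OF polytope] unfolding polyhedron_Int_affine_minimal by blast
  then obtain a b where ab: "\<And>h. h \<in> H \<Longrightarrow> a h \<noteq> 0 \<and> h = {x. a h \<bullet> x \<le> b h}"
    by metis
  have T: "T = {x. \<forall>h\<in>H. a h \<bullet> x \<le> b h}"
    using H(2) ab unfolding aff by blast
  have facet: "C facet_of T \<longleftrightarrow> (\<exists>h. h \<in> H \<and> C = T \<inter> {x. a h \<bullet> x = b h})" for C
    by (rule facet_of_polyhedron_explicit[OF H(1,2) ab]) (use H(4) in auto)
  obtain x0 where x0: "x0 \<in> interior T" using interior_nonempty by auto
  have x0_strict: "a h \<bullet> x0 < b h" if "h \<in> H" for h
  proof -
    have "x0 \<in> interior {x. a h \<bullet> x \<le> b h}"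
      using interior_mono[of T "{x. a h \<bullet> x \<le> b h}"] T that x0 by blast
    then show ?thesis using ab[OF that] interior_halfspace_le[of "a h" "b h"] by blast
  qed
  have point: "\<exists>y. a h \<bullet> y = b h \<and> (\<forall>h'\<in>H - {h}. a h' \<bullet> y < b h')" if h: "h \<in> H" for h
  proof -
    have "H - {h} \<subset> H" using h by auto
    from psubset_imp_ex_mem[OF H(4)[rule_format, OF this]]
    obtain z where "z \<in> affine hull T \<inter> \<Inter>(H - {h}) - T" ..
    then have z: "z \<notin> T" "z \<in> \<Inter>(H - {h})" by simp_all
    have z_le: "a h' \<bullet> z \<le> b h'" if "h' \<in> H - {h}" for h' using z(2) that ab[of h'] by auto
    have z_gt: "a h \<bullet> z > b h" using z(1) z_le h unfolding T by force
    define t where "t = (b h - a h \<bullet> x0) / (a h \<bullet> z - a h \<bullet> x0)"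
    have t: "0 < t" "t < 1" using z_gt x0_strict[OF h] by (auto simp: t_def field_simps)
    define y where "y = (1 - t) *\<^sub>R x0 + t *\<^sub>R z"
    have "a h \<bullet> y = a h \<bullet> x0 + t * (a h \<bullet> z - a h \<bullet> x0)" by (simp add: y_def inner_add_right algebra_simps)
    also have "\<dots> = b h" using z_gt x0_strict[OF h] by (simp add: t_def)
    finally have "a h \<bullet> y = b h" .
    moreover have "a h' \<bullet> y < b h'" if h': "h' \<in> H - {h}" for h'
    proof -
      have "a h' \<bullet> y = (1 - t) * (a h' \<bullet> x0) + t * (a h' \<bullet> z)" by (simp add: y_def inner_add_right)
      also have "\<dots> < (1 - t) * b h' + t * b h'"
        using t x0_strict[of h'] z_le[OF h'] h' by (intro add_less_le_mono mult_strict_left_mono mult_left_mono) auto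
      finally show ?thesis by (simp add: algebra_simps)
    qed
    ultimately show ?thesis by blast
  qed
  have inj: "h = h'" if hH: "h \<in> H" and "h' \<in> H" "T \<inter> {x. a h \<bullet> x = b h} = T \<inter> {x. a h' \<bullet> x = b h'}" for h h'
  proof (rule ccontr)
    assume "h \<noteq> h'"
    obtain y where y: "a h \<bullet> y = b h" "\<forall>h'\<in>H - {h}. a h' \<bullet> y < b h'" using point[OF hH] by blast
    then have "y \<in> T" unfolding T by force
    then have "y \<in> T \<inter> {x. a h' \<bullet> x = b h'}" using y(1) that(3) by blast
    then have "a h' \<bullet> y = b h'" by blast
    moreover have "a h' \<bullet> y < b h'" using y(2) that(2) \<open>h \<noteq> h'\<close> by blast
    ultimately show False by simp
  qed
  define h where "h = (\<lambda>F. SOME h. h \<in> H \<and> F = T \<inter> {x. a h \<bullet> x = b h})"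
  have h: "h F \<in> H \<and> F = T \<inter> {x. a (h F) \<bullet> x = b (h F)}" if "F facet_of T" for F
    unfolding h_def by (rule someI_ex) (use facet that in blast)
  have h_surj: "\<exists>F. F facet_of T \<and> h F = k" if "k \<in> H" for k
  proof (intro exI conjI)
    show "T \<inter> {x. a k \<bullet> x = b k} facet_of T" using facet that by blast
    then show "h (T \<inter> {x. a k \<bullet> x = b k}) = k" using h inj that by metis
  qed
  define n where "n = (\<lambda>F. a (h F) /\<^sub>R norm (a (h F)))"
  define c where "c = (\<lambda>F. b (h F) / norm (a (h F)))"
  have pos: "norm (a (h F)) > 0" if "F facet_of T" for F using ab h[OF that] by simp
  have eq_iff: "n F \<bullet> x = c F \<longleftrightarrow> a (h F) \<bullet> x = b (h F)" if "F facet_of T" for F x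
    using pos[OF that] by (simp add: n_def c_def field_simps)
  have le_iff: "n F \<bullet> x \<le> c F \<longleftrightarrow> a (h F) \<bullet> x \<le> b (h F)" if "F facet_of T" for F x
    using pos[OF that] by (simp add: n_def c_def field_simps)
  have less_iff: "n F \<bullet> x < c F \<longleftrightarrow> a (h F) \<bullet> x < b (h F)" if "F facet_of T" for F x
    using eq_iff[OF that, of x] le_iff[OF that, of x] by linarith
  show ?thesis
  proof (rule that[of n c])
    show "norm (n F) = 1" if "F facet_of T" for F using pos[OF that] by (simp add: n_def)
    show "F = T \<inter> {x. n F \<bullet> x = c F}" if "F facet_of T" for F
      using h[OF that] eq_iff[OF that] by auto
    have "x \<in> T \<longleftrightarrow> (\<forall>F. F facet_of T \<longrightarrow> n F \<bullet> x \<le> c F)" for x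
    proof
      show "\<forall>F. F facet_of T \<longrightarrow> n F \<bullet> x \<le> c F" if "x \<in> T"
        using that h le_iff T by blast
      show "x \<in> T" if "\<forall>F. F facet_of T \<longrightarrow> n F \<bullet> x \<le> c F"
        using that h_surj le_iff unfolding T by blast
    qed
    then show "T = {x. \<forall>F. F facet_of T \<longrightarrow> n F \<bullet> x \<le> c F}" by blast
    show "\<exists>y. n F \<bullet> y = c F \<and> (\<forall>F'. F' facet_of T \<longrightarrow> F' \<noteq> F \<longrightarrow> n F' \<bullet> y < c F')" if F: "F facet_of T" for F
    proof -
      obtain y where y: "a (h F) \<bullet> y = b (h F)" "\<forall>h'\<in>H - {h F}. a h' \<bullet> y < b h'"
        using point h[OF F] by blast
      have "n F' \<bullet> y < c F'" if "F' facet_of T" "F' \<noteq> F" for F'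
      proof -
        have "h F' \<noteq> h F" using h that F by metis
        then show ?thesis using y(2) h[OF that(1)] less_iff[OF that(1)] by blast
      qed
      with y(1) eq_iff[OF F] show ?thesis by blast
    qed
  qed
qed

text \<open>Justifies the definite description in \<open>outer_normal\<close>. At a point of
  \<open>F\<close> strictly inside the other inequalities \<open>T\<close> is locally a half-space,
  so every competitor \<open>n'\<close> satisfies \<open>n' \<bullet> d \<le> 0\<close> whenever
  \<open>N F \<bullet> d \<le> 0\<close>. Testing with the part of \<open>n'\<close> orthogonal to
  \<open>N F\<close> and with \<open>- N F\<close> forces \<open>n' \<bullet> N F = 1\<close>, hence
  equality of the two unit vectors.\<close>

lemma normal_unique:
  assumes "norm n = 1" "\<And>x. x \<in> T \<Longrightarrow> n \<bullet> x \<le> c" "\<And>x. x \<in> F \<Longrightarrow> n \<bullet> x = c" and F: "F facet_of T"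
  shows "normal F = n" "offset F = c"
proof -
  obtain N C where N: "\<And>F. F facet_of T \<Longrightarrow> norm (N F) = 1" "\<And>F. F facet_of T \<Longrightarrow> F = T \<inter> {x. N F \<bullet> x = C F}"
    "T = {x. \<forall>F. F facet_of T \<longrightarrow> N F \<bullet> x \<le> C F}"
    "\<And>F. F facet_of T \<Longrightarrow> \<exists>y. N F \<bullet> y = C F \<and> (\<forall>F'. F' facet_of T \<longrightarrow> F' \<noteq> F \<longrightarrow> N F' \<bullet> y < C F')"
    using exists_facet_inequalities by blast
  have unique: "n' = N F"
    if n': "norm n' = 1" "\<And>x. x \<in> T \<Longrightarrow> n' \<bullet> x \<le> c'" "\<And>x. x \<in> F \<Longrightarrow> n' \<bullet> x = c'" for n' c'
  proof -
    obtain y where y: "N F \<bullet> y = C F" "\<And>F'. F' facet_of T \<Longrightarrow> F' \<noteq> F \<Longrightarrow> N F' \<bullet> y < C F'"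
      using N(4)[OF F] by blast
    have "y \<in> T"
      by (subst N(3)) (use y in \<open>force simp: less_imp_le\<close>)
    then have yF: "y \<in> F" using y(1) N(2)[OF F] by blast
    let ?U = "\<Inter>F'\<in>{F'. F' facet_of T} - {F}. {x. N F' \<bullet> x < C F'}"
    have "open ?U" using finite_facets by (intro open_INT) (auto simp: open_halfspace_lt)
    moreover have "y \<in> ?U" using y by auto
    ultimately obtain r where r: "r > 0" "ball y r \<subseteq> ?U" using open_contains_ball by blast
    have half: "n' \<bullet> d \<le> 0" if "N F \<bullet> d \<le> 0" for d
    proof -
      define t where "t = r / (2 * (norm d + 1))"
      have t: "t > 0" "t * norm d < r"
      proof -
        show "t > 0" using r by (auto simp: t_def add_nonneg_pos)
        have "t * norm d \<le> t * (norm d + 1)" using \<open>t > 0\<close> by simp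
        also have "\<dots> = r / 2"
        proof -
          have "norm d + 1 \<noteq> 0" using norm_ge_zero[of d] by linarith
          then show ?thesis by (simp add: t_def field_simps)
        qed
        finally show "t * norm d < r" using r by simp
      qed
      have "y + t *\<^sub>R d \<in> ?U" using t r by (intro subsetD[OF r(2)]) (auto simp: dist_norm)
      moreover have "N F \<bullet> (y + t *\<^sub>R d) \<le> C F" using y(1) that t by (simp add: inner_add_right mult_nonneg_nonpos)
      ultimately have "y + t *\<^sub>R d \<in> T"
        by (subst N(3)) (force simp: less_imp_le)
      from n'(2)[OF this] n'(3)[OF yF] have "t * (n' \<bullet> d) \<le> 0" by (simp add: inner_add_right)
      then show ?thesis using t by (simp add: mult_le_0_iff)
    qed
    let ?s = "n' \<bullet> N F"
    have NN: "N F \<bullet> N F = 1" "n' \<bullet> n' = 1" using N(1)[OF F] n'(1) by (auto simp: dot_square_norm)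
    have "n' \<bullet> (n' - ?s *\<^sub>R N F) \<le> 0"
      by (rule half) (simp add: inner_diff_right NN inner_commute)
    then have "1 \<le> ?s * ?s" by (simp add: inner_diff_right NN)
    moreover have "?s \<ge> 0" using half[of "- N F"] by (simp add: NN)
    moreover have "?s \<le> 1" using norm_cauchy_schwarz[of n' "N F"] n'(1) N(1)[OF F] by simp
    moreover from calculation(2,3) have "?s * ?s \<le> ?s" using mult_left_le by blast
    ultimately have "?s = 1" by linarith
    then have "(n' - N F) \<bullet> (n' - N F) = 0" by (simp add: inner_diff_left inner_diff_right NN inner_commute)
    then show ?thesis by simp
  qed
  show "normal F = n"
    unfolding outer_normal_def
  proof (rule the_equality)
    show "norm n = 1 \<and> (\<exists>c. (\<forall>x\<in>F. n \<bullet> x = c) \<and> (\<forall>x\<in>T. n \<bullet> x \<le> c))"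
      by (intro conjI exI[of _ c] ballI assms)
    show "n' = n" if nn: "norm n' = 1 \<and> (\<exists>c. (\<forall>x\<in>F. n' \<bullet> x = c) \<and> (\<forall>x\<in>T. n' \<bullet> x \<le> c))" for n'
    proof -
      from nn have "norm n' = 1" by (rule conjunct1)
      moreover obtain c' where c': "(\<forall>x\<in>F. n' \<bullet> x = c') \<and> (\<forall>x\<in>T. n' \<bullet> x \<le> c')"
        using nn by blast
      ultimately have "n' = N F" by (intro unique) (use c' in auto)
      moreover have "n = N F" by (rule unique[OF assms(1-3)])
      ultimately show ?thesis by simp
    qed
  qed
  moreover have "(SOME p. p \<in> F) \<in> F"
    using F by (auto simp: facet_of_def some_in_eq)
  ultimately show "offset F = c" using assms(3) by (simp add: offset_def)
qed

lemma facet_inequalities: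
  shows norm_normal: "F facet_of T \<Longrightarrow> norm (normal F) = 1"
    and facet_eq: "F facet_of T \<Longrightarrow> F = T \<inter> {x. normal F \<bullet> x = offset F}"
    and polytope_eq: "T = {x. \<forall>F. F facet_of T \<longrightarrow> normal F \<bullet> x \<le> offset F}"
    and facet_point: "F facet_of T \<Longrightarrow>
      \<exists>y. normal F \<bullet> y = offset F \<and> (\<forall>F'. F' facet_of T \<longrightarrow> F' \<noteq> F \<longrightarrow> normal F' \<bullet> y < offset F')"
proof -
  obtain N C where N: "\<And>F. F facet_of T \<Longrightarrow> norm (N F) = 1" "\<And>F. F facet_of T \<Longrightarrow> F = T \<inter> {x. N F \<bullet> x = C F}"
    "T = {x. \<forall>F. F facet_of T \<longrightarrow> N F \<bullet> x \<le> C F}"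
    "\<And>F. F facet_of T \<Longrightarrow> \<exists>y. N F \<bullet> y = C F \<and> (\<forall>F'. F' facet_of T \<longrightarrow> F' \<noteq> F \<longrightarrow> N F' \<bullet> y < C F')"
    using exists_facet_inequalities by blast
  have le: "N F \<bullet> x \<le> C F" if "x \<in> T" "F facet_of T" for F x
    using N(3) that by blast
  have eq: "normal F = N F" "offset F = C F" if F: "F facet_of T" for F
    using normal_unique[of "N F" "C F" F] N(1)[OF F] le[OF _ F] N(2)[OF F] F by blast+
  show "F facet_of T \<Longrightarrow> norm (normal F) = 1" using N(1) eq by simp
  show "F facet_of T \<Longrightarrow> F = T \<inter> {x. normal F \<bullet> x = offset F}" using N(2) eq by simp
  show "T = {x. \<forall>F. F facet_of T \<longrightarrow> normal F \<bullet> x \<le> offset F}" using N(3) eq by auto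
  show "F facet_of T \<Longrightarrow>
      \<exists>y. normal F \<bullet> y = offset F \<and> (\<forall>F'. F' facet_of T \<longrightarrow> F' \<noteq> F \<longrightarrow> normal F' \<bullet> y < offset F')"
    using N(4) eq by simp
qed

lemma in_polytope_le: "x \<in> T \<Longrightarrow> F facet_of T \<Longrightarrow> normal F \<bullet> x \<le> offset F"
  using polytope_eq by blast

lemma in_polytopeI: "(\<And>F. F facet_of T \<Longrightarrow> normal F \<bullet> x \<le> offset F) \<Longrightarrow> x \<in> T"
  using polytope_eq by blast

lemma in_facet_iff: "F facet_of T \<Longrightarrow> x \<in> F \<longleftrightarrow> x \<in> T \<and> normal F \<bullet> x = offset F"
  using facet_eq by blast

lemma compact_facet: "F facet_of T \<Longrightarrow> compact F"
  using compact_Int_closed[OF compact closed_hyperplane] facet_eq by metis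

lemma normal_nonzero: "F facet_of T \<Longrightarrow> normal F \<noteq> 0"
  using norm_normal by fastforce

lemma interior_eq: "interior T = {x. \<forall>F. F facet_of T \<longrightarrow> normal F \<bullet> x < offset F}"
proof
  show "interior T \<subseteq> {x. \<forall>F. F facet_of T \<longrightarrow> normal F \<bullet> x < offset F}"
  proof safe
    fix x F assume x: "x \<in> interior T" and F: "F facet_of T"
    have "x \<in> interior {x. normal F \<bullet> x \<le> offset F}"
      using interior_mono[of T "{x. normal F \<bullet> x \<le> offset F}"] in_polytope_le[OF _ F] x by blast
    then show "normal F \<bullet> x < offset F" using normal_nonzero[OF F] interior_halfspace_le by blast
  qed
  have "open {x. \<forall>F. F facet_of T \<longrightarrow> normal F \<bullet> x < offset F}"
  proof -
    have "{x. \<forall>F. F facet_of T \<longrightarrow> normal F \<bullet> x < offset F} = (\<Inter>F\<in>{F. F facet_of T}. {x. normal F \<bullet> x < offset F})"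
      by auto
    then show ?thesis using finite_facets by (auto intro!: open_INT open_halfspace_lt)
  qed
  then show "{x. \<forall>F. F facet_of T \<longrightarrow> normal F \<bullet> x < offset F} \<subseteq> interior T"
    by (intro interior_maximal subsetI in_polytopeI) (auto intro: less_imp_le)
qed

text \<open>An open set that meets no other facet, contains almost every point of \<open>F\<close>
  and reaches across \<open>F\<close>. Test functions supported in it see no other part of the
  boundary of \<open>T\<close>.\<close>

definition beside :: "(real^'n) set \<Rightarrow> (real^'n) set" where
  "beside F = {x. \<forall>F'. F' facet_of T \<longrightarrow> F' \<noteq> F \<longrightarrow> normal F' \<bullet> x < offset F'}"

lemma open_beside: "open (beside F)"
proof -
  have "beside F = (\<Inter>F'\<in>{F'. F' facet_of T} - {F}. {x. normal F' \<bullet> x < offset F'})"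
    by (auto simp: beside_def)
  then show ?thesis using finite_facets by (auto intro!: open_INT open_halfspace_lt)
qed

lemma beside_in_polytope: "F facet_of T \<Longrightarrow> x \<in> beside F \<Longrightarrow> normal F \<bullet> x \<le> offset F \<Longrightarrow> x \<in> T"
  by (rule in_polytopeI) (force simp: beside_def)

lemma beside_in_interior: "F facet_of T \<Longrightarrow> x \<in> beside F \<Longrightarrow> normal F \<bullet> x < offset F \<Longrightarrow> x \<in> interior T"
  unfolding interior_eq beside_def by blast

lemma other_facet_disjoint_beside: "F' facet_of T \<Longrightarrow> F' \<noteq> F \<Longrightarrow> F' \<inter> beside F = {}"
  using in_facet_iff unfolding beside_def by force

lemma exists_facet_beside_point: "F facet_of T \<Longrightarrow> \<exists>y\<in>F. y \<in> beside F"
  (is "_ \<Longrightarrow> ?thesis")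
proof -
  assume F: "F facet_of T"
  obtain y where y: "normal F \<bullet> y = offset F" "\<forall>F'. F' facet_of T \<longrightarrow> F' \<noteq> F \<longrightarrow> normal F' \<bullet> y < offset F'"
    using facet_point[OF F] by blast
  then have "y \<in> beside F" by (simp add: beside_def)
  moreover from this have "y \<in> F" using beside_in_polytope[OF F] in_facet_iff[OF F] y(1) by simp
  ultimately show ?thesis by blast
qed

end

lemma open_segment_near:
  fixes y :: "'a::real_normed_vector"
  assumes "open U" "y \<in> U"
  obtains t where "0 < t" "t < 1" "y + t *\<^sub>R d \<in> U"
proof -
  obtain r where r: "r > 0" "ball y r \<subseteq> U" using assms open_contains_ball by blast
  define t where "t = min (1/2) (r / (2 * (norm d + 1)))"
  have d: "norm d + 1 > 0" using norm_ge_zero[of d] by linarith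
  have t: "0 < t" "t < 1" using r d by (auto simp: t_def)
  have "t * norm d \<le> (r / (2 * (norm d + 1))) * norm d" by (intro mult_right_mono) (auto simp: t_def)
  also have "\<dots> < r" using r d by (simp add: field_simps) (smt (verit) mult_nonneg_nonneg norm_ge_zero)
  finally have "y + t *\<^sub>R d \<in> U" using t by (intro subsetD[OF r(2)]) (auto simp: dist_norm)
  with t that show ?thesis by blast
qed

text \<open>Near \<open>y\<close> the polytope \<open>T\<close> is a half-space. A point of
  \<open>T'\<close> strictly on the side of \<open>T\<close> would make a segment in
  \<open>T'\<close> from \<open>y\<close> enter the interior of \<open>T\<close>, which is
  impossible as \<open>T \<inter> T'\<close> is a proper face. So \<open>T'\<close> lies beyond the
  hyperplane of \<open>F\<close>, which also yields the opposite normal.\<close>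

lemma solid_polytope_shared_facet:
  fixes T T' F :: "(real^'n::finite) set"
  assumes "solid_polytope T" "solid_polytope T'" "(T \<inter> T') face_of T" "(T \<inter> T') face_of T'" "T \<noteq> T'"
    and F: "F facet_of T" and y: "y \<in> F" "y \<in> T'" "y \<in> solid_polytope.beside T F"
  shows "T \<inter> T' = F" "F facet_of T'" "outer_normal T' F = - outer_normal T F"
    "solid_polytope.offset T' F = - solid_polytope.offset T F"
proof -
  interpret T: solid_polytope T by fact
  interpret T': solid_polytope T' by fact
  let ?G = "T \<inter> T'"
  have yT: "y \<in> T" and yF: "T.normal F \<bullet> y = T.offset F" using y(1) T.in_facet_iff[OF F] by auto
  have no_int: "S \<inter> interior S' = {}" if "S face_of S'" "S \<noteq> S'" for S S' :: "(real^'n) set"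
    using face_of_disjoint_interior that by blast
  have "?G \<noteq> T"
  proof
    assume "?G = T"
    then have "T face_of T'" "T \<subseteq> T'" using assms(4) by auto
    then have "T \<inter> interior T' = {}" using no_int \<open>T \<noteq> T'\<close> by blast
    moreover have "interior T \<subseteq> T \<inter> interior T'" using \<open>T \<subseteq> T'\<close> interior_mono interior_subset by blast
    ultimately show False using T.interior_nonempty by blast
  qed
  then have G_int: "?G \<inter> interior T = {}" using no_int[OF assms(3)] by blast
  have Tx: "T.normal F \<bullet> p \<ge> T.offset F" if p: "p \<in> T'" for p
  proof (rule ccontr)
    assume "\<not> T.normal F \<bullet> p \<ge> T.offset F"
    then have p_less: "T.normal F \<bullet> p < T.offset F" by simp
    obtain t where t: "0 < t" "t < 1" "y + t *\<^sub>R (p - y) \<in> T.beside F"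
      using open_segment_near[OF T.open_beside y(3)] by blast
    have "T.normal F \<bullet> (y + t *\<^sub>R (p - y)) = T.offset F + t * (T.normal F \<bullet> p - T.offset F)"
      using yF by (simp add: inner_add_right inner_diff_right)
    also have "\<dots> < T.offset F" using t p_less by (simp add: mult_pos_neg)
    finally have "y + t *\<^sub>R (p - y) \<in> interior T" using T.beside_in_interior[OF F t(3)] by blast
    moreover have "y + t *\<^sub>R (p - y) \<in> T'"
    proof -
      have "(1 - t) *\<^sub>R y + t *\<^sub>R p \<in> T'" using t y(2) p by (intro convexD[OF T'.convex]) auto
      then show ?thesis by (simp add: algebra_simps)
    qed
    ultimately show False using G_int interior_subset by blast
  qed
  have "?G \<subseteq> F"
    using Tx T.in_polytope_le[OF _ F] T.in_facet_iff[OF F] by (metis IntE antisym subsetI)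
  moreover have "F \<subseteq> ?G"
  proof
    fix x assume x: "x \<in> F"
    show "x \<in> ?G"
    proof (cases "x = y")
      case False
      \<comment> \<open>The segment from \<open>x\<close> is prolonged beyond \<open>y\<close>
        within \<open>F\<close>. Then \<open>y\<close>, a point of the face
        \<open>T \<inter> T'\<close>, is an inner point of a segment of \<open>T\<close>, and the
        defining property of a face puts the end \<open>x\<close> into \<open>T'\<close>.\<close>
      obtain t where t: "0 < t" "t < 1" "y + t *\<^sub>R (y - x) \<in> T.beside F"
        using open_segment_near[OF T.open_beside y(3)] by blast
      let ?z = "y + t *\<^sub>R (y - x)"
      have "T.normal F \<bullet> ?z = T.offset F"
        using x y(1) T.in_facet_iff[OF F] by (simp add: inner_add_right inner_diff_right)
      then have z: "?z \<in> T" using T.beside_in_polytope[OF F t(3)] by simp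
      have "y \<in> open_segment x ?z"
      proof -
        have "y = (1 - 1 / (1 + t)) *\<^sub>R x + (1 / (1 + t)) *\<^sub>R ?z"
        proof -
          have "(1 + t) *\<^sub>R y = t *\<^sub>R x + ?z" by (simp add: algebra_simps)
          then have "(1 / (1 + t)) *\<^sub>R ((1 + t) *\<^sub>R y) = (1 / (1 + t)) *\<^sub>R (t *\<^sub>R x + ?z)" by simp
          moreover have "1 - 1 / (1 + t) = t / (1 + t)" using t by (simp add: field_simps)
          ultimately show ?thesis using t by (simp add: scaleR_add_right)
        qed
        moreover have "x \<noteq> ?z"
        proof
          assume "x = ?z"
          then have "(1 + t) *\<^sub>R (y - x) = 0" by (simp add: algebra_simps)
          then show False using t False by simp
        qed
        moreover have "0 < 1 / (1 + t)" "1 / (1 + t) < 1" using t by auto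
        ultimately show ?thesis unfolding in_segment by blast
      qed
      then show ?thesis
        using assms(3) x T.in_facet_iff[OF F] z yT y(2) unfolding face_of_def by blast
    qed (use yT y in auto)
  qed
  ultimately show G: "T \<inter> T' = F" by blast
  have "aff_dim T = int CARD('n)" "aff_dim T' = int CARD('n)"
    using aff_dim_nonempty_interior[OF T.interior_nonempty] aff_dim_nonempty_interior[OF T'.interior_nonempty] by auto
  then show F': "F facet_of T'" using F assms(4) G by (auto simp: facet_of_def)
  have "norm (- T.normal F) = 1" using T.norm_normal[OF F] by simp
  moreover have "- T.normal F \<bullet> x \<le> - T.offset F" if "x \<in> T'" for x using Tx[OF that] by simp
  moreover have "- T.normal F \<bullet> x = - T.offset F" if "x \<in> F" for x using that T.in_facet_iff[OF F] by simp
  ultimately show "T'.normal F = - T.normal F" "T'.offset F = - T.offset F"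
    using T'.normal_unique[of "- T.normal F" "- T.offset F" F] F' by blast+
qed

section \<open>Surface measure on facets\<close>

lemma AE_not_in_hyperplane:
  fixes a :: "'a::euclidean_space"
  assumes "a \<noteq> 0"
  shows "AE x in lborel. a \<bullet> x \<noteq> b"
proof -
  have "{x. a \<bullet> x = b} \<in> null_sets lebesgue"
    using negligible_hyperplane[of a b] assms by (simp add: negligible_iff_null_sets)
  from AE_not_in[OF this] show ?thesis unfolding AE_completion_iff by simp
qed

context solid_polytope
begin

definition proj :: "(real^'n) set \<Rightarrow> real^'n \<Rightarrow> real^'n" where
  "proj F x = x - (normal F \<bullet> x - offset F) *\<^sub>R normal F"

definition prism :: "(real^'n) set \<Rightarrow> (real^'n) set" where
  "prism F = {x. offset F \<le> normal F \<bullet> x \<and> normal F \<bullet> x \<le> offset F + 1 \<and> proj F x \<in> F}"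

lemma side_measure_eq:
  "side_measure T F = completion (distr (restrict_space lborel (prism F)) borel (proj F))"
  by (simp add: side_measure_def Let_def prism_def proj_def[abs_def] offset_def)

lemma continuous_proj: "continuous_on S (proj F)"
  unfolding proj_def[abs_def] by (intro continuous_intros)

lemma proj_measurable [measurable]: "proj F \<in> borel_measurable borel"
  by (intro borel_measurable_continuous_onI continuous_proj)

lemma inner_normal_self: "F facet_of T \<Longrightarrow> normal F \<bullet> normal F = 1"
  using norm_normal by (simp add: dot_square_norm)

lemma normal_proj: "F facet_of T \<Longrightarrow> normal F \<bullet> proj F x = offset F"
  by (simp add: proj_def inner_diff_right inner_normal_self)

lemma proj_eq_self: "F facet_of T \<Longrightarrow> x \<in> F \<Longrightarrow> proj F x = x"
  using in_facet_iff by (simp add: proj_def)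

lemma closed_prism:
  assumes F: "F facet_of T" shows "closed (prism F)"
proof -
  have "prism F = {x. offset F \<le> normal F \<bullet> x} \<inter> {x. normal F \<bullet> x \<le> offset F + 1} \<inter> proj F -` F"
    by (auto simp: prism_def)
  then show ?thesis
    using compact_imp_closed[OF compact_facet[OF F]]
    by (auto intro!: closed_Int closed_halfspace_ge closed_halfspace_le continuous_closed_vimage
        continuous_on_imp_continuous_within simp: continuous_on_eq_continuous_at[symmetric] continuous_proj)
qed

lemma bounded_prism:
  assumes F: "F facet_of T" shows "bounded (prism F)"
proof -
  obtain R where R: "\<And>x. x \<in> F \<Longrightarrow> norm x \<le> R"
    using compact_imp_bounded[OF compact_facet[OF F]] by (auto simp: bounded_iff)
  have "norm x \<le> R + 1" if x: "x \<in> prism F" for x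
  proof -
    have "norm x = norm (proj F x + (normal F \<bullet> x - offset F) *\<^sub>R normal F)" by (simp add: proj_def)
    also have "\<dots> \<le> norm (proj F x) + \<bar>normal F \<bullet> x - offset F\<bar>"
      using norm_triangle_ineq[of "proj F x" "(normal F \<bullet> x - offset F) *\<^sub>R normal F"] norm_normal[OF F] by simp
    also have "\<dots> \<le> R + 1" using R[of "proj F x"] x by (auto simp: prism_def)
    finally show ?thesis .
  qed
  then show ?thesis by (auto simp: bounded_iff)
qed

lemma prism_borel [measurable]: "F facet_of T \<Longrightarrow> prism F \<in> sets borel"
  using closed_prism by auto

lemma emeasure_prism_finite: "F facet_of T \<Longrightarrow> emeasure lborel (prism F) < \<infinity>"
  using bounded_prism emeasure_bounded_finite by blast

lemma proj_measurable_prism [measurable]: "proj F \<in> restrict_space lborel (prism F) \<rightarrow>\<^sub>M borel"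
  by (intro measurable_restrict_space1) simp

text \<open>Replaces surface integrals of Borel functions by volume integrals over the prism, the
  form in which the limit of the boundary layers appears.\<close>

lemma side_measure_integral:
  fixes f :: "real^'n \<Rightarrow> real"
  assumes F: "F facet_of T" and f: "f \<in> borel_measurable borel"
  shows "(LINT y|side_measure T F. f y) = (LINT x|lborel. indicator (prism F) x * f (proj F x))"
proof -
  have "(LINT y|side_measure T F. f y) = (LINT y|distr (restrict_space lborel (prism F)) borel (proj F). f y)"
    unfolding side_measure_eq by (rule integral_completion) (use f in simp)
  also have "\<dots> = (LINT x|restrict_space lborel (prism F). f (proj F x))"
    by (rule integral_distr) (use f in auto)
  also have "\<dots> = (LINT x|lborel. indicator (prism F) x * f (proj F x))"
    using prism_borel[OF F] by (subst integral_restrict_space) auto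
  finally show ?thesis .
qed

lemma side_measure_space: "space (side_measure T F) = UNIV"
  by (simp add: side_measure_eq)

lemma side_measure_borel_measurable: "f \<in> borel_measurable borel \<Longrightarrow> f \<in> borel_measurable (side_measure T F)"
  unfolding side_measure_eq by (rule measurable_completion) simp

lemma side_measure_complete: "complete_measure (side_measure T F)"
  unfolding side_measure_eq by (rule completion.complete_measure_axioms)

lemma side_measure_finite:
  assumes F: "F facet_of T" shows "finite_measure (side_measure T F)"
proof
  have "emeasure (side_measure T F) UNIV = emeasure lborel (prism F)"
    unfolding side_measure_eq using prism_borel[OF F]
    by (simp add: emeasure_distr emeasure_restrict_space space_restrict_space)
  then show "emeasure (side_measure T F) (space (side_measure T F)) \<noteq> \<infinity>"
    using emeasure_prism_finite[OF F] by (simp add: side_measure_space)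
qed

lemma side_measure_AE:
  assumes F: "F facet_of T" and Q: "{y. Q y} \<in> sets borel"
    and AE: "AE x in lborel. x \<in> prism F \<longrightarrow> Q (proj F x)"
  shows "AE y in side_measure T F. Q y"
proof -
  have "AE x in restrict_space lborel (prism F). Q (proj F x)"
    using AE prism_borel[OF F] by (subst AE_restrict_space_iff) auto
  then have "AE y in distr (restrict_space lborel (prism F)) borel (proj F). Q y"
    using Q by (subst AE_distr_iff) auto
  then show ?thesis
    unfolding side_measure_eq by (rule AE_completion)
qed

lemma AE_side_measure_in_facet: "F facet_of T \<Longrightarrow> AE y in side_measure T F. y \<in> F"
  using compact_imp_closed[OF compact_facet] by (intro side_measure_AE) (auto simp: prism_def)

text \<open>After projection the functional of \<open>F'\<close> is affine with gradient
  \<open>d\<close>, the part of \<open>normal F'\<close> orthogonal to \<open>normal F\<close>. For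
  \<open>d \<noteq> 0\<close> its level set is a null hyperplane. For \<open>d = 0\<close> it is
  constant, and its value at a point of \<open>F\<close> beside all other facets is strictly below
  \<open>offset F'\<close>.\<close>

lemma AE_proj_off_facet:
  assumes F: "F facet_of T" and F': "F' facet_of T" "F' \<noteq> F"
  shows "AE x in lborel. normal F' \<bullet> proj F x \<noteq> offset F'"
proof -
  define s where "s = normal F' \<bullet> normal F"
  define d where "d = normal F' - s *\<^sub>R normal F"
  have eq: "normal F' \<bullet> proj F x = d \<bullet> x + s * offset F" for x
    by (simp add: proj_def d_def s_def inner_diff_left inner_diff_right algebra_simps)
  show ?thesis
  proof (cases "d = 0")
    case True
    obtain y where y: "y \<in> F" "y \<in> beside F" using exists_facet_beside_point[OF F] by blast
    then have "normal F' \<bullet> y < offset F'" using F' by (auto simp: beside_def)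
    then have "s * offset F < offset F'"
      using eq[of y] True proj_eq_self[OF F y(1)] by simp
    then show ?thesis using eq True by simp
  next
    case False
    then have "AE x in lborel. d \<bullet> x \<noteq> offset F' - s * offset F"
      by (rule AE_not_in_hyperplane)
    then show ?thesis by eventually_elim (auto simp: eq)
  qed
qed

lemma AE_side_measure_beside:
  assumes F: "F facet_of T"
  shows "AE y in side_measure T F. y \<in> beside F"
proof (rule side_measure_AE[OF F])
  show "{y. y \<in> beside F} \<in> sets borel" using open_beside by auto
  have "AE x in lborel. \<forall>F'\<in>{F'. F' facet_of T} - {F}. normal F' \<bullet> proj F x \<noteq> offset F'"
    using finite_facets AE_proj_off_facet[OF F] by (intro AE_finite_allI) auto
  then show "AE x in lborel. x \<in> prism F \<longrightarrow> proj F x \<in> beside F"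
  proof eventually_elim
    case (elim x)
    show ?case
    proof
      assume "x \<in> prism F"
      then have "proj F x \<in> T" using in_facet_iff[OF F] by (simp add: prism_def)
      then show "proj F x \<in> beside F"
        using elim in_polytope_le unfolding beside_def by (force simp: order_less_le)
    qed
  qed
qed

end

text \<open>The two prisms stand on opposite sides of \<open>F\<close>. Translation by the unit
  normal carries one to the other, commutes with the projection onto the hyperplane and preserves
  Lebesgue measure.\<close>

lemma side_measure_opposite:
  assumes "solid_polytope T" "solid_polytope T'" "F facet_of T" "F facet_of T'"
    "outer_normal T' F = - outer_normal T F" "solid_polytope.offset T' F = - solid_polytope.offset T F"
  shows "side_measure T' F = side_measure T F"
proof -
  interpret T: solid_polytope T by fact
  interpret T': solid_polytope T' by fact
  let ?n = "T.normal F"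
  have proj: "T'.proj F = T.proj F"
    by (rule ext) (simp add: T.proj_def T'.proj_def assms(5,6) scaleR_diff_left)
  have nn: "?n \<bullet> ?n = 1" by (rule T.inner_normal_self[OF assms(3)])
  have shift: "T.proj F (?n + x) = T.proj F x" for x
    by (simp add: T.proj_def inner_add_right nn algebra_simps)
  have "distr (restrict_space lborel (T'.prism F)) borel (T.proj F)
      = distr (restrict_space lborel (T.prism F)) borel (T.proj F)"
  proof (rule measure_eqI)
    fix A assume "A \<in> sets (distr (restrict_space lborel (T'.prism F)) borel (T.proj F))"
    then have A: "A \<in> sets borel" by simp
    have meas: "T.proj F -` A \<inter> S \<in> sets borel" if "S \<in> sets borel" for S
      using measurable_sets[OF T.proj_measurable A] that by auto
    have eq: "(+) ?n -` (T.proj F -` A \<inter> T.prism F) = T.proj F -` A \<inter> T'.prism F"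
      using nn by (auto simp: T.prism_def T'.prism_def proj shift assms inner_add_right)
    have "emeasure lborel (T.proj F -` A \<inter> T.prism F) = emeasure (distr lborel borel ((+) ?n)) (T.proj F -` A \<inter> T.prism F)"
      by (simp add: lborel_distr_plus)
    also have "\<dots> = emeasure lborel (T.proj F -` A \<inter> T'.prism F)"
      using meas[OF T.prism_borel[OF assms(3)]] by (subst emeasure_distr) (auto simp: eq simp del: vimage_Int)
    finally have "emeasure lborel (T.proj F -` A \<inter> T.prism F) = emeasure lborel (T.proj F -` A \<inter> T'.prism F)" .
    then show "emeasure (distr (restrict_space lborel (T'.prism F)) borel (T.proj F)) A
        = emeasure (distr (restrict_space lborel (T.prism F)) borel (T.proj F)) A"
      using A T.prism_borel[OF assms(3)] T'.prism_borel[OF assms(4)] meas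
        T'.proj_measurable_prism[of F, unfolded proj]
      by (simp add: emeasure_distr emeasure_restrict_space space_restrict_space)
  qed simp
  then show ?thesis
    by (simp add: T.side_measure_eq T'.side_measure_eq proj)
qed

section \<open>The divergence theorem on a polytope\<close>

text \<open>Translation invariance gives the vanishing of the integral of the difference quotients.\<close>

lemma integral_directional_derivative_eq_0:
  fixes \<psi> d :: "'a::euclidean_space \<Rightarrow> real"
  assumes int: "integrable lborel \<psi>"
    and lip: "\<And>x t. 0 < t \<Longrightarrow> t \<le> 1 \<Longrightarrow> \<bar>\<psi> (x + t *\<^sub>R v) - \<psi> x\<bar> \<le> C * t * indicator (cball 0 R) x"
    and deriv: "AE x in lborel. ((\<lambda>t. \<psi> (x + t *\<^sub>R v)) has_real_derivative d x) (at 0)"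
    and d: "d \<in> borel_measurable borel"
  shows "(LINT x|lborel. d x) = 0"
proof -
  define t where "t = (\<lambda>m. 1 / real (Suc m))"
  have t: "0 < t m" "t m \<le> 1" for m by (auto simp: t_def)
  have t_lim: "t \<longlonglongrightarrow> 0" unfolding t_def using LIMSEQ_inverse_real_of_nat by (simp add: inverse_eq_divide)
  have t_at: "filterlim t (at 0) sequentially"
    using t_lim t(1) by (auto simp: filterlim_at less_imp_neq[symmetric] intro!: always_eventually)
  have \<psi>: "\<psi> \<in> borel_measurable borel" using int by auto
  have int_t: "integrable lborel (\<lambda>x. \<psi> (x + t m *\<^sub>R v))" for m
    using lborel_affine_integrable[OF _ int, of 1 "t m *\<^sub>R v"] by (simp add: add.commute)
  have zero: "(LINT x|lborel. (\<psi> (x + t m *\<^sub>R v) - \<psi> x) / t m) = 0" for m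
    using lborel_affine_integral[OF _ \<psi>, of 1 "t m *\<^sub>R v"] int int_t[of m] by (simp add: add.commute)
  have "(\<lambda>m. LINT x|lborel. (\<psi> (x + t m *\<^sub>R v) - \<psi> x) / t m) \<longlonglongrightarrow> (LINT x|lborel. d x)"
  proof (rule integral_dominated_convergence[where w = "\<lambda>x. C * indicator (cball 0 R) x"])
    show "integrable lborel (\<lambda>x::'a. C * indicator (cball 0 R) x)"
      using emeasure_bounded_finite[of "cball (0::'a) R"]
      by (intro integrable_mult_right integrable_real_indicator) auto
    show "AE x in lborel. (\<lambda>m. (\<psi> (x + t m *\<^sub>R v) - \<psi> x) / t m) \<longlonglongrightarrow> d x"
      using deriv
    proof eventually_elim
      case (elim x)
      then have "((\<lambda>s. (\<psi> (x + s *\<^sub>R v) - \<psi> x) / s) \<longlongrightarrow> d x) (at 0)"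
        by (simp add: has_field_derivative_iff)
      from filterlim_compose[OF this t_at] show ?case .
    qed
    show "AE x in lborel. norm ((\<psi> (x + t m *\<^sub>R v) - \<psi> x) / t m) \<le> C * indicator (cball 0 R) x" for m
      using lip[OF t] t(1)[of m] by (auto simp: abs_divide field_simps)
  qed (use d \<psi> in measurable)
  then show ?thesis unfolding zero by (simp add: LIMSEQ_const_iff)
qed

text \<open>A slab of thickness 1 is the union of \<open>m\<close> translates of a slab of thickness \<open>1 / m\<close>.\<close>

lemma thin_slab_integral:
  fixes f :: "'a::euclidean_space \<Rightarrow> real"
  assumes n: "n \<bullet> n = 1" and m: "m > (0::nat)" and f: "integrable lborel f"
  shows "real m * (LINT x|lborel. indicator {x. 0 \<le> real m * (c - n \<bullet> x) \<and> real m * (c - n \<bullet> x) < 1} x * f x)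
    = (LINT y|lborel. indicator {y. 0 < n \<bullet> y - c \<and> n \<bullet> y - c \<le> 1} y
         * f (y - (of_int \<lceil>real m * (n \<bullet> y - c)\<rceil> / real m) *\<^sub>R n))"
proof -
  let ?A = "{x. 0 \<le> real m * (c - n \<bullet> x) \<and> real m * (c - n \<bullet> x) < 1}"
  let ?S = "\<lambda>j. {y. \<lceil>real m * (n \<bullet> y - c)\<rceil> = int j}"
  define g where "g = (\<lambda>x. indicator ?A x * f x)"
  have A: "?A \<in> sets borel" by measurable
  have g: "integrable lborel g"
    unfolding g_def by (rule Bochner_Integration.integrable_bound[OF f]) (use A f in \<open>auto simp: indicator_def\<close>)
  \<comment> \<open>The slab is half-open for this reason: \<open>0 \<le> j - r < 1\<close> says
    exactly that \<open>r\<close> has ceiling \<open>j\<close>, so the translates tile the unit slab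
    without overlap.\<close>
  have g_eq: "g ((- (real j / real m)) *\<^sub>R n + 1 *\<^sub>R y) = indicator (?S j) y * f (y - (real j / real m) *\<^sub>R n)" for j y
  proof -
    have "real m * (c - n \<bullet> ((- (real j / real m)) *\<^sub>R n + 1 *\<^sub>R y)) = real j - real m * (n \<bullet> y - c)"
      using m n by (simp add: inner_diff_right inner_add_right algebra_simps)
    moreover have "(0 \<le> real j - r \<and> real j - r < 1) \<longleftrightarrow> \<lceil>r\<rceil> = int j" for r
      by (auto simp: ceiling_eq_iff)
    ultimately show ?thesis by (simp add: g_def indicator_def)
  qed
  have "real m * (LINT x|lborel. g x) = (\<Sum>j\<in>{1..m}. LINT x|lborel. g x)" by simp
  also have "\<dots> = (\<Sum>j\<in>{1..m}. LINT y|lborel. indicator (?S j) y * f (y - (real j / real m) *\<^sub>R n))"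
  proof (rule sum.cong[OF refl])
    fix j
    show "(LINT x|lborel. g x) = (LINT y|lborel. indicator (?S j) y * f (y - (real j / real m) *\<^sub>R n))"
      using lborel_affine_integral[of 1 g "(- (real j / real m)) *\<^sub>R n"] g unfolding g_eq by auto
  qed
  also have "\<dots> = (LINT y|lborel. (\<Sum>j\<in>{1..m}. indicator (?S j) y * f (y - (real j / real m) *\<^sub>R n)))"
  proof (rule Bochner_Integration.integral_sum[symmetric])
    fix j
    show "integrable lborel (\<lambda>y. indicator (?S j) y * f (y - (real j / real m) *\<^sub>R n))"
      using lborel_affine_integrable[OF _ g, of 1 "(- (real j / real m)) *\<^sub>R n"] unfolding g_eq by simp
  qed
  also have "\<dots> = (LINT y|lborel. indicator {y. 0 < n \<bullet> y - c \<and> n \<bullet> y - c \<le> 1} y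
         * f (y - (of_int \<lceil>real m * (n \<bullet> y - c)\<rceil> / real m) *\<^sub>R n))"
  proof (rule Bochner_Integration.integral_cong[OF refl])
    fix y
    let ?k = "\<lceil>real m * (n \<bullet> y - c)\<rceil>"
    have pos: "0 < n \<bullet> y - c \<longleftrightarrow> 0 < ?k"
      using m by (simp add: zero_less_mult_iff)
    have le: "n \<bullet> y - c \<le> 1 \<longleftrightarrow> ?k \<le> int m"
      using m mult_le_cancel_left_pos[of "real m" "n \<bullet> y - c" 1] by (simp add: ceiling_le_iff)
    show "(\<Sum>j\<in>{1..m}. indicator (?S j) y * f (y - (real j / real m) *\<^sub>R n))
       = indicator {y. 0 < n \<bullet> y - c \<and> n \<bullet> y - c \<le> 1} y * f (y - (of_int ?k / real m) *\<^sub>R n)"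
    proof (cases "0 < ?k \<and> ?k \<le> int m")
      case True
      have "int (nat k) = k \<and> nat k \<in> {1..m}" if "0 < k" "k \<le> int m" for k
        using that by auto
      with True have k: "int (nat ?k) = ?k" "nat ?k \<in> {1..m}" by blast+
      have "(\<Sum>j\<in>{1..m}. indicator (?S j) y * f (y - (real j / real m) *\<^sub>R n))
          = (\<Sum>j\<in>{1..m}. if j = nat ?k then f (y - (real j / real m) *\<^sub>R n) else 0)"
        by (rule sum.cong[OF refl]) (use k(1) in \<open>auto simp: indicator_def\<close>)
      also have "\<dots> = f (y - (real (nat ?k) / real m) *\<^sub>R n)" using k(2) by simp
      finally show ?thesis using True pos le k(1) by (simp add: indicator_def)
    next
      case False
      have notin: "y \<notin> ?S j" if "j \<in> {1..m}" for j
      proof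
        assume "y \<in> ?S j"
        then have "?k = int j" by (simp only: mem_Collect_eq)
        moreover have "0 < int j" "int j \<le> int m" using that by auto
        ultimately show False using False by metis
      qed
      have "(\<Sum>j\<in>{1..m}. indicator (?S j) y * f (y - (real j / real m) *\<^sub>R n)) = 0"
        using notin by (intro sum.neutral ballI) simp
      then show ?thesis using False pos le by (auto simp: indicator_def)
    qed
  qed
  finally show ?thesis by (simp add: g_def)
qed

text \<open>A piecewise linear profile instead of a smooth one: its derivative is the indicator of
  an interval, so the derivative of the cutoff is exactly a multiple of the indicator of a
  layer.\<close>

definition ramp :: "real \<Rightarrow> real" where
  "ramp t = max 0 (min 1 t)"

lemma ramp_bounds: "0 \<le> ramp t" "ramp t \<le> 1" and ramp_0: "t \<le> 0 \<Longrightarrow> ramp t = 0" and ramp_1: "t \<ge> 1 \<Longrightarrow> ramp t = 1"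
  and ramp_lipschitz: "\<bar>ramp t - ramp s\<bar> \<le> \<bar>t - s\<bar>"
  by (auto simp: ramp_def)

lemma continuous_ramp: "continuous_on S ramp"
  unfolding ramp_def[abs_def] by (intro continuous_intros)

lemma ramp_measurable [measurable]: "ramp \<in> borel_measurable borel"
  by (intro borel_measurable_continuous_onI continuous_ramp)

lemma ramp_has_derivative:
  assumes "t \<noteq> 0" "t \<noteq> 1"
  shows "(ramp has_real_derivative indicator {0..<1} t) (at t)"
proof -
  consider "t < 0" | "0 < t" "t < 1" | "t > 1" using assms by linarith
  then show ?thesis
  proof cases
    case 1
    have "((\<lambda>t. 0) has_real_derivative 0) (at t)" by simp
    then have "(ramp has_real_derivative 0) (at t)"
      by (rule has_field_derivative_transform_within_open[where S = "{..<0}"])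
         (use 1 in \<open>auto simp: ramp_def\<close>)
    then show ?thesis using 1 by simp
  next
    case 2
    have "((\<lambda>t. t) has_real_derivative 1) (at t)" by simp
    then have "(ramp has_real_derivative 1) (at t)"
      by (rule has_field_derivative_transform_within_open[where S = "{0<..<1}"])
         (use 2 in \<open>auto simp: ramp_def\<close>)
    then show ?thesis using 2 by simp
  next
    case 3
    have "((\<lambda>t. 1) has_real_derivative 0) (at t)" by simp
    then have "(ramp has_real_derivative 0) (at t)"
      by (rule has_field_derivative_transform_within_open[where S = "{1<..}"])
         (use 3 in \<open>auto simp: ramp_def\<close>)
    then show ?thesis using 3 by simp
  qed
qed

section \<open>Cutoff functions, boundary layers and their limit\<close>

context solid_polytope
begin

abbreviation facets :: "(real^'n) set set" where
  "facets \<equiv> {F. F facet_of T}"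

lemma violated_facet:
  assumes "x \<notin> T" "normal F \<bullet> x \<le> offset F"
  shows "\<exists>F'\<in>facets - {F}. offset F' < normal F' \<bullet> x"
proof -
  obtain F' where F': "F' facet_of T" "\<not> normal F' \<bullet> x \<le> offset F'"
    using assms(1) in_polytopeI by blast
  with assms(2) show ?thesis by (intro bexI[of _ F']) auto
qed

text \<open>The set \<open>A\<close> is a parameter because the product rule leaves, for each facet,
  the product over the remaining ones.\<close>

definition cutoff :: "nat \<Rightarrow> (real^'n) set set \<Rightarrow> real^'n \<Rightarrow> real" where
  "cutoff m A x = (\<Prod>F\<in>A. ramp (real m * (offset F - normal F \<bullet> x)))"

lemma cutoff_bounds: "0 \<le> cutoff m A x" "cutoff m A x \<le> 1"
  unfolding cutoff_def by (auto intro!: prod_nonneg prod_le_1 simp: ramp_bounds)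

lemma cutoff_measurable [measurable]: "cutoff m A \<in> borel_measurable borel"
  unfolding cutoff_def by measurable

lemma cutoff_eq_0: "finite A \<Longrightarrow> F \<in> A \<Longrightarrow> normal F \<bullet> x \<ge> offset F \<Longrightarrow> cutoff m A x = 0"
  unfolding cutoff_def by (rule prod_zero) (auto intro!: bexI[of _ F] ramp_0 simp: mult_nonneg_nonpos)

lemma cutoff_outside_interior: "x \<notin> interior T \<Longrightarrow> cutoff m facets x = 0"
  using cutoff_eq_0[OF finite_facets] unfolding interior_eq by force

lemma ramp_tendsto_1: "a > 0 \<Longrightarrow> \<forall>\<^sub>F m in sequentially. ramp (real m * a) = 1"
proof -
  assume a: "a > 0"
  obtain m0 where m0: "1 / a < real m0" using reals_Archimedean2 by blast
  have "ramp (real m * a) = 1" if "m \<ge> m0" for m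
  proof (rule ramp_1)
    have "1 / a \<le> real m" using m0 that by linarith
    then show "1 \<le> real m * a" using a by (simp add: field_simps)
  qed
  then show ?thesis by (auto simp: eventually_sequentially)
qed

lemma cutoff_tendsto_1: "x \<in> interior T \<Longrightarrow> (\<lambda>m. cutoff m facets x) \<longlonglongrightarrow> 1"
proof (rule tendsto_eventually)
  assume "x \<in> interior T"
  then have "\<forall>\<^sub>F m in sequentially. \<forall>F\<in>facets. ramp (real m * (offset F - normal F \<bullet> x)) = 1"
    using finite_facets by (intro eventually_ball_finite ballI ramp_tendsto_1) (auto simp: interior_eq)
  then show "\<forall>\<^sub>F m in sequentially. cutoff m facets x = 1"
    by eventually_elim (simp add: cutoff_def)
qed

lemma cutoff_lipschitz:
  "\<bar>cutoff m facets x - cutoff m facets y\<bar> \<le> real m * real (card facets) * norm (x - y)"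
proof -
  have "\<bar>cutoff m facets x - cutoff m facets y\<bar>
    \<le> (\<Sum>F\<in>facets. norm (ramp (real m * (offset F - normal F \<bullet> x)) - ramp (real m * (offset F - normal F \<bullet> y))))"
    unfolding cutoff_def real_norm_def[symmetric]
    by (rule norm_prod_diff) (use ramp_bounds in auto)
  also have "\<dots> \<le> (\<Sum>F\<in>facets. real m * norm (x - y))"
  proof (rule sum_mono)
    fix F assume "F \<in> facets"
    then have n: "norm (normal F) = 1" using norm_normal by simp
    have "norm (ramp (real m * (offset F - normal F \<bullet> x)) - ramp (real m * (offset F - normal F \<bullet> y)))
      \<le> \<bar>real m * (offset F - normal F \<bullet> x) - real m * (offset F - normal F \<bullet> y)\<bar>"
      using ramp_lipschitz by simp
    also have "\<dots> = real m * \<bar>normal F \<bullet> (x - y)\<bar>"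
    proof -
      have "real m * (offset F - normal F \<bullet> x) - real m * (offset F - normal F \<bullet> y) = - (real m * (normal F \<bullet> (x - y)))"
        by (simp add: inner_diff_right algebra_simps)
      then show ?thesis by (simp add: abs_mult)
    qed
    also have "\<dots> \<le> real m * norm (x - y)"
      using Cauchy_Schwarz_ineq2[of "normal F" "x - y"] n by (intro mult_left_mono) auto
    finally show "norm (ramp (real m * (offset F - normal F \<bullet> x)) - ramp (real m * (offset F - normal F \<bullet> y))) \<le> real m * norm (x - y)" .
  qed
  finally show ?thesis by (simp add: mult_ac)
qed

text \<open>The part of space where the factor of \<open>F\<close> in the cutoff has a nonzero
  slope, with the half-open form that \<open>thin_slab_integral\<close> takes.\<close>

definition layer :: "nat \<Rightarrow> (real^'n) set \<Rightarrow> (real^'n) set" where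
  "layer m F = {x. 0 \<le> real m * (offset F - normal F \<bullet> x) \<and> real m * (offset F - normal F \<bullet> x) < 1}"

lemma layer_borel [measurable]: "layer m F \<in> sets borel"
  unfolding layer_def by measurable

lemma cutoff_has_derivative:
  assumes "\<And>F. F \<in> facets \<Longrightarrow> real m * (offset F - normal F \<bullet> x) \<notin> {0, 1}"
  shows "((\<lambda>t. cutoff m facets (x + t *\<^sub>R v)) has_real_derivative
    (\<Sum>F\<in>facets. (- real m * (normal F \<bullet> v) * indicator (layer m F) x) * cutoff m (facets - {F}) x)) (at 0)"
proof -
  have der: "((\<lambda>t. ramp (real m * (offset F - normal F \<bullet> (x + t *\<^sub>R v)))) has_real_derivative
      - real m * (normal F \<bullet> v) * indicator (layer m F) x) (at 0)" if F: "F \<in> facets" for F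
  proof -
    have 1: "((\<lambda>t. real m * (offset F - normal F \<bullet> (x + t *\<^sub>R v))) has_real_derivative - real m * (normal F \<bullet> v)) (at 0)"
      by (auto intro!: derivative_eq_intros simp: inner_add_right)
    let ?t = "real m * (offset F - normal F \<bullet> (x + 0 *\<^sub>R v))"
    have "(ramp has_real_derivative indicator (layer m F) x) (at ?t)"
    proof -
      have "indicator (layer m F) x = (indicator {0..<1} ?t :: real)"
        by (simp add: layer_def indicator_def)
      moreover have "?t \<noteq> 0" "?t \<noteq> 1" using assms[OF F] by auto
      ultimately show ?thesis using ramp_has_derivative[of ?t] by metis
    qed
    from DERIV_chain'[OF 1 this] show ?thesis
      by (simp add: mult_ac)
  qed
  from has_field_derivative_prod[where A = facets
      and f = "\<lambda>F t. ramp (real m * (offset F - normal F \<bullet> (x + t *\<^sub>R v)))", OF der]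
  show ?thesis
    by (simp add: cutoff_def)
qed

text \<open>The product of \<open>\<phi>\<close> and the cutoff is Lipschitz with bounded support,
  so its partial derivative, which exists off finitely many hyperplanes, has integral 0. The product
  rule separates the volume term from one layer term per facet, the slope contributing
  \<open>real m\<close> times a component of the normal.\<close>

lemma integral_cutoff_deriv:
  fixes \<phi> :: "real^'n \<Rightarrow> real"
  assumes \<phi>: "smooth \<phi>" and m: "m > 0"
  shows "(LINT x|lborel. partial_deriv i \<phi> x * cutoff m facets x)
    = (\<Sum>F\<in>facets. normal F $ i * (real m * (LINT x|lborel. indicator (layer m F) x * (\<phi> x * cutoff m (facets - {F}) x))))"
proof -
  define \<psi> where "\<psi> = (\<lambda>x. \<phi> x * cutoff m facets x)"
  define d where "d = (\<lambda>x. partial_deriv i \<phi> x * cutoff m facets x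
      - (\<Sum>F\<in>facets. normal F $ i * (real m * (indicator (layer m F) x * (\<phi> x * cutoff m (facets - {F}) x)))))"
  have \<phi>_meas: "\<phi> \<in> borel_measurable borel" "partial_deriv i \<phi> \<in> borel_measurable borel"
    by (auto intro: smooth_borel_measurable smooth_partial_deriv \<phi>)
  obtain R where R: "R > 0" "\<And>x. x \<in> T \<Longrightarrow> norm x \<le> R" using bounded bounded_pos by blast
  \<comment> \<open>The margin 1 accommodates steps up to 1 in the difference quotients: if one of
    \<open>x\<close> and \<open>x + t *\<^sub>R axis i 1\<close> lies in \<open>T\<close>, both lie
    in \<open>?B\<close>, where \<open>\<phi>\<close> is bounded and Lipschitz.\<close>
  let ?B = "cball 0 (R + 1) :: (real^'n) set"
  obtain L where L: "L > 0" "\<And>x y. x \<in> ?B \<Longrightarrow> y \<in> ?B \<Longrightarrow> \<bar>\<phi> x - \<phi> y\<bar> \<le> L * norm (x - y)"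
    using smooth_lipschitz_on_compact_convex[OF \<phi>, of ?B] by auto
  have "bounded (\<phi> ` ?B)" "bounded (partial_deriv i \<phi> ` ?B)"
    by (intro compact_imp_bounded compact_continuous_image smooth_continuous_on smooth_partial_deriv \<phi> compact_cball)+
  then obtain M M' where M: "M > 0" "\<And>x. x \<in> ?B \<Longrightarrow> \<bar>\<phi> x\<bar> \<le> M" and M': "M' > 0" "\<And>x. x \<in> ?B \<Longrightarrow> \<bar>partial_deriv i \<phi> x\<bar> \<le> M'"
    unfolding bounded_pos by auto
  have B_fin: "emeasure lborel ?B < \<infinity>" by (rule emeasure_bounded_finite) simp
  have T_B: "T \<subseteq> ?B" using R by force
  have bounded_int: "integrable lborel f"
    if "f \<in> borel_measurable borel" "\<And>x. x \<in> T \<Longrightarrow> \<bar>f x\<bar> \<le> K" "\<And>x. x \<notin> T \<Longrightarrow> f x = 0" for f :: "real^'n \<Rightarrow> real" and K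
  proof -
    have "integrable lborel (\<lambda>x. K * indicator ?B x)"
      using B_fin by (intro integrable_mult_right integrable_real_indicator) auto
    then show ?thesis
    proof (rule Bochner_Integration.integrable_bound)
      show "AE x in lborel. norm (f x) \<le> norm (K * indicator ?B x)"
      proof (rule AE_I2)
        fix x show "norm (f x) \<le> norm (K * indicator ?B x)"
        proof (cases "x \<in> T")
          case True
          then have "x \<in> ?B" using T_B by blast
          then show ?thesis using that(2)[OF True] by (simp add: indicator_def)
        qed (use that(3) in auto)
      qed
    qed (use that(1) in auto)
  qed
  have abs_cutoff: "\<bar>u * cutoff m A x\<bar> \<le> \<bar>u\<bar>" for u A x
    using cutoff_bounds[of m A x] mult_left_le[of "cutoff m A x" "\<bar>u\<bar>"] by (simp add: abs_mult)
  have cutoff_notin: "cutoff m facets x = 0" if "x \<notin> T" for x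
    using cutoff_outside_interior interior_subset that by blast
  have \<psi>_int: "integrable lborel \<psi>"
    unfolding \<psi>_def using T_B M(2) \<phi>_meas
    by (intro bounded_int[where K = M]) (auto simp: cutoff_notin intro!: order.trans[OF abs_cutoff])
  have int1: "integrable lborel (\<lambda>x. partial_deriv i \<phi> x * cutoff m facets x)"
    using T_B M'(2) \<phi>_meas
    by (intro bounded_int[where K = M']) (auto simp: cutoff_notin intro!: order.trans[OF abs_cutoff])
  have int2: "integrable lborel (\<lambda>x. indicator (layer m F) x * (\<phi> x * cutoff m (facets - {F}) x))" if F: "F \<in> facets" for F
  proof (rule bounded_int[where K = M])
    show "(\<lambda>x. indicator (layer m F) x * (\<phi> x * cutoff m (facets - {F}) x)) \<in> borel_measurable borel"
      using \<phi>_meas by measurable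
    show "\<bar>indicator (layer m F) x * (\<phi> x * cutoff m (facets - {F}) x)\<bar> \<le> M" if "x \<in> T" for x
    proof -
      have "\<bar>\<phi> x\<bar> \<le> M" using T_B M(2) that by blast
      then have "\<bar>\<phi> x * cutoff m (facets - {F}) x\<bar> \<le> M"
        using abs_cutoff[of "\<phi> x" "facets - {F}" x] by linarith
      then show ?thesis using M(1) by (simp add: indicator_def)
    qed
    \<comment> \<open>The layer extends beyond \<open>T\<close>. At such a point the inequality of
      \<open>F\<close> holds, so that of another facet fails and its factor in the remaining product
      is 0.\<close>
    show "indicator (layer m F) x * (\<phi> x * cutoff m (facets - {F}) x) = 0" if x: "x \<notin> T" for x
    proof (cases "x \<in> layer m F")
      case True
      then have "normal F \<bullet> x \<le> offset F" using m by (simp add: layer_def zero_le_mult_iff)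
      then obtain F' where F': "F' \<in> facets - {F}" "normal F' \<bullet> x > offset F'"
        using violated_facet[OF x] by blast
      have "cutoff m (facets - {F}) x = 0"
        by (rule cutoff_eq_0[of _ F']) (use finite_facets F' in auto)
      then show ?thesis by simp
    qed auto
  qed
  have "(LINT x|lborel. d x) = 0"
  proof (rule integral_directional_derivative_eq_0[OF \<psi>_int, where v = "axis i 1" and R = "R + 1"
        and C = "L + M * (real m * real (card facets))"])
    show "\<bar>\<psi> (x + t *\<^sub>R axis i 1) - \<psi> x\<bar> \<le> (L + M * (real m * real (card facets))) * t * indicator ?B x"
      if t: "0 < t" "t \<le> 1" for x t
    proof -
      let ?y = "x + t *\<^sub>R axis i 1"
      have norm_xy: "norm (?y - x) = t" using t by simp
      show ?thesis
      proof (cases "x \<in> T \<or> ?y \<in> T")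
        case True
        have "norm x \<le> R + 1 \<and> norm ?y \<le> R + 1"
          using True R(2)[of x] R(2)[of ?y] norm_triangle_ineq2[of x ?y] norm_triangle_ineq2[of ?y x] norm_xy t
          by (auto simp: norm_minus_commute[of x ?y])
        then have B: "x \<in> ?B" "?y \<in> ?B" by auto
        have "\<psi> ?y - \<psi> x = (\<phi> ?y - \<phi> x) * cutoff m facets ?y + \<phi> x * (cutoff m facets ?y - cutoff m facets x)"
          by (simp add: \<psi>_def algebra_simps)
        also have "\<bar>\<dots>\<bar> \<le> \<bar>\<phi> ?y - \<phi> x\<bar> + \<bar>\<phi> x\<bar> * \<bar>cutoff m facets ?y - cutoff m facets x\<bar>"
          using abs_triangle_ineq[of "(\<phi> ?y - \<phi> x) * cutoff m facets ?y" "\<phi> x * (cutoff m facets ?y - cutoff m facets x)"]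
            abs_cutoff[of "\<phi> ?y - \<phi> x" facets ?y] by (simp add: abs_mult)
        also have "\<dots> \<le> L * t + M * (real m * real (card facets) * t)"
          using L(2)[OF B(2,1)] M(2)[OF B(1)] cutoff_lipschitz[of m ?y x] M(1) unfolding norm_xy
          by (intro add_mono mult_mono) auto
        finally show ?thesis using B by (simp add: algebra_simps)
      next
        case False
        then have "\<psi> ?y = 0" "\<psi> x = 0" by (auto simp: \<psi>_def cutoff_notin)
        moreover have "0 \<le> (L + M * (real m * real (card facets))) * t * indicator ?B x"
          using L M t by (intro mult_nonneg_nonneg add_nonneg_nonneg) auto
        ultimately show ?thesis by simp
      qed
    qed
    have "AE x in lborel. \<forall>F\<in>facets. real m * (offset F - normal F \<bullet> x) \<notin> {0, 1}"
    proof (rule AE_finite_allI[OF finite_facets])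
      fix F assume F: "F \<in> facets"
      have hyp: "AE x in lborel. normal F \<bullet> x \<noteq> a" for a
        using normal_nonzero F by (intro AE_not_in_hyperplane) simp
      show "AE x in lborel. real m * (offset F - normal F \<bullet> x) \<notin> {0, 1}"
        using hyp[of "offset F"] hyp[of "offset F - 1 / real m"]
        by eventually_elim (use m in \<open>auto simp: field_simps\<close>)
    qed
    then show "AE x in lborel. ((\<lambda>t. \<psi> (x + t *\<^sub>R axis i 1)) has_real_derivative d x) (at 0)"
    proof eventually_elim
      case (elim x)
      have 1: "((\<lambda>t. \<phi> (x + t *\<^sub>R axis i 1)) has_real_derivative partial_deriv i \<phi> x) (at 0)"
        using has_derivative_axis_has_real_derivative[OF smooth_differentiable[OF \<phi>], where x = x and t = 0 and i = i] by simp
      have 2: "((\<lambda>t. cutoff m facets (x + t *\<^sub>R axis i 1)) has_real_derivative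
        (\<Sum>F\<in>facets. (- real m * (normal F $ i) * indicator (layer m F) x) * cutoff m (facets - {F}) x)) (at 0)"
        using cutoff_has_derivative[of m x "axis i 1"] elim by (simp add: inner_axis)
      have "d x = partial_deriv i \<phi> x * cutoff m facets (x + 0 *\<^sub>R axis i 1)
        + (\<Sum>F\<in>facets. (- real m * (normal F $ i) * indicator (layer m F) x) * cutoff m (facets - {F}) x) * \<phi> (x + 0 *\<^sub>R axis i 1)"
        by (simp add: d_def sum_distrib_right sum_distrib_left sum_negf mult_ac)
      with DERIV_mult[OF 1 2] show ?case by (simp add: \<psi>_def)
    qed
    show "d \<in> borel_measurable borel"
      unfolding d_def using \<phi>_meas by measurable
  qed
  moreover have "(LINT x|lborel. d x) = (LINT x|lborel. partial_deriv i \<phi> x * cutoff m facets x)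
    - (\<Sum>F\<in>facets. normal F $ i * (real m * (LINT x|lborel. indicator (layer m F) x * (\<phi> x * cutoff m (facets - {F}) x))))"
  proof -
    let ?s = "\<lambda>F x. normal F $ i * (real m * (indicator (layer m F) x * (\<phi> x * cutoff m (facets - {F}) x)))"
    have int3: "integrable lborel (?s F)" if "F \<in> facets" for F
      using int2[OF that] by simp
    have "(LINT x|lborel. d x) = (LINT x|lborel. partial_deriv i \<phi> x * cutoff m facets x) - (LINT x|lborel. (\<Sum>F\<in>facets. ?s F x))"
      unfolding d_def by (rule Bochner_Integration.integral_diff[OF int1 Bochner_Integration.integrable_sum[OF int3]])
    also have "(LINT x|lborel. (\<Sum>F\<in>facets. ?s F x)) = (\<Sum>F\<in>facets. LINT x|lborel. ?s F x)"
      by (rule Bochner_Integration.integral_sum[OF int3])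
    finally show ?thesis by simp
  qed
  ultimately show ?thesis by simp
qed

text \<open>Stacking translates rewrites the left side as an integral over the unit slab of
  \<open>\<phi>\<close> times the cutoff at \<open>q m y\<close>, which tends to
  \<open>proj F y\<close>. If the projection is beside \<open>F\<close>, the other factors are
  eventually 1; if it strictly violates another inequality, the integrand is eventually 0; the
  remaining \<open>y\<close> form a null set.\<close>

lemma layer_integral_tendsto:
  fixes \<phi> :: "real^'n \<Rightarrow> real"
  assumes \<phi>: "smooth \<phi>" and F: "F \<in> facets"
  shows "(\<lambda>m. real (Suc m) * (LINT x|lborel. indicator (layer (Suc m) F) x * (\<phi> x * cutoff (Suc m) (facets - {F}) x)))
    \<longlonglongrightarrow> (LINT y|side_measure T F. \<phi> y)"
proof -
  have F': "F facet_of T" using F by simp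
  note nn = inner_normal_self[OF F']
  have \<phi>_meas: "\<phi> \<in> borel_measurable borel" by (intro smooth_borel_measurable \<phi>)
  obtain R where R: "R > 0" "\<And>x. x \<in> T \<Longrightarrow> norm x \<le> R" using bounded bounded_pos by blast
  have "bounded (\<phi> ` T)"
    by (intro compact_imp_bounded compact_continuous_image smooth_continuous_on \<phi> compact)
  then obtain M where M: "M > 0" "\<And>x. x \<in> T \<Longrightarrow> \<bar>\<phi> x\<bar> \<le> M"
    unfolding bounded_pos by auto
  \<comment> \<open>The height of \<open>y\<close> above \<open>F\<close> is reduced by itself
    rounded up to a multiple of \<open>1 / Suc m\<close>. The new height lies between
    \<open>- 1 / Suc m\<close> and 0, so \<open>q m y\<close> is on the inner side of
    \<open>F\<close>, in the layer.\<close>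
  define q where "q = (\<lambda>m y. y - (of_int \<lceil>real (Suc m) * (normal F \<bullet> y - offset F)\<rceil> / real (Suc m)) *\<^sub>R normal F)"
  have q_meas[measurable]: "q m \<in> borel_measurable borel" for m unfolding q_def by measurable
  let ?slab = "{y. 0 < normal F \<bullet> y - offset F \<and> normal F \<bullet> y - offset F \<le> 1}"
  have slab: "?slab \<in> sets borel" by measurable
  define f where "f = (\<lambda>m x. indicator T x * (\<phi> x * cutoff (Suc m) (facets - {F}) x))"
  have T_borel: "T \<in> sets borel" using closed by auto
  have T_fin: "emeasure lborel T < \<infinity>" by (rule emeasure_bounded_finite[OF bounded])
  have f_meas[measurable]: "f m \<in> borel_measurable borel" for m
    unfolding f_def using \<phi>_meas T_borel by measurable
  have f_le: "\<bar>f m x\<bar> \<le> M * indicator T x" for m x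
    using M(2)[of x] cutoff_bounds[of "Suc m" "facets - {F}" x] mult_left_le[of "cutoff (Suc m) (facets - {F}) x" "\<bar>\<phi> x\<bar>"]
    by (auto simp: f_def indicator_def abs_mult)
  have f_int: "integrable lborel (f m)" for m
  proof (rule Bochner_Integration.integrable_bound)
    show "integrable lborel (\<lambda>x. M * indicator T x)"
      using T_fin T_borel by (intro integrable_mult_right integrable_real_indicator) auto
  qed (use f_le M in \<open>auto simp: abs_mult\<close>)
  have layer_T: "indicator (layer (Suc m) F) x * (\<phi> x * cutoff (Suc m) (facets - {F}) x) = indicator (layer (Suc m) F) x * f m x" for m x
  proof (cases "x \<in> layer (Suc m) F \<and> x \<notin> T")
    case True
    then have "normal F \<bullet> x \<le> offset F" by (simp add: layer_def zero_le_mult_iff del: of_nat_Suc)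
    then obtain F' where F': "F' \<in> facets - {F}" "normal F' \<bullet> x > offset F'"
      using violated_facet[of x F] True by blast
    have "cutoff (Suc m) (facets - {F}) x = 0"
      by (rule cutoff_eq_0[of _ F']) (use finite_facets F' in auto)
    then show ?thesis by (simp add: f_def)
  qed (auto simp: f_def indicator_def)
  have eq: "real (Suc m) * (LINT x|lborel. indicator (layer (Suc m) F) x * (\<phi> x * cutoff (Suc m) (facets - {F}) x))
      = (LINT y|lborel. indicator ?slab y * f m (q m y))" for m
    using thin_slab_integral[OF nn _ f_int, of "Suc m" "offset F" m] unfolding layer_T
    by (simp add: layer_def q_def del: of_nat_Suc)
  have q_eq: "q m y = proj F y - ((of_int \<lceil>real (Suc m) * (normal F \<bullet> y - offset F)\<rceil> - real (Suc m) * (normal F \<bullet> y - offset F)) / real (Suc m)) *\<^sub>R normal F" for m y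
  proof -
    have "real (Suc m) \<noteq> 0" by simp
    then show ?thesis
      unfolding q_def proj_def diff_divide_distrib scaleR_diff_left by (simp add: scaleR_diff_left del: of_nat_Suc)
  qed
  have q_lim: "(\<lambda>m. q m y) \<longlonglongrightarrow> proj F y" for y
  proof -
    have "(\<lambda>m. (of_int \<lceil>real (Suc m) * (normal F \<bullet> y - offset F)\<rceil> - real (Suc m) * (normal F \<bullet> y - offset F)) / real (Suc m)) \<longlonglongrightarrow> 0"
    proof (rule Lim_null_comparison)
      show "(\<lambda>m. 1 / real (Suc m)) \<longlonglongrightarrow> 0"
        using LIMSEQ_inverse_real_of_nat by (simp add: inverse_eq_divide)
      have "\<bar>of_int \<lceil>r\<rceil> - r\<bar> \<le> 1" for r :: real by linarith
      then show "\<forall>\<^sub>F m in sequentially. norm ((of_int \<lceil>real (Suc m) * (normal F \<bullet> y - offset F)\<rceil> - real (Suc m) * (normal F \<bullet> y - offset F)) / real (Suc m)) \<le> 1 / real (Suc m)"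
        by (intro always_eventually allI) (simp add: abs_divide divide_right_mono del: of_nat_Suc)
    qed
    then have "(\<lambda>m. q m y) \<longlonglongrightarrow> proj F y - 0 *\<^sub>R normal F"
      unfolding q_eq by (intro tendsto_intros)
    then show ?thesis by simp
  qed
  have "(\<lambda>m. LINT y|lborel. indicator ?slab y * f m (q m y)) \<longlonglongrightarrow> (LINT y|lborel. indicator (prism F) y * \<phi> (proj F y))"
  proof (rule integral_dominated_convergence[where w = "\<lambda>y. M * indicator (cball 0 (R + 1)) y"])
    show "integrable lborel (\<lambda>y::real^'n. M * indicator (cball 0 (R + 1)) y)"
      using emeasure_bounded_finite[of "cball (0::real^'n) (R + 1)"]
      by (intro integrable_mult_right integrable_real_indicator) auto
    show "AE y in lborel. norm (indicator ?slab y * f m (q m y)) \<le> M * indicator (cball 0 (R + 1)) y" for m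
    proof (rule AE_I2)
      fix y
      show "norm (indicator ?slab y * f m (q m y)) \<le> M * indicator (cball 0 (R + 1)) y"
      proof (cases "y \<in> ?slab \<and> q m y \<in> T")
        case True
        let ?k = "\<lceil>real (Suc m) * (normal F \<bullet> y - offset F)\<rceil>"
        have "0 \<le> ?k" using True by (auto simp: zero_le_ceiling intro!: order.strict_trans2[OF _ mult_nonneg_nonneg] simp del: of_nat_Suc)
        moreover have "?k \<le> int (Suc m)"
          using True mult_left_mono[of "normal F \<bullet> y - offset F" 1 "real (Suc m)"] by (simp add: ceiling_le_iff del: of_nat_Suc)
        ultimately have k: "0 \<le> of_int ?k / real (Suc m)" "of_int ?k / real (Suc m) \<le> 1"
          by (auto simp: divide_le_eq simp del: of_nat_Suc)
        have "norm y = norm (q m y + (of_int ?k / real (Suc m)) *\<^sub>R normal F)" by (simp add: q_def)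
        also have "\<dots> \<le> norm (q m y) + \<bar>of_int ?k / real (Suc m)\<bar>"
          using norm_triangle_ineq[of "q m y" "(of_int ?k / real (Suc m)) *\<^sub>R normal F"] norm_normal[OF F'] by simp
        also have "\<dots> \<le> R + 1" using R(2)[of "q m y"] True k by linarith
        finally have "norm y \<le> R + 1" .
        then show ?thesis using f_le[of m "q m y"] True by (simp add: indicator_def)
      qed (use M in \<open>auto simp: indicator_def f_def\<close>)
    qed
    have "AE x in lborel. \<forall>F'\<in>facets - {F}. normal F' \<bullet> proj F x \<noteq> offset F'"
      using finite_facets AE_proj_off_facet[OF F'] by (intro AE_finite_allI) auto
    \<comment> \<open>The slab excludes height 0 whereas the prism includes it; this hyperplane is
      discarded.\<close>
    moreover have "AE x in lborel. normal F \<bullet> x \<noteq> offset F"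
      by (rule AE_not_in_hyperplane[OF normal_nonzero[OF F']])
    ultimately show "AE y in lborel. (\<lambda>m. indicator ?slab y * f m (q m y)) \<longlonglongrightarrow> indicator (prism F) y * \<phi> (proj F y)"
    proof eventually_elim
      case (elim y)
      show ?case
      proof (cases "y \<in> ?slab")
        case False
        then have "y \<notin> prism F" using elim by (auto simp: prism_def)
        then show ?thesis using False by simp
      next
        case y: True
        have lim_n: "(\<lambda>m. normal F' \<bullet> q m y) \<longlonglongrightarrow> normal F' \<bullet> proj F y" for F'
          by (intro tendsto_intros q_lim)
        have q_le: "normal F \<bullet> q m y \<le> offset F" for m
        proof -
          have "0 \<le> (of_int \<lceil>real (Suc m) * (normal F \<bullet> y - offset F)\<rceil> - real (Suc m) * (normal F \<bullet> y - offset F)) / real (Suc m)"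
            by (intro divide_nonneg_nonneg) (auto simp del: of_nat_Suc)
          then show ?thesis unfolding q_eq by (simp add: inner_diff_right nn normal_proj[OF F'] del: of_nat_Suc)
        qed
        show ?thesis
        proof (cases "proj F y \<in> beside F")
          case True
          then have "proj F y \<in> F"
            using beside_in_polytope[OF F'] in_facet_iff[OF F'] normal_proj[OF F'] by simp
          then have prism: "y \<in> prism F" using y by (auto simp: prism_def)
          have ev1: "\<forall>\<^sub>F m in sequentially. ramp (real (Suc m) * (offset F' - normal F' \<bullet> q m y)) = 1"
            if "F' \<in> facets - {F}" for F'
          proof -
            let ?a = "(offset F' - normal F' \<bullet> proj F y) / 2"
            have a: "?a > 0" using True that by (simp add: beside_def)
            have "\<forall>\<^sub>F m in sequentially. normal F' \<bullet> q m y < offset F' - ?a"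
              using a by (intro order_tendstoD(2)[OF lim_n]) (simp add: field_simps)
            moreover have "\<forall>\<^sub>F m in sequentially. ramp (real (Suc m) * ?a) = 1"
              using ramp_tendsto_1[OF a] by (rule eventually_sequentially_Suc[THEN iffD2])
            ultimately show ?thesis
            proof eventually_elim
              case (elim m)
              have "real (Suc m) * ?a \<le> real (Suc m) * (offset F' - normal F' \<bullet> q m y)"
                using elim(1) by (intro mult_left_mono) (linarith, simp)
              moreover have "real (Suc m) * ?a \<ge> 1" using elim(2) by (auto simp: ramp_def max_def min_def split: if_splits)
              ultimately show ?case by (intro ramp_1) linarith
            qed
          qed
          have "\<forall>\<^sub>F m in sequentially. \<forall>F'\<in>facets - {F}. ramp (real (Suc m) * (offset F' - normal F' \<bullet> q m y)) = 1"
            using finite_facets ev1 by (intro eventually_ball_finite) auto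
          moreover have "\<forall>\<^sub>F m in sequentially. q m y \<in> beside F"
            using topological_tendstoD[OF q_lim open_beside True] .
          ultimately have ev: "\<forall>\<^sub>F m in sequentially. f m (q m y) = \<phi> (q m y)"
          proof eventually_elim
            case (elim m)
            have "q m y \<in> T" by (rule beside_in_polytope[OF F' elim(2) q_le])
            moreover have "cutoff (Suc m) (facets - {F}) (q m y) = 1"
              unfolding cutoff_def using elim(1) by (intro prod.neutral) blast
            ultimately show ?case by (simp add: f_def)
          qed
          have "(\<lambda>m. \<phi> (q m y)) \<longlonglongrightarrow> \<phi> (proj F y)"
            by (rule continuous_on_tendsto_compose[OF smooth_continuous_on[OF \<phi>, of UNIV] q_lim]) auto
          then have "(\<lambda>m. f m (q m y)) \<longlonglongrightarrow> \<phi> (proj F y)"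
            by (simp only: tendsto_cong[OF ev])
          then show ?thesis using y prism by simp
        next
          case False
          then obtain F1 where F1: "F1 \<in> facets - {F}" "normal F1 \<bullet> proj F y > offset F1"
            using elim by (force simp: beside_def)
          then have "proj F y \<notin> T" using in_polytope_le by force
          then have "y \<notin> prism F" using in_facet_iff[OF F'] by (auto simp: prism_def)
          moreover have "\<forall>\<^sub>F m in sequentially. f m (q m y) = 0"
          proof -
            have "\<forall>\<^sub>F m in sequentially. normal F1 \<bullet> q m y > offset F1"
              by (rule order_tendstoD(1)[OF lim_n F1(2)])
            then show ?thesis
            proof eventually_elim
              case (elim m)
              have "q m y \<notin> T" using elim F1(1) in_polytope_le by force
              then show ?case by (simp add: f_def)
            qed
          qed
          ultimately show ?thesis
            by (auto intro!: tendsto_eventually elim: eventually_mono)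
        qed
      qed
    qed
    show "(\<lambda>y. indicator (prism F) y * \<phi> (proj F y)) \<in> borel_measurable lborel"
      using \<phi>_meas prism_borel[OF F'] by measurable
    show "(\<lambda>y. indicator ?slab y * f m (q m y)) \<in> borel_measurable lborel" for m
      using slab by measurable
  qed
  then show ?thesis
    unfolding eq side_measure_integral[OF F' \<phi>_meas] .
qed

theorem divergence:
  fixes \<phi> :: "real^'n \<Rightarrow> real"
  assumes \<phi>: "smooth \<phi>"
  shows "(LINT x|lborel. indicator (interior T) x * partial_deriv i \<phi> x)
    = (\<Sum>F\<in>facets. normal F $ i * (LINT y|side_measure T F. \<phi> y))"
proof (rule LIMSEQ_unique)
  have d\<phi>: "smooth (partial_deriv i \<phi>)" by (rule smooth_partial_deriv[OF \<phi>])
  have "bounded (partial_deriv i \<phi> ` T)"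
    by (intro compact_imp_bounded compact_continuous_image smooth_continuous_on d\<phi> compact)
  then obtain M where M: "M > 0" "\<And>x. x \<in> T \<Longrightarrow> \<bar>partial_deriv i \<phi> x\<bar> \<le> M"
    unfolding bounded_pos by auto
  have T_borel: "T \<in> sets borel" using closed by auto
  show "(\<lambda>m. LINT x|lborel. partial_deriv i \<phi> x * cutoff (Suc m) facets x)
      \<longlonglongrightarrow> (LINT x|lborel. indicator (interior T) x * partial_deriv i \<phi> x)"
  proof (rule integral_dominated_convergence[where w = "\<lambda>x. M * indicator T x"])
    show "integrable lborel (\<lambda>x. M * indicator T x)"
      using emeasure_bounded_finite[OF bounded] T_borel by (intro integrable_mult_right integrable_real_indicator) auto
    show "AE x in lborel. (\<lambda>m. partial_deriv i \<phi> x * cutoff (Suc m) facets x) \<longlonglongrightarrow> indicator (interior T) x * partial_deriv i \<phi> x"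
    proof (rule AE_I2)
      fix x
      show "(\<lambda>m. partial_deriv i \<phi> x * cutoff (Suc m) facets x) \<longlonglongrightarrow> indicator (interior T) x * partial_deriv i \<phi> x"
      proof (cases "x \<in> interior T")
        case True
        from tendsto_mult_left[OF LIMSEQ_Suc[OF cutoff_tendsto_1[OF True]]] show ?thesis using True by simp
      qed (simp add: cutoff_outside_interior)
    qed
    show "AE x in lborel. norm (partial_deriv i \<phi> x * cutoff (Suc m) facets x) \<le> M * indicator T x" for m
    proof (rule AE_I2)
      fix x
      show "norm (partial_deriv i \<phi> x * cutoff (Suc m) facets x) \<le> M * indicator T x"
      proof (cases "x \<in> T")
        case True
        then show ?thesis
          using M cutoff_bounds[of "Suc m" facets x] mult_mono[of "\<bar>partial_deriv i \<phi> x\<bar>" M "cutoff (Suc m) facets x" 1]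
          by (simp add: abs_mult)
      next
        case False
        then show ?thesis using cutoff_outside_interior[of x] interior_subset[of T] by auto
      qed
    qed
  qed (use smooth_borel_measurable[OF d\<phi>] in measurable)
  have "(LINT x|lborel. partial_deriv i \<phi> x * cutoff (Suc m) facets x)
    = (\<Sum>F\<in>facets. normal F $ i * (real (Suc m) * (LINT x|lborel. indicator (layer (Suc m) F) x * (\<phi> x * cutoff (Suc m) (facets - {F}) x))))" for m
    by (rule integral_cutoff_deriv[OF \<phi>]) simp
  then show "(\<lambda>m. LINT x|lborel. partial_deriv i \<phi> x * cutoff (Suc m) facets x)
      \<longlonglongrightarrow> (\<Sum>F\<in>facets. normal F $ i * (LINT y|side_measure T F. \<phi> y))"
    by (simp only:) (intro tendsto_intros layer_integral_tendsto[OF \<phi>])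
qed

end

section \<open>Traces and Green's formula\<close>

lemma integral_square_triangle:
  fixes f g h :: "'a \<Rightarrow> real"
  assumes "f \<in> L2_fun M" "g \<in> L2_fun M" "h \<in> L2_fun M"
  shows "(LINT x|M. (f x - h x)\<^sup>2) \<le> 2 * (LINT x|M. (f x - g x)\<^sup>2) + 2 * (LINT x|M. (h x - g x)\<^sup>2)"
proof -
  have le: "(f x - h x)\<^sup>2 \<le> 2 * (f x - g x)\<^sup>2 + 2 * (h x - g x)\<^sup>2" for x
    using square_sum_le2[of "f x - g x" "g x - h x"] by (simp add: power2_commute[of "g x" "h x"])
  have "(LINT x|M. (f x - h x)\<^sup>2) \<le> (LINT x|M. 2 * (f x - g x)\<^sup>2 + 2 * (h x - g x)\<^sup>2)"
    using L2_diff_integrable[OF assms(1,3)] L2_diff_integrable[OF assms(1,2)] L2_diff_integrable[OF assms(3,2)]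
    by (intro integral_mono le) auto
  also have "\<dots> = 2 * (LINT x|M. (f x - g x)\<^sup>2) + 2 * (LINT x|M. (h x - g x)\<^sup>2)"
    using L2_diff_integrable[OF assms(1,2)] L2_diff_integrable[OF assms(3,2)] by simp
  finally show ?thesis .
qed

text \<open>The Riesz-Fischer theorem. On a finite measure the Cauchy-Schwarz inequality against the
  constant 1 turns an \<open>L^2\<close> Cauchy sequence into an \<open>L^1\<close> Cauchy sequence,
  which has an almost everywhere convergent subsequence; its limit is \<open>t\<close>.\<close>

lemma L2_complete:
  fixes f :: "nat \<Rightarrow> 'a \<Rightarrow> real"
  assumes M: "finite_measure M" and f: "\<And>m. f m \<in> L2_fun M"
    and Cauchy: "\<And>e. e > 0 \<Longrightarrow> \<exists>N. \<forall>m\<ge>N. \<forall>n\<ge>N. (LINT x|M. (f m x - f n x)\<^sup>2) < e"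
  obtains t where "t \<in> L2_fun M" "(\<lambda>m. LINT x|M. (f m x - t x)\<^sup>2) \<longlonglongrightarrow> 0"
proof -
  interpret finite_measure M by fact
  have f_meas[measurable]: "f m \<in> borel_measurable M" for m using f by (simp add: L2_fun_def)
  have one: "(\<lambda>x. 1) \<in> L2_fun M" by (auto simp: L2_fun_def)
  have "integrable M (f m)" for m using L2_mult_integrable[OF f one, of m] by simp
  moreover have "\<exists>N. \<forall>m\<ge>N. \<forall>n\<ge>N. (LINT x|M. norm (f m x - f n x)) < e" if e: "e > 0" for e
  proof -
    let ?V = "measure M (space M)"
    have V: "?V \<ge> 0" by simp
    then have "e\<^sup>2 / (?V + 1) > 0" using e by (intro divide_pos_pos add_nonneg_pos) auto
    from Cauchy[OF this] obtain N where N: "\<And>m n. m \<ge> N \<Longrightarrow> n \<ge> N \<Longrightarrow> (LINT x|M. (f m x - f n x)\<^sup>2) < e\<^sup>2 / (?V + 1)"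
      by blast
    have "(LINT x|M. norm (f m x - f n x)) < e" if "m \<ge> N" "n \<ge> N" for m n
    proof -
      have abs: "(\<lambda>x. \<bar>f m x - f n x\<bar>) \<in> L2_fun M"
        using L2_diff[OF f f, of m n] by (auto simp: L2_fun_def)
      have "(LINT x|M. \<bar>f m x - f n x\<bar>)\<^sup>2 \<le> (LINT x|M. (f m x - f n x)\<^sup>2) * ?V"
        using Cauchy_Schwarz_integral[OF abs one] by simp
      also have "\<dots> \<le> (LINT x|M. (f m x - f n x)\<^sup>2) * (?V + 1)"
        by (intro mult_left_mono Bochner_Integration.integral_nonneg) auto
      also have "\<dots> < e\<^sup>2 / (?V + 1) * (?V + 1)"
        using N[OF that] by (intro mult_strict_right_mono add_nonneg_pos) auto
      also have "\<dots> = e\<^sup>2"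
      proof -
        have "?V + 1 \<noteq> 0" using V by linarith
        then show ?thesis by (rule nonzero_eq_divide_eq[THEN iffD1, OF _ refl, symmetric, THEN sym])
      qed
      finally show ?thesis using e by (simp add: power2_less_imp_less)
    qed
    then show ?thesis by blast
  qed
  ultimately obtain r where r: "strict_mono r" "AE x in M. Cauchy (\<lambda>i. f (r i) x)"
    using cauchy_L1_AE_cauchy_subseq[of M f] by blast
  define t where "t = (\<lambda>x. lim (\<lambda>i. f (r i) x))"
  have t_meas[measurable]: "t \<in> borel_measurable M" unfolding t_def by measurable
  have t_lim: "AE x in M. (\<lambda>i. f (r i) x) \<longlonglongrightarrow> t x"
    using r(2) by eventually_elim (simp add: t_def Cauchy_convergent_iff convergent_LIMSEQ_iff)
  \<comment> \<open>Fatou's lemma along the subsequence passes the Cauchy bound to the limit. The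
    nonnegative integral is used because \<open>f m - t\<close> is not yet known to be square
    integrable; this bound is what proves it.\<close>
  have est: "(\<integral>\<^sup>+x. ennreal ((f m x - t x)\<^sup>2) \<partial>M) \<le> ennreal e"
    if N: "\<And>m n. m \<ge> N \<Longrightarrow> n \<ge> N \<Longrightarrow> (LINT x|M. (f m x - f n x)\<^sup>2) < e" and m: "m \<ge> N" for m e N
  proof -
    have "(\<integral>\<^sup>+x. ennreal ((f m x - t x)\<^sup>2) \<partial>M) = (\<integral>\<^sup>+x. liminf (\<lambda>i. ennreal ((f m x - f (r i) x)\<^sup>2)) \<partial>M)"
    proof (rule nn_integral_cong_AE)
      show "AE x in M. ennreal ((f m x - t x)\<^sup>2) = liminf (\<lambda>i. ennreal ((f m x - f (r i) x)\<^sup>2))"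
        using t_lim
      proof eventually_elim
        case (elim x)
        have "(\<lambda>i. ennreal ((f m x - f (r i) x)\<^sup>2)) \<longlonglongrightarrow> ennreal ((f m x - t x)\<^sup>2)"
          by (intro tendsto_ennrealI tendsto_intros elim)
        from lim_imp_Liminf[OF _ this] show ?case by simp
      qed
    qed
    also have "\<dots> \<le> liminf (\<lambda>i. \<integral>\<^sup>+x. ennreal ((f m x - f (r i) x)\<^sup>2) \<partial>M)"
      by (rule nn_integral_liminf) measurable
    also have "\<dots> \<le> ennreal e"
    proof (rule Liminf_le)
      show "\<forall>\<^sub>F i in sequentially. (\<integral>\<^sup>+x. ennreal ((f m x - f (r i) x)\<^sup>2) \<partial>M) \<le> ennreal e"
        unfolding eventually_sequentially
      proof (intro exI allI impI)
        fix i assume "N \<le> i"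
        then have "r i \<ge> N" using seq_suble[OF r(1), of i] by linarith
        then have "(LINT x|M. (f m x - f (r i) x)\<^sup>2) \<le> e" using N[OF m] by (simp add: less_imp_le)
        moreover have "(\<integral>\<^sup>+x. ennreal ((f m x - f (r i) x)\<^sup>2) \<partial>M) = ennreal (LINT x|M. (f m x - f (r i) x)\<^sup>2)"
          by (rule nn_integral_eq_integral[OF L2_diff_integrable[OF f f]]) auto
        ultimately show "(\<integral>\<^sup>+x. ennreal ((f m x - f (r i) x)\<^sup>2) \<partial>M) \<le> ennreal e" by (simp add: ennreal_leI)
      qed
    qed simp
    finally show ?thesis .
  qed
  have int: "integrable M (\<lambda>x. (f m x - t x)\<^sup>2)" if "(\<integral>\<^sup>+x. ennreal ((f m x - t x)\<^sup>2) \<partial>M) \<le> ennreal e" for m e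
    using that by (subst integrable_iff_bounded) (auto simp: top_unique intro: le_less_trans)
  have diff_L2: "\<exists>m. (\<lambda>x. f m x - t x) \<in> L2_fun M"
  proof -
    obtain N where "\<And>m n. m \<ge> N \<Longrightarrow> n \<ge> N \<Longrightarrow> (LINT x|M. (f m x - f n x)\<^sup>2) < 1"
      using Cauchy[of 1] by auto
    from int[OF est[OF this, of N]] show ?thesis by (auto simp: L2_fun_def)
  qed
  have "t \<in> L2_fun M"
  proof -
    obtain m where "(\<lambda>x. f m x - t x) \<in> L2_fun M" using diff_L2 by blast
    from L2_diff[OF f this, of m] show ?thesis by simp
  qed
  moreover have "(\<lambda>m. LINT x|M. (f m x - t x)\<^sup>2) \<longlonglongrightarrow> 0"
  proof (rule LIMSEQ_I)
    fix e :: real assume e: "e > 0"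
    obtain N where N: "\<And>m n. m \<ge> N \<Longrightarrow> n \<ge> N \<Longrightarrow> (LINT x|M. (f m x - f n x)\<^sup>2) < e / 2"
      using Cauchy[of "e / 2"] e by auto
    have "norm ((LINT x|M. (f m x - t x)\<^sup>2) - 0) < e" if m: "m \<ge> N" for m
    proof -
      have le: "(\<integral>\<^sup>+x. ennreal ((f m x - t x)\<^sup>2) \<partial>M) \<le> ennreal (e / 2)" by (rule est[OF N m])
      have "ennreal (LINT x|M. (f m x - t x)\<^sup>2) \<le> ennreal (e / 2)"
        using le nn_integral_eq_integral[OF int[OF le]] by simp
      then have "(LINT x|M. (f m x - t x)\<^sup>2) \<le> e / 2" using e by (simp add: ennreal_le_iff)
      moreover have "0 \<le> (LINT x|M. (f m x - t x)\<^sup>2)" by (rule Bochner_Integration.integral_nonneg) auto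
      ultimately show ?thesis using e by simp
    qed
    then show "\<exists>N. \<forall>m\<ge>N. norm ((LINT x|M. (f m x - t x)\<^sup>2) - 0) < e" by blast
  qed
  ultimately show ?thesis using that by blast
qed

lemma norm_square_vec: "(norm v)\<^sup>2 = (\<Sum>i\<in>UNIV. (v $ i)\<^sup>2)" for v :: "real^'n::finite"
  unfolding power2_norm_eq_inner by (simp add: inner_vec_def power2_eq_square)

section \<open>The trace inequality, existence of traces, and Green's formula on an element\<close>

context solid_polytope
begin

abbreviation vol :: "(real^'n) measure" where
  "vol \<equiv> lebesgue_on (interior T)"

lemma vol_finite: "finite_measure vol"
proof
  have "emeasure lborel (interior T) < \<infinity>"
    by (rule emeasure_bounded_finite[OF bounded_subset[OF bounded interior_subset]])
  then show "emeasure vol (space vol) \<noteq> \<infinity>"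
    by (simp add: emeasure_restrict_space space_restrict_space)
qed

lemma AE_vol_in_polytope: "AE x in vol. x \<in> T"
  using interior_subset[of T] by (intro AE_I2) (auto simp: space_restrict_space)

lemma borel_measurable_vol: "f \<in> borel_measurable borel \<Longrightarrow> f \<in> borel_measurable vol"
  by (intro measurable_restrict_space1 measurable_completion) simp

lemma smooth_bounded_on_polytope: "smooth \<phi> \<Longrightarrow> \<exists>B. \<forall>x\<in>T. \<bar>\<phi> x\<bar> \<le> B"
  using compact_imp_bounded[OF compact_continuous_image[OF smooth_continuous_on compact]] by (auto simp: bounded_iff)

lemma smooth_L2_vol: "smooth \<phi> \<Longrightarrow> \<phi> \<in> L2_fun vol"
proof -
  assume \<phi>: "smooth \<phi>"
  obtain B where "\<forall>x\<in>T. \<bar>\<phi> x\<bar> \<le> B" using smooth_bounded_on_polytope[OF \<phi>] by blast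
  then show ?thesis
    using AE_vol_in_polytope \<phi>
    by (intro bounded_L2[OF vol_finite] borel_measurable_vol smooth_borel_measurable) (auto elim: eventually_mono)
qed

lemma smooth_L2_side: "F facet_of T \<Longrightarrow> smooth \<phi> \<Longrightarrow> \<phi> \<in> L2_fun (side_measure T F)"
proof -
  assume F: "F facet_of T" and \<phi>: "smooth \<phi>"
  obtain B where B: "\<forall>x\<in>T. \<bar>\<phi> x\<bar> \<le> B" using smooth_bounded_on_polytope[OF \<phi>] by blast
  have "AE x in side_measure T F. \<bar>\<phi> x\<bar> \<le> B"
    using AE_side_measure_in_facet[OF F] by eventually_elim (use B in_facet_iff[OF F] in blast)
  then show ?thesis
    by (intro bounded_L2[OF side_measure_finite[OF F]] side_measure_borel_measurable smooth_borel_measurable \<phi>)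
qed

lemma divergence_vol:
  assumes \<phi>: "smooth \<phi>"
  shows "(LINT x|vol. partial_deriv i \<phi> x) = (\<Sum>F\<in>facets. normal F $ i * (LINT y|side_measure T F. \<phi> y))"
  using divergence[OF \<phi>, of i] smooth_borel_measurable[OF smooth_partial_deriv[OF \<phi>]]
  by (subst integral_lebesgue_on_borel) auto

lemma trace_inequality:
  assumes F0: "F0 facet_of T"
  obtains C where "C \<ge> 0" "\<And>\<phi>. smooth \<phi> \<Longrightarrow> (LINT y|side_measure T F0. (\<phi> y)\<^sup>2)
    \<le> C * ((LINT x|vol. (\<phi> x)\<^sup>2) + (\<Sum>i\<in>UNIV. LINT x|vol. (partial_deriv i \<phi> x)\<^sup>2))"
proof -
  \<comment> \<open>On the facets the field \<open>x - a\<close> has positive normal component, as \<open>a\<close> is interior.\<close>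
  obtain a where a: "a \<in> interior T" using interior_nonempty by blast
  \<comment> \<open>The distance of \<open>a\<close> from the hyperplane of \<open>F\<close>, which
    is also the value of \<open>normal F \<bullet> (y - a)\<close> at every \<open>y\<close> in
    \<open>F\<close>.\<close>
  define d where "d = (\<lambda>F. offset F - normal F \<bullet> a)"
  have d: "d F > 0" if "F facet_of T" for F using a that by (simp add: d_def interior_eq)
  obtain R where R: "R > 0" "\<And>x. x \<in> T \<Longrightarrow> norm x \<le> R" using bounded bounded_pos by blast
  define D where "D = R + norm a"
  have D: "D > 0" "\<And>x i. x \<in> T \<Longrightarrow> \<bar>x $ i - a $ i\<bar> \<le> D"
  proof -
    show "D > 0" using R by (simp add: D_def add_pos_nonneg)
    fix x i assume "x \<in> T"
    then show "\<bar>x $ i - a $ i\<bar> \<le> D"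
      using R(2)[of x] component_le_norm_cart[of "x - a" i] norm_triangle_ineq4[of x a] by (simp add: D_def)
  qed
  define N where "N = real CARD('n)"
  \<comment> \<open>The divergence of \<open>(x - a) * \<phi>^2\<close> is at most the sum over
    \<open>i\<close> of \<open>\<phi>^2 + D * (\<phi>^2 + (partial_deriv i \<phi>)^2)\<close>. This
    gives the factor \<open>N + D * N\<close> for the function and \<open>D\<close> for its
    derivatives; their sum serves both. All facets contribute nonnegatively, so \<open>F0\<close>
    can be singled out at the cost of dividing by \<open>d F0\<close>.\<close>
  define C where "C = (N + D * N + D) / d F0"
  have "N \<ge> 0" by (simp add: N_def)
  then have "C \<ge> 0" using d[OF F0] D(1) by (simp add: C_def)
  moreover have "(LINT y|side_measure T F0. (\<phi> y)\<^sup>2)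
    \<le> C * ((LINT x|vol. (\<phi> x)\<^sup>2) + (\<Sum>i\<in>UNIV. LINT x|vol. (partial_deriv i \<phi> x)\<^sup>2))" if \<phi>: "smooth \<phi>" for \<phi>
  proof -
    let ?A = "LINT x|vol. (\<phi> x)\<^sup>2" and ?B = "\<lambda>i. LINT x|vol. (partial_deriv i \<phi> x)\<^sup>2"
    let ?w = "\<lambda>i x. (x $ i - a $ i) * (\<phi> x * \<phi> x)"
    have d\<phi>: "smooth (partial_deriv i \<phi>)" for i by (rule smooth_partial_deriv[OF \<phi>])
    have sm_c: "smooth (\<lambda>x. x $ i - a $ i)" for i by (intro smooth_diff smooth_coord smooth_const)
    have sm_w: "smooth (?w i)" for i by (intro smooth_mult sm_c \<phi>)
    have sq_int: "integrable vol (\<lambda>x. (\<phi> x)\<^sup>2)" "integrable vol (\<lambda>x. (partial_deriv i \<phi> x)\<^sup>2)" for i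
      using smooth_L2_vol[OF \<phi>] smooth_L2_vol[OF d\<phi>] by (auto simp: L2_fun_def)
    have A: "?A \<ge> 0" and B: "\<And>i. ?B i \<ge> 0" by (auto intro!: Bochner_Integration.integral_nonneg)
    have dw: "partial_deriv i (?w i) x = \<phi> x * \<phi> x + (x $ i - a $ i) * (2 * (\<phi> x * partial_deriv i \<phi> x))" for i x
    proof -
      have 1: "partial_deriv i (\<lambda>x. x $ i - a $ i) x = 1"
      proof -
        have "((\<lambda>x. x $ i - a $ i) has_derivative (\<lambda>h. h $ i - 0)) (at x)"
          by (intro has_derivative_diff has_derivative_const bounded_linear_imp_has_derivative bounded_linear_vec_nth)
        from partial_deriv_eqI[OF this, of i] show ?thesis by (simp add: axis_def)
      qed
      have 2: "partial_deriv i (\<lambda>x. \<phi> x * \<phi> x) x = 2 * (\<phi> x * partial_deriv i \<phi> x)"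
        by (subst partial_deriv_mult) (auto simp: smooth_differentiable[OF \<phi>])
      have "partial_deriv i (?w i) x = (x $ i - a $ i) * partial_deriv i (\<lambda>x. \<phi> x * \<phi> x) x
          + partial_deriv i (\<lambda>x. x $ i - a $ i) x * (\<phi> x * \<phi> x)"
        by (rule partial_deriv_mult) (intro smooth_differentiable sm_c smooth_mult \<phi>)+
      then show ?thesis unfolding 1 2 by simp
    qed
    have "(\<Sum>F\<in>facets. d F * (LINT y|side_measure T F. (\<phi> y)\<^sup>2))
        = (\<Sum>F\<in>facets. \<Sum>i\<in>UNIV. normal F $ i * (LINT y|side_measure T F. ?w i y))"
    proof (rule sum.cong[OF refl])
      fix F assume "F \<in> facets"
      then have F: "F facet_of T" by simp
      have int: "integrable (side_measure T F) (?w i)" for i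
      proof -
        have "integrable (side_measure T F) (\<lambda>x. (x $ i - a $ i) * (\<phi> x * \<phi> x))"
          by (intro L2_mult_integrable smooth_L2_side[OF F] sm_c smooth_mult \<phi>)
        then show ?thesis .
      qed
      have "(\<Sum>i\<in>UNIV. normal F $ i * (LINT y|side_measure T F. ?w i y))
          = (LINT y|side_measure T F. (\<Sum>i\<in>UNIV. normal F $ i * ?w i y))"
        using int by simp
      also have "\<dots> = (LINT y|side_measure T F. d F * (\<phi> y)\<^sup>2)"
      proof (rule integral_cong_AE_complete[OF side_measure_complete])
        show "AE y in side_measure T F. (\<Sum>i\<in>UNIV. normal F $ i * ?w i y) = d F * (\<phi> y)\<^sup>2"
          using AE_side_measure_in_facet[OF F]
        proof eventually_elim
          case (elim y)
          have "(\<Sum>i\<in>UNIV. normal F $ i * ?w i y) = (\<Sum>i\<in>UNIV. normal F $ i * (y - a) $ i) * (\<phi> y)\<^sup>2"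
            by (simp add: sum_distrib_right sum_distrib_left power2_eq_square mult_ac)
          also have "(\<Sum>i\<in>UNIV. normal F $ i * (y - a) $ i) = normal F \<bullet> (y - a)"
            by (simp add: inner_vec_def)
          also have "\<dots> = d F" using elim in_facet_iff[OF F] by (simp add: inner_diff_right d_def)
          finally show ?case .
        qed
      qed
      finally show "d F * (LINT y|side_measure T F. (\<phi> y)\<^sup>2) = (\<Sum>i\<in>UNIV. normal F $ i * (LINT y|side_measure T F. ?w i y))"
        by simp
    qed
    also have "\<dots> = (\<Sum>i\<in>UNIV. LINT x|vol. partial_deriv i (?w i) x)"
      unfolding divergence_vol[OF sm_w] by (rule sum.swap)
    also have "\<dots> \<le> (\<Sum>i\<in>UNIV. ?A + D * (?A + ?B i))"
    proof (rule sum_mono)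
      fix i :: 'n
      have "(LINT x|vol. partial_deriv i (?w i) x) \<le> (LINT x|vol. (\<phi> x)\<^sup>2 + D * ((\<phi> x)\<^sup>2 + (partial_deriv i \<phi> x)\<^sup>2))"
      proof (rule integral_mono_AE)
        have "integrable vol (\<lambda>x. partial_deriv i (?w i) x * 1)"
          by (intro L2_mult_integrable smooth_L2_vol smooth_partial_deriv sm_w smooth_const)
        then show "integrable vol (partial_deriv i (?w i))" by simp
        show "integrable vol (\<lambda>x. (\<phi> x)\<^sup>2 + D * ((\<phi> x)\<^sup>2 + (partial_deriv i \<phi> x)\<^sup>2))"
          using sq_int by simp
        show "AE x in vol. partial_deriv i (?w i) x \<le> (\<phi> x)\<^sup>2 + D * ((\<phi> x)\<^sup>2 + (partial_deriv i \<phi> x)\<^sup>2)"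
          using AE_vol_in_polytope
        proof eventually_elim
          case (elim x)
          let ?p = "2 * (\<phi> x * partial_deriv i \<phi> x)"
          have p: "\<bar>?p\<bar> \<le> (\<phi> x)\<^sup>2 + (partial_deriv i \<phi> x)\<^sup>2"
            using zero_le_power2[of "\<phi> x - partial_deriv i \<phi> x"] zero_le_power2[of "\<phi> x + partial_deriv i \<phi> x"]
            unfolding power2_sum power2_diff by (simp add: abs_le_iff)
          have "(x $ i - a $ i) * ?p \<le> \<bar>x $ i - a $ i\<bar> * \<bar>?p\<bar>" by (metis abs_ge_self abs_mult)
          also have "\<dots> \<le> D * ((\<phi> x)\<^sup>2 + (partial_deriv i \<phi> x)\<^sup>2)"
            by (intro mult_mono D p elim) (use D in auto)
          finally show ?case by (simp add: dw power2_eq_square)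
        qed
      qed
      also have "\<dots> = ?A + D * (?A + ?B i)" using sq_int by simp
      finally show "(LINT x|vol. partial_deriv i (?w i) x) \<le> ?A + D * (?A + ?B i)" .
    qed
    also have "\<dots> = (N + D * N) * ?A + D * (\<Sum>i\<in>UNIV. ?B i)"
      by (simp add: sum.distrib sum_distrib_left[symmetric] N_def algebra_simps)
    also have "\<dots> \<le> (N + D * N + D) * ?A + (N + D * N + D) * (\<Sum>i\<in>UNIV. ?B i)"
    proof -
      have "0 \<le> D * N" using D(1) \<open>N \<ge> 0\<close> by simp
      then have "N + D * N \<le> N + D * N + D" "D \<le> N + D * N + D" using D(1) \<open>N \<ge> 0\<close> by linarith+
      then show ?thesis using A B by (intro add_mono[OF mult_right_mono mult_right_mono] sum_nonneg) blast+
    qed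
    finally have le: "(\<Sum>F\<in>facets. d F * (LINT y|side_measure T F. (\<phi> y)\<^sup>2)) \<le> (N + D * N + D) * (?A + (\<Sum>i\<in>UNIV. ?B i))"
      by (simp add: distrib_left)
    have "d F0 * (LINT y|side_measure T F0. (\<phi> y)\<^sup>2) \<le> (\<Sum>F\<in>facets. d F * (LINT y|side_measure T F. (\<phi> y)\<^sup>2))"
    proof (rule member_le_sum[OF _ _ finite_facets])
      show "F0 \<in> facets" using F0 by simp
      show "0 \<le> d F * (LINT y|side_measure T F. (\<phi> y)\<^sup>2)" if "F \<in> facets - {F0}" for F
        using that d[of F] by (intro mult_nonneg_nonneg Bochner_Integration.integral_nonneg) auto
    qed
    with le have "d F0 * (LINT y|side_measure T F0. (\<phi> y)\<^sup>2) \<le> (N + D * N + D) * (?A + (\<Sum>i\<in>UNIV. ?B i))" by linarith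
    then show ?thesis using d[OF F0] by (simp add: C_def field_simps)
  qed
  ultimately show ?thesis using that by blast
qed

text \<open>The space \<open>H^1(interior T)\<close>, written by coordinates to avoid a
  classification of the multi-indices of order at most 1.\<close>

definition in_H1 :: "(real^'n \<Rightarrow> real) \<Rightarrow> bool" where
  "in_H1 g \<longleftrightarrow> g \<in> L2_fun vol \<and> (\<forall>i. \<exists>G\<in>L2_fun vol. is_weak_deriv (interior T) (mi_single i 1) g G)"

lemma in_H1_L2: "in_H1 g \<Longrightarrow> g \<in> L2_fun vol"
  by (simp add: in_H1_def)

lemma in_H1_weak_deriv:
  assumes "in_H1 g"
  shows "weak_deriv (interior T) (mi_single i 1) g \<in> L2_fun vol"
    "is_weak_deriv (interior T) (mi_single i 1) g (weak_deriv (interior T) (mi_single i 1) g)"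
proof -
  have "\<exists>G. G \<in> L2_fun vol \<and> is_weak_deriv (interior T) (mi_single i 1) g G"
    using assms by (auto simp: in_H1_def)
  from someI_ex[OF this]
  show "weak_deriv (interior T) (mi_single i 1) g \<in> L2_fun vol"
    "is_weak_deriv (interior T) (mi_single i 1) g (weak_deriv (interior T) (mi_single i 1) g)"
    unfolding weak_deriv_def by auto
qed

lemma H1_density:
  assumes g: "g \<in> L2_fun vol"
  obtains \<psi> where "\<And>m. smooth (\<psi> m)" "(\<lambda>m. LINT x|vol. (\<psi> m x - g x)\<^sup>2) \<longlonglongrightarrow> 0"
    "\<And>i G. G \<in> L2_fun vol \<Longrightarrow> is_weak_deriv (interior T) (mi_single i 1) g G \<Longrightarrow>
       (\<lambda>m. LINT x|vol. (partial_deriv i (\<psi> m) x - G x)\<^sup>2) \<longlonglongrightarrow> 0"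
proof (rule H1_smooth_density[OF open_interior convex_interior[OF convex]
      bounded_subset[OF bounded interior_subset] interior_nonempty g])
  fix \<psi> :: "nat \<Rightarrow> real^'n \<Rightarrow> real"
  assume "\<And>m. smooth (\<psi> m)" "(\<lambda>m. LINT x|vol. (\<psi> m x - g x)\<^sup>2) \<longlonglongrightarrow> 0"
    "\<And>i G. G \<in> L2_fun vol \<Longrightarrow> is_weak_deriv (interior T) (mi_single i 1) g G \<Longrightarrow>
       (\<lambda>m. LINT x|vol. (partial_deriv i (\<psi> m) x - G x)\<^sup>2) \<longlonglongrightarrow> 0"
  then show thesis by (rule that)
qed

text \<open>Merges the two volume limits of \<open>is_trace\<close> into one null sequence, the
  squared \<open>H^1\<close> distance.\<close>

definition H1_dist2 :: "(real^'n \<Rightarrow> real) \<Rightarrow> (real^'n \<Rightarrow> real) \<Rightarrow> real" where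
  "H1_dist2 g \<phi> = (LINT x|vol. (\<phi> x - g x)\<^sup>2)
     + (\<Sum>i\<in>UNIV. LINT x|vol. (partial_deriv i \<phi> x - weak_deriv (interior T) (mi_single i 1) g x)\<^sup>2)"

text \<open>The trace inequality for \<open>\<phi> - \<psi>\<close> and the triangle inequality
  through \<open>g\<close>. Applied within one approximating sequence it yields the Cauchy property
  on the side; applied to two sequences it shows that they have the same limit.\<close>

lemma trace_estimate:
  assumes F: "F facet_of T" and g: "in_H1 g"
  obtains C where "C \<ge> 0" "\<And>\<phi> \<psi>. smooth \<phi> \<Longrightarrow> smooth \<psi> \<Longrightarrow>
     (LINT y|side_measure T F. (\<phi> y - \<psi> y)\<^sup>2) \<le> C * (H1_dist2 g \<phi> + H1_dist2 g \<psi>)"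
proof -
  obtain C where C: "C \<ge> 0" "\<And>\<phi>. smooth \<phi> \<Longrightarrow> (LINT y|side_measure T F. (\<phi> y)\<^sup>2)
    \<le> C * ((LINT x|vol. (\<phi> x)\<^sup>2) + (\<Sum>i\<in>UNIV. LINT x|vol. (partial_deriv i \<phi> x)\<^sup>2))"
    using trace_inequality[OF F] by blast
  have gL: "g \<in> L2_fun vol" using g by (simp add: in_H1_def)
  let ?G = "\<lambda>i. weak_deriv (interior T) (mi_single i 1) g"
  have "(LINT y|side_measure T F. (\<phi> y - \<psi> y)\<^sup>2) \<le> (2 * C) * (H1_dist2 g \<phi> + H1_dist2 g \<psi>)"
    if \<phi>: "smooth \<phi>" and \<psi>: "smooth \<psi>" for \<phi> \<psi>
  proof -
    have d: "partial_deriv i (\<lambda>x. \<phi> x - \<psi> x) x = partial_deriv i \<phi> x - partial_deriv i \<psi> x" for i x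
    proof -
      have "partial_deriv i (\<lambda>x. \<phi> x + (- 1) * \<psi> x) x = partial_deriv i \<phi> x + partial_deriv i (\<lambda>x. (- 1) * \<psi> x) x"
        by (intro partial_deriv_add smooth_differentiable smooth_cmult \<phi> \<psi>)
      also have "partial_deriv i (\<lambda>x. (- 1) * \<psi> x) x = - partial_deriv i \<psi> x"
        by (subst partial_deriv_mult) (auto simp: smooth_differentiable[OF \<psi>] partial_deriv_const)
      finally show ?thesis by simp
    qed
    have "(LINT y|side_measure T F. (\<phi> y - \<psi> y)\<^sup>2)
      \<le> C * ((LINT x|vol. (\<phi> x - \<psi> x)\<^sup>2) + (\<Sum>i\<in>UNIV. LINT x|vol. (partial_deriv i \<phi> x - partial_deriv i \<psi> x)\<^sup>2))"
      using C(2)[OF smooth_diff[OF \<phi> \<psi>]] by (simp add: d)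
    also have "\<dots> \<le> C * ((2 * (LINT x|vol. (\<phi> x - g x)\<^sup>2) + 2 * (LINT x|vol. (\<psi> x - g x)\<^sup>2))
      + (\<Sum>i\<in>UNIV. 2 * (LINT x|vol. (partial_deriv i \<phi> x - ?G i x)\<^sup>2) + 2 * (LINT x|vol. (partial_deriv i \<psi> x - ?G i x)\<^sup>2)))"
      by (intro mult_left_mono add_mono sum_mono integral_square_triangle smooth_L2_vol smooth_partial_deriv \<phi> \<psi> gL
          in_H1_weak_deriv(1) g C(1))
    also have "\<dots> = (2 * C) * (H1_dist2 g \<phi> + H1_dist2 g \<psi>)"
      by (simp add: H1_dist2_def sum.distrib sum_distrib_left[symmetric] algebra_simps)
    finally show ?thesis .
  qed
  then show ?thesis using that[of "2 * C"] C(1) by simp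
qed

lemma is_trace_iff:
  assumes g: "in_H1 g"
  shows "is_trace T F g t \<longleftrightarrow> t \<in> L2_fun (side_measure T F) \<and>
     (\<exists>\<phi>. (\<forall>m. smooth (\<phi> m)) \<and> (\<lambda>m. H1_dist2 g (\<phi> m)) \<longlonglongrightarrow> 0 \<and>
        (\<lambda>m. LINT x|side_measure T F. (\<phi> m x - t x)\<^sup>2) \<longlonglongrightarrow> 0)"
proof -
  let ?G = "\<lambda>i. weak_deriv (interior T) (mi_single i 1) g"
  have grad: "(LINT x|vol. (norm (gradient \<phi> x - weak_gradient (interior T) g x))\<^sup>2)
      = (\<Sum>i\<in>UNIV. LINT x|vol. (partial_deriv i \<phi> x - ?G i x)\<^sup>2)" if \<phi>: "smooth \<phi>" for \<phi>
  proof -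
    have "(LINT x|vol. (norm (gradient \<phi> x - weak_gradient (interior T) g x))\<^sup>2)
        = (LINT x|vol. (\<Sum>i\<in>UNIV. (partial_deriv i \<phi> x - ?G i x)\<^sup>2))"
      by (simp add: norm_square_vec gradient_def weak_gradient_def)
    also have "\<dots> = (\<Sum>i\<in>UNIV. LINT x|vol. (partial_deriv i \<phi> x - ?G i x)\<^sup>2)"
      by (intro Bochner_Integration.integral_sum L2_diff_integrable smooth_L2_vol smooth_partial_deriv \<phi> in_H1_weak_deriv(1) g)
    finally show ?thesis .
  qed
  have "(\<lambda>m. H1_dist2 g (\<phi> m)) \<longlonglongrightarrow> 0 \<longleftrightarrow>
        (\<lambda>m. LINT x|vol. (\<phi> m x - g x)\<^sup>2) \<longlonglongrightarrow> 0 \<and>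
        (\<lambda>m. LINT x|vol. (norm (gradient (\<phi> m) x - weak_gradient (interior T) g x))\<^sup>2) \<longlonglongrightarrow> 0"
    if \<phi>: "\<forall>m. smooth (\<phi> m)" for \<phi>
  proof -
    let ?a = "\<lambda>m. LINT x|vol. (\<phi> m x - g x)\<^sup>2"
    let ?b = "\<lambda>m. LINT x|vol. (norm (gradient (\<phi> m) x - weak_gradient (interior T) g x))\<^sup>2"
    have eq: "H1_dist2 g (\<phi> m) = ?a m + ?b m" for m
      using grad[of "\<phi> m"] \<phi> by (simp add: H1_dist2_def)
    have pos: "?a m \<ge> 0" "?b m \<ge> 0" for m by (auto intro!: Bochner_Integration.integral_nonneg)
    show ?thesis
    proof
      assume L: "(\<lambda>m. H1_dist2 g (\<phi> m)) \<longlonglongrightarrow> 0"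
      have "?a \<longlonglongrightarrow> 0" "?b \<longlonglongrightarrow> 0"
        using pos by (auto intro!: tendsto_sandwich[OF _ _ tendsto_const L] always_eventually simp: eq add_increasing add_increasing2)
      then show "?a \<longlonglongrightarrow> 0 \<and> ?b \<longlonglongrightarrow> 0" by blast
    next
      assume "?a \<longlonglongrightarrow> 0 \<and> ?b \<longlonglongrightarrow> 0"
      then show "(\<lambda>m. H1_dist2 g (\<phi> m)) \<longlonglongrightarrow> 0"
        unfolding eq using tendsto_add[of ?a 0 sequentially ?b 0] by simp
    qed
  qed
  then show ?thesis unfolding is_trace_def by blast
qed

lemma H1_dist2_tendsto_density:
  assumes g: "in_H1 g" and \<psi>: "(\<lambda>m. LINT x|vol. (\<psi> m x - g x)\<^sup>2) \<longlonglongrightarrow> 0"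
    "\<And>i G. G \<in> L2_fun vol \<Longrightarrow> is_weak_deriv (interior T) (mi_single i 1) g G \<Longrightarrow>
       (\<lambda>m. LINT x|vol. (partial_deriv i (\<psi> m) x - G x)\<^sup>2) \<longlonglongrightarrow> 0"
  shows "(\<lambda>m. H1_dist2 g (\<psi> m)) \<longlonglongrightarrow> 0"
proof -
  have "(\<lambda>m. H1_dist2 g (\<psi> m)) \<longlonglongrightarrow> 0 + (\<Sum>i\<in>(UNIV::'n set). 0)"
    unfolding H1_dist2_def by (intro tendsto_add tendsto_sum \<psi> in_H1_weak_deriv g)
  then show ?thesis by simp
qed

text \<open>Justifies the Hilbert choice in \<open>trace\<close>: the restrictions of an
  approximating sequence are Cauchy in \<open>L^2\<close> of the side, which is complete.\<close>

lemma trace_exists: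
  assumes F: "F facet_of T" and g: "in_H1 g"
  shows "is_trace T F g (trace T F g)"
proof -
  obtain \<psi> where \<psi>: "\<And>m. smooth (\<psi> m)" "(\<lambda>m. LINT x|vol. (\<psi> m x - g x)\<^sup>2) \<longlonglongrightarrow> 0"
    "\<And>i G. G \<in> L2_fun vol \<Longrightarrow> is_weak_deriv (interior T) (mi_single i 1) g G \<Longrightarrow>
       (\<lambda>m. LINT x|vol. (partial_deriv i (\<psi> m) x - G x)\<^sup>2) \<longlonglongrightarrow> 0"
    using H1_density[OF in_H1_L2[OF g]] by blast
  note lim = H1_dist2_tendsto_density[OF g \<psi>(2,3)]
  obtain C where C: "C \<ge> 0" "\<And>\<phi> \<psi>. smooth \<phi> \<Longrightarrow> smooth \<psi> \<Longrightarrow>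
     (LINT y|side_measure T F. (\<phi> y - \<psi> y)\<^sup>2) \<le> C * (H1_dist2 g \<phi> + H1_dist2 g \<psi>)"
    using trace_estimate[OF F g] by blast
  have "\<exists>N. \<forall>m\<ge>N. \<forall>n\<ge>N. (LINT x|side_measure T F. (\<psi> m x - \<psi> n x)\<^sup>2) < e" if e: "e > 0" for e
  proof -
    have "(\<lambda>m. C * H1_dist2 g (\<psi> m)) \<longlonglongrightarrow> 0" using tendsto_mult_left[OF lim, of C] by simp
    then have "\<forall>\<^sub>F m in sequentially. C * H1_dist2 g (\<psi> m) < e / 2"
      using e by (intro order_tendstoD) auto
    then obtain N where N: "\<And>m. m \<ge> N \<Longrightarrow> C * H1_dist2 g (\<psi> m) < e / 2" by (auto simp: eventually_sequentially)
    have "(LINT x|side_measure T F. (\<psi> m x - \<psi> n x)\<^sup>2) < e" if "m \<ge> N" "n \<ge> N" for m n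
      using C(2)[OF \<psi>(1) \<psi>(1), of m n] N[OF that(1)] N[OF that(2)] by (simp add: distrib_left)
    then show ?thesis by blast
  qed
  from L2_complete[OF side_measure_finite[OF F] smooth_L2_side[OF F \<psi>(1)] this]
  obtain t where "t \<in> L2_fun (side_measure T F)" "(\<lambda>m. LINT x|side_measure T F. (\<psi> m x - t x)\<^sup>2) \<longlonglongrightarrow> 0"
    by blast
  with \<psi>(1) lim have "is_trace T F g t" unfolding is_trace_iff[OF g] by blast
  then show ?thesis unfolding trace_def by (rule someI[where P = "is_trace T F g"])
qed

text \<open>The chosen trace comes with an approximating sequence of its own;
  \<open>trace_estimate\<close> between that sequence and \<open>\<psi>\<close> transfers the
  limit.\<close>

lemma trace_tendsto:
  assumes F: "F facet_of T" and g: "in_H1 g" and \<psi>: "\<And>m. smooth (\<psi> m)" "(\<lambda>m. H1_dist2 g (\<psi> m)) \<longlonglongrightarrow> 0"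
  shows "(\<lambda>m. LINT x|side_measure T F. (\<psi> m x - trace T F g x)\<^sup>2) \<longlonglongrightarrow> 0"
proof -
  obtain \<phi> where tL: "trace T F g \<in> L2_fun (side_measure T F)" and \<phi>: "\<And>m. smooth (\<phi> m)"
    "(\<lambda>m. H1_dist2 g (\<phi> m)) \<longlonglongrightarrow> 0" "(\<lambda>m. LINT x|side_measure T F. (\<phi> m x - trace T F g x)\<^sup>2) \<longlonglongrightarrow> 0"
    using trace_exists[OF F g] unfolding is_trace_iff[OF g] by blast
  obtain C where C: "C \<ge> 0" "\<And>\<phi> \<psi>. smooth \<phi> \<Longrightarrow> smooth \<psi> \<Longrightarrow>
     (LINT y|side_measure T F. (\<phi> y - \<psi> y)\<^sup>2) \<le> C * (H1_dist2 g \<phi> + H1_dist2 g \<psi>)"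
    using trace_estimate[OF F g] by blast
  show ?thesis
  proof (rule tendsto_sandwich[OF _ _ tendsto_const])
    show "(\<lambda>m. 2 * (C * (H1_dist2 g (\<psi> m) + H1_dist2 g (\<phi> m)))
        + 2 * (LINT x|side_measure T F. (\<phi> m x - trace T F g x)\<^sup>2)) \<longlonglongrightarrow> 0"
      by (auto intro!: tendsto_eq_intros \<psi> \<phi>)
    have "(LINT x|side_measure T F. (\<psi> m x - trace T F g x)\<^sup>2) \<le> 2 * (C * (H1_dist2 g (\<psi> m) + H1_dist2 g (\<phi> m)))
        + 2 * (LINT x|side_measure T F. (\<phi> m x - trace T F g x)\<^sup>2)" for m
      using integral_square_triangle[OF smooth_L2_side[OF F \<psi>(1)[of m]] smooth_L2_side[OF F \<phi>(1)[of m]] tL] C(2)[OF \<psi>(1) \<phi>(1), of m m]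
      by (simp add: power2_commute[of "trace T F g _" "\<phi> m _"])
    then show "\<forall>\<^sub>F m in sequentially. (LINT x|side_measure T F. (\<psi> m x - trace T F g x)\<^sup>2) \<le> 2 * (C * (H1_dist2 g (\<psi> m) + H1_dist2 g (\<phi> m)))
        + 2 * (LINT x|side_measure T F. (\<phi> m x - trace T F g x)\<^sup>2)" by (intro always_eventually allI)
  qed (auto intro!: always_eventually Bochner_Integration.integral_nonneg)
qed

lemma trace_L2: "F facet_of T \<Longrightarrow> in_H1 g \<Longrightarrow> trace T F g \<in> L2_fun (side_measure T F)"
  using trace_exists unfolding is_trace_def by blast

text \<open>Passage to the limit in the divergence theorem for \<open>\<psi> m * p\<close>. The
  traces are tied to the derivatives chosen on \<open>interior T\<close>, whereas \<open>G\<close>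
  will be the restriction of one chosen on \<open>\<Omega>\<close>; the density sequence converges
  to both.\<close>

theorem Green:
  assumes g: "in_H1 g" and G: "G \<in> L2_fun vol" "is_weak_deriv (interior T) (mi_single i 1) g G" and p: "smooth p"
  shows "(LINT x|vol. g x * partial_deriv i p x) + (LINT x|vol. G x * p x)
    = (\<Sum>F\<in>facets. normal F $ i * (LINT y|side_measure T F. trace T F g y * p y))"
proof -
  obtain \<psi> where \<psi>: "\<And>m. smooth (\<psi> m)" "(\<lambda>m. LINT x|vol. (\<psi> m x - g x)\<^sup>2) \<longlonglongrightarrow> 0"
    "\<And>i G. G \<in> L2_fun vol \<Longrightarrow> is_weak_deriv (interior T) (mi_single i 1) g G \<Longrightarrow>
       (\<lambda>m. LINT x|vol. (partial_deriv i (\<psi> m) x - G x)\<^sup>2) \<longlonglongrightarrow> 0"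
    using H1_density[OF in_H1_L2[OF g]] by blast
  note lim = H1_dist2_tendsto_density[OF g \<psi>(2,3)]
  have gL: "g \<in> L2_fun vol" using g by (simp add: in_H1_def)
  note d\<psi> = smooth_partial_deriv[OF \<psi>(1)] and dp = smooth_partial_deriv[OF p]
  have lim1: "(\<lambda>m. (LINT x|vol. \<psi> m x * partial_deriv i p x) + (LINT x|vol. partial_deriv i (\<psi> m) x * p x))
    \<longlonglongrightarrow> (LINT x|vol. g x * partial_deriv i p x) + (LINT x|vol. G x * p x)"
    by (intro tendsto_add L2_convergence_mult smooth_L2_vol \<psi> d\<psi> dp p G gL)
  have "(LINT x|vol. \<psi> m x * partial_deriv i p x) + (LINT x|vol. partial_deriv i (\<psi> m) x * p x)
    = (\<Sum>F\<in>facets. normal F $ i * (LINT y|side_measure T F. \<psi> m y * p y))" for m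
  proof -
    have "(LINT x|vol. \<psi> m x * partial_deriv i p x) + (LINT x|vol. partial_deriv i (\<psi> m) x * p x)
      = (LINT x|vol. \<psi> m x * partial_deriv i p x + partial_deriv i (\<psi> m) x * p x)"
      by (intro Bochner_Integration.integral_add[symmetric] L2_mult_integrable smooth_L2_vol \<psi> d\<psi> dp p)
    also have "\<dots> = (LINT x|vol. partial_deriv i (\<lambda>x. \<psi> m x * p x) x)"
      by (simp add: partial_deriv_mult smooth_differentiable[OF \<psi>(1)] smooth_differentiable[OF p])
    also have "\<dots> = (\<Sum>F\<in>facets. normal F $ i * (LINT y|side_measure T F. \<psi> m y * p y))"
      by (rule divergence_vol[OF smooth_mult[OF \<psi>(1) p]])
    finally show ?thesis .
  qed
  moreover have "(\<lambda>m. \<Sum>F\<in>facets. normal F $ i * (LINT y|side_measure T F. \<psi> m y * p y))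
     \<longlonglongrightarrow> (\<Sum>F\<in>facets. normal F $ i * (LINT y|side_measure T F. trace T F g y * p y))"
  proof (intro tendsto_sum tendsto_mult tendsto_const)
    fix F assume "F \<in> facets"
    then have F: "F facet_of T" by simp
    show "(\<lambda>m. LINT y|side_measure T F. \<psi> m y * p y) \<longlonglongrightarrow> (LINT y|side_measure T F. trace T F g y * p y)"
      by (intro L2_convergence_mult smooth_L2_side[OF F] \<psi> p trace_L2[OF F g] trace_tendsto[OF F g] lim)
  qed
  ultimately have "(\<lambda>m. (LINT x|vol. \<psi> m x * partial_deriv i p x) + (LINT x|vol. partial_deriv i (\<psi> m) x * p x))
     \<longlonglongrightarrow> (\<Sum>F\<in>facets. normal F $ i * (LINT y|side_measure T F. trace T F g y * p y))"
    by simp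
  with lim1 show ?thesis by (rule LIMSEQ_unique)
qed

end

section \<open>Cancellation across shared facets\<close>

text \<open>The indicator of the points at distance at least \<open>2 / r\<close> from the
  complement is mollified at scale \<open>1 / r\<close>. The result is supported at distance at
  least \<open>1 / r\<close> from the complement and equals 1 at distance more than
  \<open>3 / r\<close>, for \<open>r = Suc m\<close>.\<close>

lemma exhausting_test_funs:
  fixes U :: "(real^'n::finite) set"
  assumes U: "open U" "bounded U"
  obtains \<eta> :: "nat \<Rightarrow> real^'n \<Rightarrow> real" where "\<And>m. test_fun U (\<eta> m)" "\<And>m x. 0 \<le> \<eta> m x" "\<And>m x. \<eta> m x \<le> 1"
    "\<And>x. x \<in> U \<Longrightarrow> (\<lambda>m. \<eta> m x) \<longlonglongrightarrow> 1"
proof -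
  have ne: "- U \<noteq> {}" using U(2) not_bounded_UNIV by (metis Compl_empty_eq double_complement)
  have closed: "closed (- U)" using U(1) by auto
  obtain \<rho> :: "real^'n \<Rightarrow> real" where \<rho>: "smooth \<rho>" "\<And>x. \<rho> x \<ge> 0" "\<And>x. norm x > 1 \<Longrightarrow> \<rho> x = 0"
    "closure {x. \<rho> x \<noteq> 0} \<subseteq> cball 0 1" "integrable lborel \<rho>" "integral\<^sup>L lborel \<rho> = 1"
    by (rule exists_bump, rule that) auto
  have \<rho>_supp: "compact (closure {x. \<rho> x \<noteq> 0})"
    using \<rho>(4) by (meson bounded_cball bounded_subset closed_closure compact_eq_bounded_closed)
  have \<rho>_meas[measurable]: "\<rho> \<in> borel_measurable borel" by (rule smooth_borel_measurable[OF \<rho>(1)])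
  define A where "A = (\<lambda>s. {x. s \<le> infdist x (- U)})"
  have A_closed: "closed (A s)" for s
    unfolding A_def by (intro closed_Collect_le continuous_intros)
  have A_U: "A s \<subseteq> U" if "s > 0" for s
    using that by (auto simp: A_def intro: ccontr)
  define r where "r = (\<lambda>m. real (Suc m))"
  have r: "r m > 0" for m by (simp add: r_def)
  define K where "K = (\<lambda>m. A (2 / r m))"
  have K_U: "K m \<subseteq> U" for m unfolding K_def using r by (intro A_U) auto
  have K_borel[measurable]: "K m \<in> sets borel" for m unfolding K_def using A_closed by auto
  have K_int: "integrable lborel (indicator (K m) :: real^'n \<Rightarrow> real)" for m
    using emeasure_bounded_finite[OF bounded_subset[OF U(2) K_U]] by (intro integrable_real_indicator) auto
  define \<eta> where "\<eta> = (\<lambda>m x. r m ^ CARD('n) * (LINT y|lborel. \<rho> (r m *\<^sub>R (1 *\<^sub>R x + (-1) *\<^sub>R y)) * indicator (K m) y))"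
  have smooth: "smooth (\<eta> m)" for m
    unfolding \<eta>_def
    using smooth_compact_support_scale[OF \<rho>(1) \<rho>_supp, of "r m"] r[of m] K_int
    by (intro smooth_cmult convolution_smooth[where K = "\<lambda>z. \<rho> (r m *\<^sub>R z)"]) auto
  have eq: "\<eta> m x = (LINT z|lborel. \<rho> z * indicator (K m) (x - (1 / r m) *\<^sub>R z))" for m x
  proof -
    let ?f = "\<lambda>y. \<rho> (r m *\<^sub>R (1 *\<^sub>R x + (-1) *\<^sub>R y)) * indicator (K m) y :: real"
    have f_meas: "?f \<in> borel_measurable borel" by measurable
    have f_eq: "?f (x + (- (1 / r m)) *\<^sub>R z) = \<rho> z * indicator (K m) (x - (1 / r m) *\<^sub>R z)" for z
      using r[of m] by simp
    have "(LINT z|lborel. \<rho> z * indicator (K m) (x - (1 / r m) *\<^sub>R z)) = (LINT z|lborel. ?f (x + (- (1 / r m)) *\<^sub>R z))"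
      by (simp only: f_eq)
    also have "\<dots> = (LINT y|lborel. ?f y) / \<bar>- (1 / r m)\<bar> ^ CARD('n)"
      using lborel_affine_integral[OF _ f_meas, of "- (1 / r m)" x] r[of m] by simp
    also have "\<dots> = \<eta> m x" using r[of m] by (simp add: \<eta>_def power_one_over)
    finally show ?thesis by simp
  qed
  have int: "integrable lborel (\<lambda>z. \<rho> z * indicator (K m) (x - (1 / r m) *\<^sub>R z))" for m x
    by (rule Bochner_Integration.integrable_bound[OF \<rho>(5)]) (auto simp: indicator_def)
  have ge0: "0 \<le> \<eta> m x" for m x
    unfolding eq using \<rho>(2) by (intro Bochner_Integration.integral_nonneg) auto
  have le1: "\<eta> m x \<le> 1" for m x
  proof -
    have "\<eta> m x \<le> (LINT z|lborel. \<rho> z)"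
      unfolding eq using \<rho>(2) by (intro integral_mono int \<rho>(5)) (auto simp: indicator_def)
    then show ?thesis using \<rho>(6) by simp
  qed
  have supp: "x \<in> A (1 / r m)" if nz: "\<eta> m x \<noteq> 0" for m x
  proof -
    have "\<exists>z. \<rho> z * indicator (K m) (x - (1 / r m) *\<^sub>R z) \<noteq> (0::real)"
    proof (rule ccontr)
      assume "\<nexists>z. \<rho> z * indicator (K m) (x - (1 / r m) *\<^sub>R z) \<noteq> (0::real)"
      then have "\<eta> m x = (LINT z|(lborel :: (real^'n) measure). 0)" unfolding eq by (intro Bochner_Integration.integral_cong) auto
      then show False using nz by simp
    qed
    then obtain z where z: "\<rho> z \<noteq> 0" "x - (1 / r m) *\<^sub>R z \<in> K m" by (auto simp: indicator_def split: if_splits)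
    have "norm z \<le> 1" using \<rho>(3) z(1) not_le by blast
    then have "dist x (x - (1 / r m) *\<^sub>R z) \<le> 1 / r m" using r[of m] by (simp add: dist_norm divide_right_mono)
    moreover have "2 / r m \<le> infdist (x - (1 / r m) *\<^sub>R z) (- U)" using z(2) by (simp add: K_def A_def)
    moreover have "infdist (x - (1 / r m) *\<^sub>R z) (- U) \<le> infdist x (- U) + dist (x - (1 / r m) *\<^sub>R z) x"
      by (rule infdist_triangle)
    ultimately have "1 / r m \<le> infdist x (- U)" by (simp add: dist_commute add_divide_distrib[of 1 1 "r m", simplified])
    then show ?thesis by (simp add: A_def)
  qed
  have test: "test_fun U (\<eta> m)" for m
  proof -
    have sub: "closure {x. \<eta> m x \<noteq> 0} \<subseteq> A (1 / r m)"
      by (rule closure_minimal) (use supp A_closed in auto)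
    then have "closure {x. \<eta> m x \<noteq> 0} \<subseteq> U" using A_U[of "1 / r m"] r[of m] by auto
    then show ?thesis
      using smooth bounded_subset[OF U(2)] unfolding test_fun_def by (auto simp: compact_eq_bounded_closed)
  qed
  have lim: "(\<lambda>m. \<eta> m x) \<longlonglongrightarrow> 1" if x: "x \<in> U" for x
  proof (rule tendsto_eventually)
    define d where "d = infdist x (- U)"
    have "d > 0" using x ne closed unfolding d_def by (simp add: infdist_pos_not_in_closed)
    obtain m0 where m0: "3 / d < real m0" using reals_Archimedean2 by blast
    have "\<eta> m x = 1" if m: "m \<ge> m0" for m
    proof -
      have "3 / d < r m" using m0 m by (simp add: r_def)
      then have d3: "3 / r m < d" using \<open>d > 0\<close> r[of m] by (simp add: field_simps)
      have eqz: "\<rho> z * indicator (K m) (x - (1 / r m) *\<^sub>R z) = \<rho> z" for z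
      proof (cases "\<rho> z = 0")
        case False
        then have "norm z \<le> 1" using \<rho>(3) not_le by blast
        then have "dist x (x - (1 / r m) *\<^sub>R z) \<le> 1 / r m" using r[of m] by (simp add: dist_norm divide_right_mono)
        moreover have "d \<le> infdist (x - (1 / r m) *\<^sub>R z) (- U) + dist x (x - (1 / r m) *\<^sub>R z)"
          unfolding d_def by (rule infdist_triangle)
        moreover have "3 / r m = 2 / r m + 1 / r m" by (simp add: add_divide_distrib[symmetric])
        ultimately have "2 / r m \<le> infdist (x - (1 / r m) *\<^sub>R z) (- U)" using d3 by linarith
        then show ?thesis by (simp add: K_def A_def)
      qed auto
      show ?thesis unfolding eq by (simp only: eqz \<rho>(6))
    qed
    then show "\<forall>\<^sub>F m in sequentially. \<eta> m x = 1" by (auto simp: eventually_sequentially)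
  qed
  show ?thesis by (rule that[OF test ge0 le1 lim])
qed

section \<open>Weak derivatives on subdomains, iterated weak derivatives, matching of traces\<close>

lemma test_fun_foldr_partial_deriv: "test_fun C \<phi> \<Longrightarrow> test_fun C (foldr partial_deriv js \<phi>)"
  by (induction js) (auto intro: test_fun_partial_deriv)

lemma test_fun_mi_deriv: "test_fun C \<phi> \<Longrightarrow> test_fun C (mi_deriv \<alpha> \<phi>)"
  unfolding mi_deriv_def by (rule test_fun_foldr_partial_deriv)

lemma test_fun_outside: "test_fun C \<phi> \<Longrightarrow> x \<notin> C \<Longrightarrow> \<phi> x = 0"
  unfolding test_fun_def using closure_subset[of "{x. \<phi> x \<noteq> 0}"] by blast

lemma test_fun_L2:
  assumes \<phi>: "test_fun C \<phi>" and C: "open C" "bounded C"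
  shows "\<phi> \<in> L2_fun (lebesgue_on C)"
proof -
  obtain B where B: "\<And>x. \<bar>\<phi> x\<bar> \<le> B"
    using bounded_continuous_compact_support[of \<phi>] \<phi> unfolding test_fun_def by (metis smooth_continuous_on)
  have "\<phi> \<in> borel_measurable borel" using \<phi> by (simp add: test_fun_def smooth_borel_measurable)
  then have "\<phi> \<in> borel_measurable (lebesgue_on C)"
    by (intro measurable_restrict_space1 measurable_completion) simp
  moreover have "finite_measure (lebesgue_on C)"
  proof
    show "emeasure (lebesgue_on C) (space (lebesgue_on C)) \<noteq> \<infinity>"
      using emeasure_bounded_finite[OF C(2)] C(1) by (simp add: emeasure_restrict_space space_restrict_space)
  qed
  ultimately show ?thesis using B by (intro bounded_L2) auto
qed

lemma integral_lebesgue_on_superset: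
  fixes f :: "'a::euclidean_space \<Rightarrow> real"
  assumes "C \<subseteq> S" "C \<in> sets lebesgue" "S \<in> sets lebesgue" "\<And>x. x \<notin> C \<Longrightarrow> f x = 0"
  shows "(LINT x|lebesgue_on C. f x) = (LINT x|lebesgue_on S. f x)"
proof -
  have eq: "indicator C x *\<^sub>R f x = indicator S x *\<^sub>R f x" for x
    by (cases "x \<in> C") (use assms(1,4) in \<open>auto simp: indicator_def\<close>)
  have "(LINT x|lebesgue_on C. f x) = (LINT x|lebesgue. indicator C x *\<^sub>R f x)"
    using assms by (intro integral_restrict_space) auto
  also have "\<dots> = (LINT x|lebesgue. indicator S x *\<^sub>R f x)" by (simp only: eq)
  also have "\<dots> = (LINT x|lebesgue_on S. f x)"
    using assms by (intro integral_restrict_space[symmetric]) auto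
  finally show ?thesis .
qed

lemma is_weak_deriv_subset:
  assumes "is_weak_deriv \<Omega> \<alpha> v g" "open C" "open \<Omega>" "C \<subseteq> \<Omega>"
  shows "is_weak_deriv C \<alpha> v g"
  unfolding is_weak_deriv_def
proof (intro allI impI)
  fix \<phi> assume \<phi>: "test_fun C \<phi>"
  have "(LINT x|lebesgue_on C. v x * mi_deriv \<alpha> \<phi> x) = (LINT x|lebesgue_on \<Omega>. v x * mi_deriv \<alpha> \<phi> x)"
    using assms test_fun_outside[OF test_fun_mi_deriv[OF \<phi>]] by (intro integral_lebesgue_on_superset) auto
  moreover have "(LINT x|lebesgue_on C. g x * \<phi> x) = (LINT x|lebesgue_on \<Omega>. g x * \<phi> x)"
    using assms test_fun_outside[OF \<phi>] by (intro integral_lebesgue_on_superset) auto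
  ultimately show "(LINT x|lebesgue_on C. v x * mi_deriv \<alpha> \<phi> x) = (- 1) ^ mi_order \<alpha> * (LINT x|lebesgue_on C. g x * \<phi> x)"
    using assms(1) test_fun_mono[OF \<phi> assms(4)] by (simp add: is_weak_deriv_def)
qed

lemma L2_subset:
  fixes g :: "'a::euclidean_space \<Rightarrow> real"
  assumes g: "g \<in> L2_fun (lebesgue_on \<Omega>)" and "open C" "open \<Omega>" "C \<subseteq> \<Omega>"
  shows "g \<in> L2_fun (lebesgue_on C)"
proof -
  have eq: "lebesgue_on C = restrict_space (lebesgue_on \<Omega>) C"
    using assms(4) by (simp add: restrict_restrict_space assms Int_absorb1)
  have C: "C \<inter> space (lebesgue_on \<Omega>) \<in> sets (lebesgue_on \<Omega>)"
    using assms by (auto simp: sets_restrict_space_iff space_restrict_space Int_absorb2)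
  have "integrable (lebesgue_on \<Omega>) (\<lambda>x. indicator C x *\<^sub>R (g x)\<^sup>2)"
    using g C by (intro integrable_mult_indicator) (auto simp: L2_fun_def space_restrict_space Int_absorb2 assms)
  then show ?thesis
    using g C unfolding L2_fun_def eq
    by (auto simp: integrable_restrict_space intro: measurable_restrict_space1)
qed

lemma concat_map_if_filter: "concat (map (\<lambda>l. if P l then [l] else []) xs) = filter P xs"
  by (induction xs) auto

text \<open>The enumeration behind \<open>mi_deriv\<close> may list \<open>i\<close> and
  \<open>j\<close> in either order, so the symmetry of second derivatives is needed. For
  \<open>i = j\<close> the index has a single entry 2.\<close>

lemma mi_deriv_pair:
  assumes \<phi>: "smooth \<phi>"
  shows "mi_deriv (\<lambda>l. mi_single i 1 l + mi_single j 1 l) \<phi> = partial_deriv i (partial_deriv j \<phi>)"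
proof (cases "i = j")
  case True
  then have "(\<lambda>l. mi_single i 1 l + mi_single j 1 l) = mi_single i 2" by (auto simp: mi_single_def)
  then show ?thesis using True by (simp add: mi_deriv_single numeral_2_eq_2)
next
  case False
  let ?L = "filter (\<lambda>l. l = i \<or> l = j) coord_list"
  have "(\<lambda>l. replicate (mi_single i 1 l + mi_single j 1 l) l) = (\<lambda>l. if l = i \<or> l = j then [l] else [])"
    using False by (auto simp: mi_single_def)
  then have eq: "mi_deriv (\<lambda>l. mi_single i 1 l + mi_single j 1 l) \<phi> = foldr partial_deriv ?L \<phi>"
    by (simp add: mi_deriv_def concat_map_if_filter)
  have L: "distinct ?L" "set ?L = {i, j}" by (auto simp: coord_list)
  then have "length ?L = 2" using distinct_card[OF L(1)] False by simp
  then obtain a b where ab: "?L = [a, b]" by (auto simp: length_Suc_conv numeral_2_eq_2)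
  then have "(a = i \<and> b = j) \<or> (a = j \<and> b = i)" using L by auto
  then show ?thesis
    unfolding eq ab using partial_deriv_commute[OF \<phi>, of i j] by auto
qed

lemma mi_order_pair: "mi_order (\<lambda>l. mi_single i 1 l + mi_single j 1 l) = 2"
  using mi_order_single[of i 1] mi_order_single[of j 1] by (simp add: mi_order_def sum.distrib)

text \<open>Test the first-order relation with \<open>partial_deriv j \<phi>\<close>, which is again
  a test function. This is how second weak derivatives of \<open>u\<close> put the components of
  \<open>\<nabla>u\<close> into \<open>H^1\<close> of each element.\<close>

lemma weak_deriv_of_weak_deriv:
  assumes g: "is_weak_deriv \<Omega> (mi_single i 1) u g"
    and h: "is_weak_deriv \<Omega> (\<lambda>l. mi_single i 1 l + mi_single j 1 l) u h"
  shows "is_weak_deriv \<Omega> (mi_single j 1) g h"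
  unfolding is_weak_deriv_single
proof (intro allI impI)
  fix \<phi> assume \<phi>: "test_fun \<Omega> \<phi>"
  then have "smooth \<phi>" by (simp add: test_fun_def)
  have "(LINT x|lebesgue_on \<Omega>. g x * partial_deriv j \<phi> x) = - (LINT x|lebesgue_on \<Omega>. u x * partial_deriv i (partial_deriv j \<phi>) x)"
    using g[unfolded is_weak_deriv_single] test_fun_partial_deriv[OF \<phi>, of j] by simp
  also have "\<dots> = - (LINT x|lebesgue_on \<Omega>. h x * \<phi> x)"
    using h[unfolded is_weak_deriv_def, rule_format, OF \<phi>, unfolded mi_deriv_pair[OF \<open>smooth \<phi>\<close>] mi_order_pair]
    by simp
  finally show "(LINT x|lebesgue_on \<Omega>. g x * partial_deriv j \<phi> x) = - (LINT x|lebesgue_on \<Omega>. h x * \<phi> x)" .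
qed

lemma sobolev_H_weak_deriv:
  assumes "u \<in> sobolev_H m \<Omega>" "mi_order \<alpha> \<le> m"
  shows "weak_deriv \<Omega> \<alpha> u \<in> L2_fun (lebesgue_on \<Omega>)" "is_weak_deriv \<Omega> \<alpha> u (weak_deriv \<Omega> \<alpha> u)"
proof -
  have "\<exists>g. g \<in> L2_fun (lebesgue_on \<Omega>) \<and> is_weak_deriv \<Omega> \<alpha> u g"
    using assms by (auto simp: sobolev_H_def)
  from someI_ex[OF this] show "weak_deriv \<Omega> \<alpha> u \<in> L2_fun (lebesgue_on \<Omega>)" "is_weak_deriv \<Omega> \<alpha> u (weak_deriv \<Omega> \<alpha> u)"
    unfolding weak_deriv_def by auto
qed

text \<open>Green's formula on both elements with the weight \<open>p * \<eta> m\<close>, supported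
  where a point is beside \<open>F\<close> for both: only the boundary terms of \<open>F\<close>
  survive. The two volume integrals add up to one over \<open>U\<close>, which is 0 because
  \<open>G\<close> is a weak derivative across \<open>F\<close>. As \<open>m\<close> grows,
  \<open>\<eta> m\<close> tends to 1 on \<open>U\<close>, which contains almost every point of
  \<open>F\<close>.\<close>

lemma trace_cancel_shared_facet:
  fixes T T' \<Omega> :: "(real^'n::finite) set"
  assumes T: "solid_polytope T" and T': "solid_polytope T'"
    and F: "F facet_of T" "F facet_of T'" and int: "T \<inter> T' = F"
    and opposite: "outer_normal T' F = - outer_normal T F" "solid_polytope.offset T' F = - solid_polytope.offset T F"
    and \<Omega>: "open \<Omega>" "interior (T \<union> T') \<subseteq> \<Omega>"
    and g: "solid_polytope.in_H1 T g" "solid_polytope.in_H1 T' g" and gL: "g \<in> L2_fun (lebesgue_on \<Omega>)"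
    and G: "is_weak_deriv \<Omega> (mi_single i 1) g G" "G \<in> L2_fun (lebesgue_on \<Omega>)"
    and p: "smooth p"
  shows "outer_normal T F $ i * (LINT y|side_measure T F. trace T F g y * p y)
    + outer_normal T' F $ i * (LINT y|side_measure T' F. trace T' F g y * p y) = 0"
proof -
  interpret T: solid_polytope T by fact
  interpret T': solid_polytope T' by fact
  define U where "U = T.beside F \<inter> T'.beside F"
  have U_open: "open U" unfolding U_def by (intro open_Int T.open_beside T'.open_beside)
  \<comment> \<open>The only inequality left open is that of \<open>F\<close>, and the two elements
    have it with opposite signs; one of them holds.\<close>
  have U_sub: "U \<subseteq> T \<union> T'"
  proof
    fix x assume "x \<in> U"
    then show "x \<in> T \<union> T'"
      using T.beside_in_polytope[OF F(1), of x] T'.beside_in_polytope[OF F(2), of x]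
      by (cases "T.normal F \<bullet> x \<le> T.offset F") (auto simp: U_def opposite)
  qed
  have U_bounded: "bounded U"
    using U_sub T.bounded T'.bounded by (meson bounded_Un bounded_subset)
  have U_\<Omega>: "U \<subseteq> \<Omega>" using interior_maximal[OF U_sub U_open] \<Omega>(2) by blast
  have int_sub: "interior T \<subseteq> \<Omega>" "interior T' \<subseteq> \<Omega>"
    using interior_mono[of T "T \<union> T'"] interior_mono[of T' "T \<union> T'"] \<Omega>(2) by auto
  obtain \<eta> :: "nat \<Rightarrow> real^'n \<Rightarrow> real" where \<eta>: "\<And>m. test_fun U (\<eta> m)" "\<And>m x. 0 \<le> \<eta> m x" "\<And>m x. \<eta> m x \<le> 1"
    "\<And>x. x \<in> U \<Longrightarrow> (\<lambda>m. \<eta> m x) \<longlonglongrightarrow> 1"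
    using exhausting_test_funs[OF U_open U_bounded] by blast
  let ?I = "\<lambda>T q. LINT y|side_measure T F. trace T F g y * q y"
  have zero: "T.normal F $ i * ?I T (\<lambda>x. p x * \<eta> m x) + T'.normal F $ i * ?I T' (\<lambda>x. p x * \<eta> m x) = 0" for m
  proof -
    let ?q = "\<lambda>x. p x * \<eta> m x"
    have q: "test_fun U ?q" by (rule test_fun_mult[OF \<eta>(1) p])
    have q_smooth: "smooth ?q" using q by (simp add: test_fun_def)
    have Green: "(LINT x|lebesgue_on (interior S). g x * partial_deriv i ?q x + G x * ?q x) = outer_normal S F $ i * ?I S ?q"
      and integrable: "integrable (lebesgue_on (interior S)) (\<lambda>x. g x * partial_deriv i ?q x + G x * ?q x)"
      if S: "solid_polytope S" "solid_polytope.in_H1 S g" "F facet_of S" "interior S \<subseteq> \<Omega>" "U \<subseteq> solid_polytope.beside S F" for S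
    proof -
      interpret S: solid_polytope S by fact
      have GS: "is_weak_deriv (interior S) (mi_single i 1) g G" "G \<in> L2_fun S.vol"
        using is_weak_deriv_subset[OF G(1) open_interior \<Omega>(1) S(4)] L2_subset[OF G(2) open_interior \<Omega>(1) S(4)] by auto
      have i1: "integrable S.vol (\<lambda>x. g x * partial_deriv i ?q x)" "integrable S.vol (\<lambda>x. G x * ?q x)"
        by (intro L2_mult_integrable S.in_H1_L2 S GS S.smooth_L2_vol smooth_partial_deriv q_smooth)+
      then show "integrable (lebesgue_on (interior S)) (\<lambda>x. g x * partial_deriv i ?q x + G x * ?q x)" by simp
      have "(LINT x|S.vol. g x * partial_deriv i ?q x + G x * ?q x)
          = (\<Sum>F'\<in>S.facets. S.normal F' $ i * (LINT y|side_measure S F'. trace S F' g y * ?q y))"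
        using S.Green[OF S(2) GS(2,1) q_smooth] i1 by simp
      \<comment> \<open>The other facets do not meet \<open>beside F\<close>, so the weight vanishes
        on them.\<close>
      also have "\<dots> = (\<Sum>F'\<in>S.facets. if F' = F then S.normal F $ i * ?I S ?q else 0)"
      proof (rule sum.cong[OF refl])
        fix F' assume "F' \<in> S.facets"
        then have F': "F' facet_of S" by simp
        show "S.normal F' $ i * (LINT y|side_measure S F'. trace S F' g y * ?q y) = (if F' = F then S.normal F $ i * ?I S ?q else 0)"
        proof (cases "F' = F")
          case False
          have "AE y in side_measure S F'. trace S F' g y * ?q y = 0"
            using S.AE_side_measure_in_facet[OF F']
          proof eventually_elim
            case (elim y)
            then have "y \<notin> U" using S.other_facet_disjoint_beside[of F' F] F' False S(5) by auto
            then show ?case using test_fun_outside[OF \<eta>(1)] by simp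
          qed
          from integral_cong_AE_complete[OF S.side_measure_complete this] False show ?thesis by simp
        qed auto
      qed
      also have "\<dots> = S.normal F $ i * ?I S ?q"
        using S.finite_facets S(3) by simp
      finally show "(LINT x|lebesgue_on (interior S). g x * partial_deriv i ?q x + G x * ?q x) = outer_normal S F $ i * ?I S ?q" .
    qed
    note GT = Green[OF T g(1) F(1) int_sub(1)] integrable[OF T g(1) F(1) int_sub(1)]
    note GT' = Green[OF T' g(2) F(2) int_sub(2)] integrable[OF T' g(2) F(2) int_sub(2)]
    let ?f = "\<lambda>x. g x * partial_deriv i ?q x + G x * ?q x"
    have f0: "?f x = 0" if "x \<notin> U" for x
      using test_fun_outside[OF q that] test_fun_outside[OF test_fun_partial_deriv[OF q] that] by simp
    have "T.normal F $ i * ?I T ?q + T'.normal F $ i * ?I T' ?q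
        = (LINT x|lebesgue_on (interior T). ?f x) + (LINT x|lebesgue_on (interior T'). ?f x)"
      using GT GT' by (simp add: U_def)
    also have "\<dots> = (LINT x|lebesgue. indicator (interior T) x * ?f x) + (LINT x|lebesgue. indicator (interior T') x * ?f x)"
      by (simp add: integral_restrict_space)
    also have "\<dots> = (LINT x|lebesgue. indicator (interior T) x * ?f x + indicator (interior T') x * ?f x)"
      using GT(2) GT'(2) by (intro Bochner_Integration.integral_add[symmetric]) (auto simp: integrable_restrict_space U_def)
    \<comment> \<open>Off the hyperplane of \<open>F\<close> each point of \<open>U\<close> is
      interior to exactly one of the two elements, and off \<open>U\<close> the integrand is
      0.\<close>
    also have "\<dots> = (LINT x|lebesgue. indicator \<Omega> x * ?f x)"
    proof (rule integral_cong_AE_complete)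
      show "complete_measure (lebesgue :: (real^'n) measure)" by (rule completion.complete_measure_axioms)
      have "AE x in lebesgue. T.normal F \<bullet> x \<noteq> T.offset F"
        by (rule AE_completion[OF AE_not_in_hyperplane[OF T.normal_nonzero[OF F(1)]]])
      then show "AE x in lebesgue. indicator (interior T) x * ?f x + indicator (interior T') x * ?f x = indicator \<Omega> x * ?f x"
      proof eventually_elim
        case (elim x)
        show ?case
        proof (cases "x \<in> U")
          case True
          have "(x \<in> interior T) \<noteq> (x \<in> interior T')"
          proof (cases "T.normal F \<bullet> x < T.offset F")
            case less: True
            then have "x \<in> interior T" using True T.beside_in_interior[OF F(1)] by (simp add: U_def)
            moreover have "x \<notin> T'" using T'.in_polytope_le[OF _ F(2), of x] less by (auto simp: opposite)
            ultimately show ?thesis using interior_subset by blast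
          next
            case False
            then have greater: "T.normal F \<bullet> x > T.offset F" using elim by auto
            then have "x \<in> interior T'" using True T'.beside_in_interior[OF F(2), of x] by (simp add: U_def opposite)
            moreover have "x \<notin> T" using T.in_polytope_le[OF _ F(1), of x] greater by auto
            ultimately show ?thesis using interior_subset by blast
          qed
          moreover have "x \<in> \<Omega>" using True U_\<Omega> by blast
          ultimately show ?thesis by (auto simp: indicator_def)
        qed (simp add: f0)
      qed
    qed
    also have "\<dots> = (LINT x|lebesgue_on \<Omega>. ?f x)"
      using \<Omega>(1) by (simp add: integral_restrict_space)
    also have "\<dots> = (LINT x|lebesgue_on U. ?f x)"
      using U_\<Omega> U_open \<Omega>(1) f0 by (intro integral_lebesgue_on_superset[symmetric]) auto
    also have "\<dots> = 0"
    proof -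
      have "is_weak_deriv U (mi_single i 1) g G" by (rule is_weak_deriv_subset[OF G(1) U_open \<Omega>(1) U_\<Omega>])
      then have "(LINT x|lebesgue_on U. g x * partial_deriv i ?q x) = - (LINT x|lebesgue_on U. G x * ?q x)"
        using q unfolding is_weak_deriv_single by blast
      moreover have "integrable (lebesgue_on U) (\<lambda>x. g x * partial_deriv i ?q x)" "integrable (lebesgue_on U) (\<lambda>x. G x * ?q x)"
        using L2_subset[OF gL U_open \<Omega>(1) U_\<Omega>] L2_subset[OF G(2) U_open \<Omega>(1) U_\<Omega>]
        by (auto intro!: L2_mult_integrable test_fun_L2 test_fun_partial_deriv q U_bounded U_open)
      ultimately show ?thesis by simp
    qed
    finally show ?thesis .
  qed
  have lim: "(\<lambda>m. ?I S (\<lambda>x. p x * \<eta> m x)) \<longlonglongrightarrow> ?I S p"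
    if S: "solid_polytope S" "solid_polytope.in_H1 S g" "F facet_of S"
      and AE_U: "AE y in side_measure S F. y \<in> U" for S
  proof -
    interpret S: solid_polytope S by fact
    have tL: "trace S F g \<in> L2_fun (side_measure S F)" by (rule S.trace_L2[OF S(3,2)])
    have \<eta>_smooth: "smooth (\<eta> m)" for m using \<eta>(1) by (simp add: test_fun_def)
    have int: "integrable (side_measure S F) (\<lambda>y. trace S F g y * p y)"
      by (intro L2_mult_integrable tL S.smooth_L2_side[OF S(3)] p)
    show ?thesis
    proof (rule integral_dominated_convergence[where w = "\<lambda>y. \<bar>trace S F g y * p y\<bar>"])
      show "integrable (side_measure S F) (\<lambda>y. \<bar>trace S F g y * p y\<bar>)" using int by simp
      show "AE y in side_measure S F. (\<lambda>m. trace S F g y * (p y * \<eta> m y)) \<longlonglongrightarrow> trace S F g y * p y"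
        using AE_U
      proof eventually_elim
        case (elim y)
        from tendsto_mult_left[OF \<eta>(4)[OF elim], of "trace S F g y * p y"] show ?case by (simp add: mult.assoc)
      qed
      show "AE y in side_measure S F. norm (trace S F g y * (p y * \<eta> m y)) \<le> \<bar>trace S F g y * p y\<bar>" for m
      proof (rule AE_I2)
        fix y
        have "\<bar>trace S F g y * p y\<bar> * \<eta> m y \<le> \<bar>trace S F g y * p y\<bar>"
          using \<eta>(2,3) by (intro mult_left_le) auto
        then show "norm (trace S F g y * (p y * \<eta> m y)) \<le> \<bar>trace S F g y * p y\<bar>"
          using \<eta>(2)[of m y] by (simp add: abs_mult mult.assoc)
      qed
      show "(\<lambda>y. trace S F g y * p y) \<in> borel_measurable (side_measure S F)" using int by simp
      have "integrable (side_measure S F) (\<lambda>y. trace S F g y * (p y * \<eta> m y))" for m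
        by (intro L2_mult_integrable tL S.smooth_L2_side[OF S(3)] smooth_mult p \<eta>_smooth)
      then show "(\<lambda>y. trace S F g y * (p y * \<eta> m y)) \<in> borel_measurable (side_measure S F)" for m by blast
    qed
  qed
  have sm: "side_measure T' F = side_measure T F"
    by (rule side_measure_opposite[OF T T' F opposite])
  have AE_U: "AE y in side_measure T F. y \<in> U"
    using T.AE_side_measure_beside[OF F(1)] T'.AE_side_measure_beside[OF F(2)] unfolding sm
    by eventually_elim (simp add: U_def)
  have AE_U': "AE y in side_measure T' F. y \<in> U"
    unfolding sm by (rule AE_U)
  have "(\<lambda>m. T.normal F $ i * ?I T (\<lambda>x. p x * \<eta> m x) + T'.normal F $ i * ?I T' (\<lambda>x. p x * \<eta> m x))
      \<longlonglongrightarrow> T.normal F $ i * ?I T p + T'.normal F $ i * ?I T' p"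
    by (intro tendsto_add tendsto_mult_left lim T T' F g AE_U AE_U')
  then show ?thesis unfolding zero by (simp add: LIMSEQ_const_iff)
qed

section \<open>Taylor's formula for polynomials\<close>

text \<open>The falling factorial \<open>a (a - 1) \<dots> (a - b + 1)\<close>; it vanishes for \<open>b > a\<close> despite the truncated subtraction.\<close>

definition falling :: "nat \<Rightarrow> nat \<Rightarrow> real" where
  "falling a b = (\<Prod>j<b. real (a - j))"

lemma falling_choose: "falling a b = fact b * real (a choose b)"
proof (cases "b \<le> a")
  case True
  have "falling a b * fact (a - b) = fact a"
    using True
  proof (induction b)
    case (Suc b)
    have "fact (a - b) = real (a - b) * fact (a - Suc b)"
      using Suc.prems by (metis Suc_diff_Suc Suc_le_lessD fact_Suc of_nat_fact of_nat_mult)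
    then show ?case using Suc by (simp add: falling_def mult_ac)
  qed (simp add: falling_def)
  moreover have "fact b * fact (a - b) * real (a choose b) = fact a"
    using binomial_fact_lemma[OF True] by (metis of_nat_fact of_nat_mult)
  ultimately have "falling a b * fact (a - b) = (fact b * real (a choose b)) * fact (a - b)" by (simp add: mult_ac)
  then show ?thesis by simp
next
  case False
  then have "falling a b = 0" unfolding falling_def by (intro prod_zero) auto
  then show ?thesis using False by (simp add: binomial_eq_0)
qed

text \<open>One coefficient per coordinate keeps the shape of the formula under further
  differentiation. For \<open>m i = 0\<close> the truncated exponent is harmless, since the new
  coefficient is 0.\<close>

lemma partial_deriv_monomial:
  "partial_deriv i (\<lambda>x::real^'n::finite. \<Prod>l\<in>UNIV. c l * (x $ l) ^ m l)
    = (\<lambda>x. \<Prod>l\<in>UNIV. (if l = i then c l * real (m l) else c l) * (x $ l) ^ (m l - (if l = i then 1 else 0)))"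
proof
  fix x :: "real^'n"
  let ?g = "\<lambda>x::real^'n. \<Prod>l\<in>UNIV - {i}. c l * (x $ l) ^ m l"
  let ?f = "\<lambda>x::real^'n. \<Prod>l\<in>UNIV. c l * (x $ l) ^ m l"
  have diff: "?f differentiable (at x)"
    by (intro smooth_differentiable smooth_prod smooth_cmult smooth_power smooth_coord)
  have "((\<lambda>t. ?f (x + t *\<^sub>R axis i 1)) has_real_derivative partial_deriv i ?f x) (at 0)"
    using has_derivative_axis_has_real_derivative[of ?f x 0 i] diff by simp
  moreover have "?f (x + t *\<^sub>R axis i 1) = c i * (x $ i + t) ^ m i * ?g x" for t
  proof -
    have "?f (x + t *\<^sub>R axis i 1) = c i * ((x + t *\<^sub>R axis i 1) $ i) ^ m i * ?g (x + t *\<^sub>R axis i 1)"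
      by (rule prod.remove) auto
    also have "?g (x + t *\<^sub>R axis i 1) = ?g x"
      by (intro prod.cong refl) (auto simp: axis_def)
    finally show ?thesis by simp
  qed
  moreover have "((\<lambda>t. c i * (x $ i + t) ^ m i * ?g x) has_real_derivative c i * (real (m i) * (x $ i) ^ (m i - 1)) * ?g x) (at 0)"
    by (auto intro!: derivative_eq_intros)
  ultimately have "partial_deriv i ?f x = c i * (real (m i) * (x $ i) ^ (m i - 1)) * ?g x"
    using DERIV_unique by force
  also have "\<dots> = (\<Prod>l\<in>UNIV. (if l = i then c l * real (m l) else c l) * (x $ l) ^ (m l - (if l = i then 1 else 0)))"
  proof -
    have "(\<Prod>l\<in>UNIV. (if l = i then c l * real (m l) else c l) * (x $ l) ^ (m l - (if l = i then 1 else 0)))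
      = c i * real (m i) * (x $ i) ^ (m i - 1) * (\<Prod>l\<in>UNIV - {i}. (if l = i then c l * real (m l) else c l) * (x $ l) ^ (m l - (if l = i then 1 else 0)))"
      by (subst prod.remove[of _ i]) auto
    also have "(\<Prod>l\<in>UNIV - {i}. (if l = i then c l * real (m l) else c l) * (x $ l) ^ (m l - (if l = i then 1 else 0))) = ?g x"
      by (intro prod.cong) auto
    finally show ?thesis by (simp add: mult_ac)
  qed
  finally show "partial_deriv i ?f x = (\<Prod>l\<in>UNIV. (if l = i then c l * real (m l) else c l) * (x $ l) ^ (m l - (if l = i then 1 else 0)))" .
qed

text \<open>Only the multiplicities of the coordinates in \<open>js\<close> enter, so for
  polynomials the arbitrary enumeration in \<open>mi_deriv\<close> has no influence.\<close>

lemma foldr_partial_deriv_mi_power: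
  "foldr partial_deriv js (\<lambda>x::real^'n::finite. mi_power x \<alpha>)
    = (\<lambda>x. \<Prod>l\<in>UNIV. falling (\<alpha> l) (count_list js l) * (x $ l) ^ (\<alpha> l - count_list js l))"
proof (induction js)
  case Nil
  show ?case by (simp add: mi_power_def falling_def)
next
  case (Cons i js)
  have "foldr partial_deriv (i # js) (\<lambda>x::real^'n. mi_power x \<alpha>)
    = (\<lambda>x. \<Prod>l\<in>UNIV. (if l = i then falling (\<alpha> l) (count_list js l) * real (\<alpha> l - count_list js l) else falling (\<alpha> l) (count_list js l))
        * (x $ l) ^ (\<alpha> l - count_list js l - (if l = i then 1 else 0)))"
    by (simp only: foldr.simps comp_apply Cons.IH partial_deriv_monomial)
  also have "\<dots> = (\<lambda>x. \<Prod>l\<in>UNIV. falling (\<alpha> l) (count_list (i # js) l) * (x $ l) ^ (\<alpha> l - count_list (i # js) l))"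
    by (intro ext prod.cong refl) (auto simp: falling_def)
  finally show ?case .
qed

lemma count_list_replicate_eq: "count_list (replicate m x) y = (if x = y then m else 0)"
  by (induction m) auto

lemma count_list_distinct: "distinct xs \<Longrightarrow> count_list xs x = (if x \<in> set xs then 1 else 0)"
  by (induction xs) auto

lemma count_list_concat_replicate:
  "count_list (concat (map (\<lambda>i. replicate (\<beta> i) i) xs)) l = \<beta> l * count_list xs l"
  by (induction xs) (auto simp: count_list_append count_list_replicate_eq)

lemma count_list_coord_list: "count_list coord_list l = 1"
  by (simp add: count_list_distinct coord_list)

lemma mi_deriv_mi_power:
  "mi_deriv \<beta> (\<lambda>x. mi_power x \<alpha>) x = (\<Prod>l\<in>UNIV. falling (\<alpha> l) (\<beta> l) * (x $ l) ^ (\<alpha> l - \<beta> l))"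
  by (simp add: mi_deriv_def foldr_partial_deriv_mi_power count_list_concat_replicate count_list_coord_list)

lemma foldr_partial_deriv_sum:
  assumes "finite J" "\<And>j. j \<in> J \<Longrightarrow> smooth (f j)"
  shows "foldr partial_deriv js (\<lambda>x. \<Sum>j\<in>J. c j * f j x) = (\<lambda>x. \<Sum>j\<in>J. c j * foldr partial_deriv js (f j) x)"
proof (induction js)
  case (Cons i js)
  have sm: "smooth (foldr partial_deriv js (f j))" if "j \<in> J" for j
    using assms(2)[OF that] by (induction js) (auto intro: smooth_partial_deriv)
  have "partial_deriv i (\<lambda>x. \<Sum>j\<in>J. c j * foldr partial_deriv js (f j) x) x = (\<Sum>j\<in>J. c j * partial_deriv i (foldr partial_deriv js (f j)) x)" for x
  proof (subst partial_deriv_eqI)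
    show "((\<lambda>x. \<Sum>j\<in>J. c j * foldr partial_deriv js (f j) x) has_derivative
        (\<lambda>h. \<Sum>j\<in>J. c j * (\<Sum>i\<in>UNIV. partial_deriv i (foldr partial_deriv js (f j)) x * h $ i))) (at x)"
      by (intro has_derivative_sum has_derivative_mult_right smooth_has_derivative sm)
  qed (simp add: axis_def if_distrib cong: if_cong)
  then show ?case using Cons.IH by simp
qed simp

lemma finite_mi_le: "finite {\<alpha> :: 'n::finite multiindex. mi_order \<alpha> \<le> k}"
proof (rule finite_subset)
  have "\<alpha> l \<le> k" if "mi_order \<alpha> \<le> k" for \<alpha> :: "'n multiindex" and l
    using that member_le_sum[of l UNIV \<alpha>] by (simp add: mi_order_def)
  then show "{\<alpha> :: 'n multiindex. mi_order \<alpha> \<le> k} \<subseteq> PiE UNIV (\<lambda>_. {..k})" by (auto simp: PiE_UNIV_domain)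
  show "finite (PiE (UNIV :: 'n set) (\<lambda>_. {..k}))" by (intro finite_PiE) auto
qed

text \<open>The binomial theorem in every coordinate, with the product of sums expanded into a sum
  over the multi-indices below \<open>\<alpha>\<close>. All other multi-indices of order at most
  \<open>k\<close> contribute 0 through a vanishing binomial coefficient, so the range of summation
  can be the same for all monomials.\<close>

lemma Taylor_mi_power:
  assumes "mi_order \<alpha> \<le> k"
  shows "mi_power (x + d) \<alpha> = (\<Sum>\<beta> | mi_order \<beta> \<le> k. mi_deriv \<beta> (\<lambda>x. mi_power x \<alpha>) x * mi_power d \<beta> / mi_fact \<beta>)"
proof -
  let ?t = "\<lambda>\<beta>. \<Prod>l\<in>UNIV. real (\<alpha> l choose \<beta> l) * (d $ l) ^ \<beta> l * (x $ l) ^ (\<alpha> l - \<beta> l)"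
  have monomial: "mi_deriv \<beta> (\<lambda>x. mi_power x \<alpha>) x * mi_power d \<beta> / mi_fact \<beta> = ?t \<beta>" for \<beta>
    unfolding mi_deriv_mi_power
    unfolding mi_power_def mi_fact_def falling_choose prod.distrib[symmetric] prod_dividef[symmetric]
    by (intro prod.cong refl) simp
  have "mi_power (x + d) \<alpha> = (\<Prod>l\<in>UNIV. \<Sum>b\<le>\<alpha> l. real (\<alpha> l choose b) * (d $ l) ^ b * (x $ l) ^ (\<alpha> l - b))"
    unfolding mi_power_def by (intro prod.cong refl) (simp add: add.commute[of "x $ _"] binomial_ring)
  also have "\<dots> = (\<Sum>\<beta>\<in>PiE UNIV (\<lambda>l. {..\<alpha> l}). ?t \<beta>)"
    by (rule prod_sum_PiE) auto
  also have "\<dots> = (\<Sum>\<beta> | mi_order \<beta> \<le> k. ?t \<beta>)"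
  proof (rule sum.mono_neutral_left[OF finite_mi_le])
    show "PiE UNIV (\<lambda>l. {..\<alpha> l}) \<subseteq> {\<beta>. mi_order \<beta> \<le> k}"
    proof
      fix \<beta> :: "'a \<Rightarrow> nat" assume "\<beta> \<in> PiE UNIV (\<lambda>l. {..\<alpha> l})"
      then have "\<beta> l \<le> \<alpha> l" for l by auto
      then have "mi_order \<beta> \<le> mi_order \<alpha>" unfolding mi_order_def by (rule sum_mono)
      then show "\<beta> \<in> {\<beta>. mi_order \<beta> \<le> k}" using assms by simp
    qed
    show "\<forall>\<beta>\<in>{\<beta>. mi_order \<beta> \<le> k} - PiE UNIV (\<lambda>l. {..\<alpha> l}). ?t \<beta> = 0"
    proof
      fix \<beta> :: "'a \<Rightarrow> nat" assume "\<beta> \<in> {\<beta>. mi_order \<beta> \<le> k} - PiE UNIV (\<lambda>l. {..\<alpha> l})"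
      then obtain l where "\<not> \<beta> l \<le> \<alpha> l" by (auto simp: PiE_UNIV_domain)
      then have "\<beta> l > \<alpha> l" by simp
      then show "?t \<beta> = 0" by (intro prod_zero) (auto intro!: bexI[of _ l] simp: binomial_eq_0)
    qed
  qed
  finally show ?thesis by (simp only: monomial)
qed

lemma Taylor_polys:
  assumes p: "p \<in> polys k"
  shows "p (x + d) = (\<Sum>\<beta> | mi_order \<beta> \<le> k. mi_deriv \<beta> p x * mi_power d \<beta> / mi_fact \<beta>)"
proof -
  obtain c where c: "p = (\<lambda>x. \<Sum>\<alpha> | mi_order \<alpha> \<le> k. c \<alpha> * mi_power x \<alpha>)"
    using p unfolding polys_def by blast
  have deriv: "mi_deriv \<beta> p x = (\<Sum>\<alpha> | mi_order \<alpha> \<le> k. c \<alpha> * mi_deriv \<beta> (\<lambda>x. mi_power x \<alpha>) x)" for \<beta>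
    unfolding c mi_deriv_def by (subst foldr_partial_deriv_sum) (auto intro: smooth_mi_power finite_mi_le)
  have "p (x + d) = (\<Sum>\<alpha> | mi_order \<alpha> \<le> k. c \<alpha> * (\<Sum>\<beta> | mi_order \<beta> \<le> k. mi_deriv \<beta> (\<lambda>x. mi_power x \<alpha>) x * mi_power d \<beta> / mi_fact \<beta>))"
    unfolding c by (intro sum.cong refl) (simp add: Taylor_mi_power[of _ k])
  also have "\<dots> = (\<Sum>\<beta> | mi_order \<beta> \<le> k. mi_deriv \<beta> p x * mi_power d \<beta> / mi_fact \<beta>)"
    unfolding deriv sum_distrib_left sum_distrib_right sum_divide_distrib
    by (subst sum.swap) (simp add: mult_ac)
  finally show ?thesis .
qed

text \<open>The factor \<open>fact i\<close> in \<open>dir_deriv\<close> cancels against the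
  division, and what remains is the Taylor sum grouped by order, with \<open>p x\<close> as the term
  of order 0.\<close>

lemma sum_dir_deriv_polys:
  fixes p :: "real^'n::finite \<Rightarrow> real"
  assumes p: "p \<in> polys k"
  shows "p x + (\<Sum>i=1..k. dir_deriv i d p x / fact i) = p (x + d)"
proof -
  let ?t = "\<lambda>\<beta>. mi_deriv \<beta> p x * mi_power d \<beta> / mi_fact \<beta>"
  have "dir_deriv i d p x / fact i = (\<Sum>\<beta> | mi_order \<beta> = i. ?t \<beta>)" for i
    by (simp add: dir_deriv_def sum_divide_distrib)
  moreover have "p x = (\<Sum>\<beta> | mi_order \<beta> = 0. ?t \<beta>)"
  proof -
    have "{\<beta> :: 'n multiindex. mi_order \<beta> = 0} = {\<lambda>_. 0}" by (auto simp: mi_order_def)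
    moreover have "mi_deriv (\<lambda>_. 0) p = p"
    proof -
      have "concat (map (\<lambda>i. [] :: 'n list) xs) = []" for xs :: "'n list" by (induction xs) auto
      then show ?thesis unfolding mi_deriv_def replicate_0 by (simp only: foldr.simps id_apply)
    qed
    ultimately show ?thesis by (simp add: mi_power_def mi_fact_def)
  qed
  ultimately have "p x + (\<Sum>i=1..k. dir_deriv i d p x / fact i) = (\<Sum>i=0..k. \<Sum>\<beta> | mi_order \<beta> = i. ?t \<beta>)"
    by (simp add: sum.atLeast_Suc_atMost)
  also have "\<dots> = (\<Sum>i\<in>{0..k}. sum ?t {\<beta>. \<beta> \<in> {\<beta>. mi_order \<beta> \<le> k} \<and> mi_order \<beta> = i})"
    by (intro sum.cong refl) auto
  also have "\<dots> = (\<Sum>\<beta> | mi_order \<beta> \<le> k. ?t \<beta>)"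
    by (rule sum.group) (auto intro: finite_mi_le)
  finally show ?thesis using Taylor_polys[OF p] by simp
qed

section \<open>Polynomials are determined by their values on an open set\<close>

lemma polys_along_line:
  assumes p: "p \<in> polys k"
  shows "\<exists>P. \<forall>t. p (x + t *\<^sub>R v) = poly P t"
proof -
  obtain c where c: "p = (\<lambda>x. \<Sum>\<alpha> | mi_order \<alpha> \<le> k. c \<alpha> * mi_power x \<alpha>)"
    using p unfolding polys_def by blast
  have "p (x + t *\<^sub>R v) = poly (\<Sum>\<alpha> | mi_order \<alpha> \<le> k. [:c \<alpha>:] * (\<Prod>l\<in>UNIV. [:x $ l, v $ l:] ^ \<alpha> l)) t" for t
    by (simp add: c mi_power_def poly_sum poly_prod)
  then show ?thesis by blast
qed

text \<open>On the line through \<open>y\<close> and a point of \<open>U\<close> the difference is a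
  univariate polynomial with infinitely many zeros. This makes the definite description in
  \<open>elem_poly\<close> meaningful.\<close>

lemma polys_eq_on_open:
  assumes p: "p \<in> polys k" and q: "q \<in> polys k" and U: "open U" "U \<noteq> {}" and eq: "\<And>x. x \<in> U \<Longrightarrow> p x = q x"
  shows "p = q"
proof
  fix y
  obtain x where "x \<in> U" using U(2) by blast
  obtain P where P: "\<And>t. p (x + t *\<^sub>R (y - x)) = poly P t" using polys_along_line[OF p] by metis
  obtain Q where Q: "\<And>t. q (x + t *\<^sub>R (y - x)) = poly Q t" using polys_along_line[OF q] by metis
  have "P - Q = 0"
  proof (rule ccontr)
    assume "P - Q \<noteq> 0"
    then have fin: "finite {t. poly (P - Q) t = 0}" by (rule poly_roots_finite)
    have "open ((\<lambda>t. x + t *\<^sub>R (y - x)) -` U)"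
      by (intro open_vimage U continuous_intros)
    moreover have "0 \<in> (\<lambda>t. x + t *\<^sub>R (y - x)) -` U" using \<open>x \<in> U\<close> by simp
    ultimately obtain e where e: "e > 0" "ball 0 e \<subseteq> (\<lambda>t. x + t *\<^sub>R (y - x)) -` U"
      using open_contains_ball by metis
    then have "{0<..<e} \<subseteq> (\<lambda>t. x + t *\<^sub>R (y - x)) -` U" by (auto simp: subset_iff)
    then have "infinite ((\<lambda>t. x + t *\<^sub>R (y - x)) -` U)"
      using infinite_Ioo[OF e(1)] finite_subset by blast
    moreover have "(\<lambda>t. x + t *\<^sub>R (y - x)) -` U \<subseteq> {t. poly (P - Q) t = 0}"
      using eq by (auto simp: P[symmetric] Q[symmetric])
    ultimately show False using fin finite_subset by blast
  qed
  then show "p y = q y" using P[of 1] Q[of 1] by simp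
qed

section \<open>The surrogate domain\<close>

text \<open>A point outside \<open>\<Omega>\<close> at the frontier lies on or below the local
  graph. A small step against \<open>e\<close> leads strictly below the graph, where a whole
  neighbourhood misses \<open>\<Omega>\<close>, while the point reached is still in
  \<open>closure \<Omega>\<close>. This excludes slits, across which \<open>u\<close> would have no
  weak derivatives.\<close>

lemma lipschitz_boundary_interior_closure:
  fixes \<Omega> :: "(real^'n::finite) set"
  assumes "open \<Omega>" "lipschitz_boundary \<Omega>"
  shows "interior (closure \<Omega>) \<subseteq> \<Omega>"
proof
  fix x assume x: "x \<in> interior (closure \<Omega>)"
  show "x \<in> \<Omega>"
  proof (rule ccontr)
    assume nx: "x \<notin> \<Omega>"
    then have "x \<in> frontier \<Omega>"
      using x interior_subset assms(1) by (auto simp: frontier_def interior_open)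
    then obtain r e L and \<gamma> :: "real^'n \<Rightarrow> real" where r: "r > 0" and e: "norm e = 1" and L: "L-lipschitz_on UNIV \<gamma>"
      and graph: "\<And>y. y \<in> ball x r \<Longrightarrow> y \<in> \<Omega> \<longleftrightarrow> \<gamma> (y - (y \<bullet> e) *\<^sub>R e) < y \<bullet> e"
      using assms(2) unfolding lipschitz_boundary_def by blast
    have ee: "e \<bullet> e = 1" using e by (simp add: dot_square_norm)
    obtain t where t: "0 < t" "x + t *\<^sub>R (- e) \<in> ball x r \<inter> interior (closure \<Omega>)"
      using open_segment_near[of "ball x r \<inter> interior (closure \<Omega>)" x "- e"] x r by auto
    define y where "y = x + t *\<^sub>R (- e)"
    have ye: "y \<bullet> e = x \<bullet> e - t" by (simp add: y_def inner_add_left inner_diff_left ee)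
    have "y - (y \<bullet> e) *\<^sub>R e = x - (x \<bullet> e) *\<^sub>R e"
      unfolding ye by (simp add: y_def algebra_simps)
    moreover have "\<gamma> (x - (x \<bullet> e) *\<^sub>R e) \<ge> x \<bullet> e" using graph[of x] nx r by simp
    ultimately have below: "y \<bullet> e < \<gamma> (y - (y \<bullet> e) *\<^sub>R e)" using ye t by simp
    define W where "W = {z. z \<bullet> e < \<gamma> (z - (z \<bullet> e) *\<^sub>R e)}"
    have cont: "continuous_on UNIV \<gamma>" by (rule lipschitz_on_continuous_on[OF L])
    have "open W"
      unfolding W_def
      by (intro open_Collect_less continuous_intros continuous_on_compose2[OF cont]) auto
    then have "open (W \<inter> ball x r)" by auto
    moreover have "y \<in> W \<inter> ball x r" using below t by (simp add: W_def y_def)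
    moreover have "y \<in> closure \<Omega>" using t interior_subset by (auto simp: y_def)
    ultimately obtain z where "z \<in> \<Omega>" "z \<in> W \<inter> ball x r"
      using closure_iff_nhds_not_empty[of y \<Omega>] by blast
    then show False using graph[of z] by (auto simp: W_def)
  qed
qed

lemma simplex_solid_polytope:
  fixes T :: "(real^'n::finite) set"
  assumes "int CARD('n) simplex T"
  shows "solid_polytope T"
proof
  show "polytope T" by (rule simplex_imp_polytope[OF assms])
  have "aff_dim T = int DIM(real^'n)" using aff_dim_simplex[OF assms] by simp
  then have aff: "affine hull T = UNIV" by (simp only: aff_dim_eq_full)
  have "T \<noteq> {}" using aff by auto
  then have "rel_interior T \<noteq> {}" using rel_interior_eq_empty[OF convex_simplex[OF assms]] by blast
  then show "interior T \<noteq> {}" using rel_interior_interior[OF aff] by simp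
qed

lemma AE_lebesgue_on_subset:
  assumes "AE x in lebesgue_on \<Omega>. P x" "C \<subseteq> \<Omega>" "C \<in> sets lebesgue" "\<Omega> \<in> sets lebesgue"
  shows "AE x in lebesgue_on C. P x"
  using assms by (auto simp: AE_restrict_space_iff elim!: eventually_mono)

locale surrogate =
  fixes \<Omega> D :: "(real^'n::finite) set" and \<T> :: "(real^'n) set set" and k :: nat
  assumes open_domain: "open \<Omega>" and bounded_domain: "bounded \<Omega>" and lipschitz: "lipschitz_boundary \<Omega>"
    and mesh: "conforming_mesh D \<T>"
begin

abbreviation elements :: "(real^'n) set set" where
  "elements \<equiv> surrogate_mesh \<Omega> \<T>"

abbreviation domain :: "(real^'n) set" where
  "domain \<equiv> surrogate_domain \<Omega> \<T>"

lemma elements_subset: "elements \<subseteq> \<T>"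
  by (auto simp: surrogate_mesh_def)

lemma finite_elements: "finite elements"
  using finite_subset[OF elements_subset] mesh by (simp add: conforming_mesh_def triangulation_def)

lemma element_solid: "T \<in> elements \<Longrightarrow> solid_polytope T"
  using mesh elements_subset by (intro simplex_solid_polytope) (auto simp: conforming_mesh_def)

lemma elements_face: "T \<in> elements \<Longrightarrow> T' \<in> elements \<Longrightarrow> (T \<inter> T') face_of T \<and> (T \<inter> T') face_of T'"
proof -
  have "\<forall>T T'. T \<in> \<T> \<and> T' \<in> \<T> \<longrightarrow> (T \<inter> T') face_of T"
    using mesh by (simp add: conforming_mesh_def triangulation_def)
  then have "(T \<inter> T') face_of T \<and> (T \<inter> T') face_of T'" if "T \<in> \<T>" "T' \<in> \<T>" for T T'
    using that by (metis Int_commute)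
  then show "T \<in> elements \<Longrightarrow> T' \<in> elements \<Longrightarrow> (T \<inter> T') face_of T \<and> (T \<inter> T') face_of T'"
    using elements_subset by (metis subsetD)
qed

lemma interior_closure_domain: "interior (closure \<Omega>) \<subseteq> \<Omega>"
  by (rule lipschitz_boundary_interior_closure[OF open_domain lipschitz])

lemma element_subset: "T \<in> elements \<Longrightarrow> T \<subseteq> closure \<Omega>"
  by (auto simp: surrogate_mesh_def)

lemma open_surrogate: "open domain"
  by (simp add: surrogate_domain_def)

lemma surrogate_subset: "domain \<subseteq> \<Omega>"
proof -
  have "domain \<subseteq> interior (closure \<Omega>)"
    unfolding surrogate_domain_def using element_subset by (intro interior_mono) auto
  then show ?thesis using interior_closure_domain by blast
qed

lemma interior_element_subset: "T \<in> elements \<Longrightarrow> interior T \<subseteq> domain"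
  unfolding surrogate_domain_def by (intro interior_mono) auto

lemma interior_Un_elements_subset: "T \<in> elements \<Longrightarrow> T' \<in> elements \<Longrightarrow> interior (T \<union> T') \<subseteq> domain"
  unfolding surrogate_domain_def by (intro interior_mono) auto

lemma interior_element_subset_domain: "T \<in> elements \<Longrightarrow> interior T \<subseteq> \<Omega>"
  using interior_element_subset surrogate_subset by blast

text \<open>A face that meets the interior is the whole polytope; overlapping interiors would make
  \<open>T \<inter> T'\<close> equal to both elements.\<close>

lemma interiors_disjoint:
  assumes "T \<in> elements" "T' \<in> elements" "T \<noteq> T'"
  shows "interior T \<inter> interior T' = {}"
proof (rule ccontr)
  assume ne: "interior T \<inter> interior T' \<noteq> {}"
  have "T \<inter> T' = T"
    using face_of_disjoint_interior[of "T \<inter> T'" T] elements_face[OF assms(1,2)] ne interior_subset by blast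
  moreover have "T \<inter> T' = T'"
    using face_of_disjoint_interior[of "T \<inter> T'" T'] elements_face[OF assms(1,2)] ne interior_subset by blast
  ultimately show False using assms(3) by simp
qed

text \<open>The exceptional points lie on the frontiers of the elements, which are negligible by
  convexity.\<close>

lemma AE_indicator_surrogate:
  "AE x in lebesgue. (indicator domain x :: real) = (\<Sum>T\<in>elements. indicator (interior T) x)"
proof -
  have "negligible (\<Union>T\<in>elements. frontier T)"
    using finite_elements element_solid solid_polytope.convex
    by (intro negligible_Union) (auto intro!: negligible_convex_frontier)
  then have "AE x in lebesgue. x \<notin> (\<Union>T\<in>elements. frontier T)"
    unfolding negligible_iff_null_sets by (rule AE_not_in)
  then show ?thesis
  proof eventually_elim
    case (elim x)
    show ?case
    proof (cases "x \<in> domain")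
      case True
      then obtain T where T: "T \<in> elements" "x \<in> T"
        unfolding surrogate_domain_def using interior_subset by blast
      have "x \<notin> frontier T" using elim T(1) by blast
      then have xT: "x \<in> interior T" using T(2) closure_subset by (auto simp: frontier_def)
      have "(\<Sum>T'\<in>elements. indicator (interior T') x) = (\<Sum>T'\<in>elements. if T' = T then 1 else (0::real))"
        using interiors_disjoint[OF T(1)] xT by (intro sum.cong refl) (auto simp: indicator_def)
      then show ?thesis using True T(1) finite_elements by simp
    next
      case False
      then have "x \<notin> interior T" if "T \<in> elements" for T using interior_element_subset[OF that] by blast
      then show ?thesis using False by simp
    qed
  qed
qed

text \<open>On each element the integrand may be replaced by an expression of its own, as
  \<open>w\<close> and \<open>gradient w\<close> agree with those of a polynomial only element by
  element.\<close>

lemma integral_surrogate: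
  fixes f :: "real^'n \<Rightarrow> real"
  assumes eq: "\<And>T. T \<in> elements \<Longrightarrow> AE x in lebesgue_on (interior T). f x = h T x"
    and int: "\<And>T. T \<in> elements \<Longrightarrow> integrable (lebesgue_on (interior T)) (h T)"
  shows "(LINT x|lebesgue_on domain. f x) = (\<Sum>T\<in>elements. LINT x|lebesgue_on (interior T). h T x)"
proof -
  have "(LINT x|lebesgue_on domain. f x) = (LINT x|lebesgue. indicator domain x *\<^sub>R f x)"
    using open_surrogate by (intro integral_restrict_space) auto
  also have "\<dots> = (LINT x|lebesgue. (\<Sum>T\<in>elements. indicator (interior T) x *\<^sub>R h T x))"
  proof (rule integral_cong_AE_complete[OF completion.complete_measure_axioms])
    have "AE x in lebesgue. x \<in> interior T \<longrightarrow> f x = h T x" if "T \<in> elements" for T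
      using eq[OF that] by (simp add: AE_restrict_space_iff)
    then have "AE x in lebesgue. \<forall>T\<in>elements. x \<in> interior T \<longrightarrow> f x = h T x"
      using finite_elements by (intro AE_finite_allI) auto
    with AE_indicator_surrogate
    show "AE x in lebesgue. indicator domain x *\<^sub>R f x = (\<Sum>T\<in>elements. indicator (interior T) x *\<^sub>R h T x)"
    proof eventually_elim
      case (elim x)
      have "indicator domain x *\<^sub>R f x = (\<Sum>T\<in>elements. indicator (interior T) x *\<^sub>R f x)"
        by (simp only: elim(1) scaleR_sum_left)
      also have "\<dots> = (\<Sum>T\<in>elements. indicator (interior T) x *\<^sub>R h T x)"
        using elim(2) by (intro sum.cong refl) (auto simp: indicator_def)
      finally show ?case .
    qed
  qed
  also have "\<dots> = (\<Sum>T\<in>elements. LINT x|lebesgue. indicator (interior T) x *\<^sub>R h T x)"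
    using int by (intro Bochner_Integration.integral_sum) (simp add: integrable_restrict_space)
  also have "\<dots> = (\<Sum>T\<in>elements. LINT x|lebesgue_on (interior T). h T x)"
    by (intro sum.cong refl integral_restrict_space[symmetric]) auto
  finally show ?thesis .
qed

lemma shared_facet:
  assumes "T \<in> elements" "T' \<in> elements" "T \<noteq> T'" "F facet_of T" "F facet_of T'"
  shows "T \<inter> T' = F" "outer_normal T' F = - outer_normal T F"
    "solid_polytope.offset T' F = - solid_polytope.offset T F"
proof -
  note S = element_solid[OF assms(1)] element_solid[OF assms(2)]
  obtain y where y: "y \<in> F" "y \<in> solid_polytope.beside T F"
    using solid_polytope.exists_facet_beside_point[OF S(1) assms(4)] by blast
  have "F \<subseteq> T'" using assms(5) by (simp add: facet_of_imp_subset)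
  then have "y \<in> T'" using y(1) by blast
  note shared = solid_polytope_shared_facet[OF S _ _ assms(3,4) y(1) this y(2)]
  show "T \<inter> T' = F" "outer_normal T' F = - outer_normal T F"
    "solid_polytope.offset T' F = - solid_polytope.offset T F"
    using shared elements_face[OF assms(1,2)] by auto
qed

text \<open>Some point of \<open>F\<close> lies in the open domain; a small move within
  \<open>F\<close> towards a point beside the other facets keeps it there. If no other element
  contained the resulting \<open>y\<close>, a short step along the outer normal would stay in the
  domain and hence in \<open>T\<close>, which is absurd. Three elements on one facet would need
  pairwise opposite normals, which gives uniqueness.\<close>

lemma exists_neighbour:
  assumes T: "T \<in> elements" and F: "F facet_of T" and nb: "\<not> F \<subseteq> surrogate_boundary \<Omega> \<T>"
  shows "\<exists>!T'. T' \<in> elements \<and> T' \<noteq> T \<and> F facet_of T'"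
proof -
  interpret T: solid_polytope T by (rule element_solid[OF T])
  obtain x where x: "x \<in> F" "x \<notin> frontier domain" using nb by (auto simp: surrogate_boundary_def)
  have "x \<in> closure domain"
    using x(1) T.in_facet_iff[OF F] T.closure_interior closure_mono[OF interior_element_subset[OF T]] by blast
  then have x_dom: "x \<in> domain" using x(2) open_surrogate by (simp add: frontier_def interior_open)
  obtain y0 where y0: "y0 \<in> F" "y0 \<in> T.beside F" using T.exists_facet_beside_point[OF F] by blast
  obtain t where t: "0 < t" "t < 1" "x + t *\<^sub>R (y0 - x) \<in> domain"
    using open_segment_near[OF open_surrogate x_dom] by blast
  define y where "y = x + t *\<^sub>R (y0 - x)"
  have n_y: "n \<bullet> y = (1 - t) * (n \<bullet> x) + t * (n \<bullet> y0)" for n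
    by (simp add: y_def inner_add_right inner_diff_right algebra_simps)
  have y_beside: "y \<in> T.beside F"
    unfolding T.beside_def
  proof (intro CollectI allI impI)
    fix F' assume F': "F' facet_of T" "F' \<noteq> F"
    have "T.normal F' \<bullet> x \<le> T.offset F'" using T.in_polytope_le[OF _ F'(1)] x(1) T.in_facet_iff[OF F] by blast
    moreover have "T.normal F' \<bullet> y0 < T.offset F'" using y0(2) F' by (simp add: T.beside_def)
    ultimately have "(1 - t) * (T.normal F' \<bullet> x) + t * (T.normal F' \<bullet> y0) < (1 - t) * T.offset F' + t * T.offset F'"
      using t by (intro add_le_less_mono mult_strict_left_mono mult_left_mono) auto
    then show "T.normal F' \<bullet> y < T.offset F'" unfolding n_y by (simp add: algebra_simps)
  qed
  have n_yF: "T.normal F \<bullet> y = T.offset F"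
    using x(1) y0(1) T.in_facet_iff[OF F] unfolding n_y by (simp add: algebra_simps)
  then have yT: "y \<in> T" using T.beside_in_polytope[OF F y_beside] by simp
  then have yF: "y \<in> F" using T.in_facet_iff[OF F] n_yF by simp
  have y_dom: "y \<in> domain" using t(3) by (simp add: y_def)
  define V where "V = \<Union>(elements - {T})"
  have "y \<in> V"
  proof (rule ccontr)
    assume "y \<notin> V"
    then have "y \<in> domain \<inter> - V" using y_dom by simp
    have "closed V"
      unfolding V_def using finite_elements element_solid solid_polytope.closed by (intro closed_Union) auto
    then have "open (domain \<inter> - V)" using open_surrogate by auto
    from open_segment_near[OF this \<open>y \<in> domain \<inter> - V\<close>, of "T.normal F"]
    obtain s where s: "0 < s" "y + s *\<^sub>R T.normal F \<in> domain \<inter> - V" by blast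
    then have "y + s *\<^sub>R T.normal F \<in> \<Union>elements" "y + s *\<^sub>R T.normal F \<notin> V"
      unfolding surrogate_domain_def using interior_subset[of "\<Union>elements"] by auto
    then have "y + s *\<^sub>R T.normal F \<in> T" by (auto simp: V_def)
    then have "T.normal F \<bullet> (y + s *\<^sub>R T.normal F) \<le> T.offset F" by (rule T.in_polytope_le[OF _ F])
    then show False using s(1) n_yF T.inner_normal_self[OF F] by (simp add: inner_add_right)
  qed
  then obtain T' where T': "T' \<in> elements" "T' \<noteq> T" "y \<in> T'" by (auto simp: V_def)
  have F': "F facet_of T'"
    using elements_face[OF T T'(1)] T' yF y_beside element_solid[OF T'(1)]
    by (intro solid_polytope_shared_facet(2)[OF T.solid_polytope_axioms _ _ _ _ F yF]) auto
  show ?thesis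
  proof (rule ex1I[of _ T'])
    show "T' \<in> elements \<and> T' \<noteq> T \<and> F facet_of T'" using T' F' by blast
  next
    fix S assume S: "S \<in> elements \<and> S \<noteq> T \<and> F facet_of S"
    show "S = T'"
    proof (rule ccontr)
      assume "S \<noteq> T'"
      have "outer_normal S F = - T.normal F" using shared_facet(2)[of T S F] S T F by blast
      moreover have "outer_normal T' F = - T.normal F" using shared_facet(2)[of T T' F] T' T F F' by blast
      moreover have "outer_normal S F = - outer_normal T' F" using shared_facet(2)[of T' S F] S T' F' \<open>S \<noteq> T'\<close> by blast
      ultimately have "T.normal F + T.normal F = 0" by (metis add.right_inverse minus_minus)
      then have "(2::real) *\<^sub>R T.normal F = 0" by (simp add: scaleR_2)
      then show False using T.normal_nonzero[OF F] by simp
    qed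
  qed
qed

lemma elem_poly:
  assumes w: "w \<in> fe_space k \<Omega> \<T>" and T: "T \<in> elements"
  shows "elem_poly k T w \<in> polys k" "\<And>x. x \<in> T \<Longrightarrow> x \<in> domain \<Longrightarrow> w x = elem_poly k T w x"
proof -
  interpret T: solid_polytope T by (rule element_solid[OF T])
  obtain p where p: "p \<in> polys k" "\<And>x. x \<in> T \<Longrightarrow> x \<in> domain \<Longrightarrow> w x = p x"
    using w T by (auto simp: fe_space_def)
  have int: "x \<in> T \<and> x \<in> domain" if "x \<in> interior T" for x
    using that interior_subset interior_element_subset[OF T] by blast
  have "elem_poly k T w = p"
    unfolding elem_poly_def
  proof (rule the_equality)
    show "p \<in> polys k \<and> (\<forall>x\<in>interior T. w x = p x)" using p int by blast
    show "q = p" if "q \<in> polys k \<and> (\<forall>x\<in>interior T. w x = q x)" for q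
    proof (rule polys_eq_on_open[OF _ p(1) open_interior T.interior_nonempty])
      show "q \<in> polys k" using that by blast
      show "q x = p x" if x: "x \<in> interior T" for x
        using \<open>q \<in> polys k \<and> (\<forall>x\<in>interior T. w x = q x)\<close> p(2)[of x] int[OF x] x by simp
    qed
  qed
  with p show "elem_poly k T w \<in> polys k" "\<And>x. x \<in> T \<Longrightarrow> x \<in> domain \<Longrightarrow> w x = elem_poly k T w x" by auto
qed

lemma gradient_elem_poly:
  assumes w: "w \<in> fe_space k \<Omega> \<T>" and T: "T \<in> elements" and x: "x \<in> interior T"
  shows "gradient w x $ i = partial_deriv i (elem_poly k T w) x"
proof -
  let ?p = "elem_poly k T w"
  have "(?p has_derivative (\<lambda>h. \<Sum>i\<in>UNIV. partial_deriv i ?p x * h $ i)) (at x)"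
    by (intro smooth_has_derivative smooth_polys[of _ k] elem_poly(1)[OF w T])
  then have "(w has_derivative (\<lambda>h. \<Sum>i\<in>UNIV. partial_deriv i ?p x * h $ i)) (at x)"
  proof (rule has_derivative_transform_within_open[OF _ open_interior x])
    fix y assume "y \<in> interior T"
    then have "y \<in> T" "y \<in> domain" using interior_subset interior_element_subset[OF T] by blast+
    then show "?p y = w y" using elem_poly(2)[OF w T] by simp
  qed
  from partial_deriv_eqI[OF this, of i] show ?thesis
    by (simp add: gradient_def axis_def if_distrib cong: if_cong)
qed

lemma shift_eq_comp:
  assumes "v \<in> fe_space k \<Omega> \<T>" "T \<in> elements"
  shows "shift k (\<lambda>x. M x - x) T v x = elem_poly k T v (M x)"
  using sum_dir_deriv_polys[OF elem_poly(1)[OF assms], of x "M x - x"] by (simp add: shift_def)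

lemma ahat_discrete:
  assumes v: "v \<in> fe_space k \<Omega> \<T>"
  shows "ahat_form k \<Omega> \<T> M (Discrete v) w = a_form k \<Omega> \<T> M v w"
proof -
  have "inner_bd \<Omega> \<T> (\<lambda>T F. elem_poly k T v \<circ> M) (discrete_flux k w)
      = inner_bd \<Omega> \<T> (\<lambda>T F. shift k (\<lambda>x. M x - x) T v) (discrete_flux k w)"
    unfolding inner_bd_def
    by (intro sum.cong refl) (auto simp: boundary_sides_def shift_eq_comp[OF v])
  then show ?thesis by (simp add: ahat_form_def a_form_def)
qed

end

section \<open>Exact consistency for the solution of the Poisson problem\<close>

locale surrogate_poisson = surrogate \<Omega> D \<T> k
  for \<Omega> D :: "(real^'n::finite) set" and \<T> :: "(real^'n) set set" and k :: nat +
  fixes u f uD :: "real^'n \<Rightarrow> real"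
  assumes u: "u \<in> sobolev_H 2 \<Omega>" and poisson: "poisson_solution \<Omega> f uD u"
begin

abbreviation du :: "'n \<Rightarrow> real^'n \<Rightarrow> real" where
  "du i \<equiv> weak_deriv \<Omega> (mi_single i 1) u"

abbreviation ddu :: "'n \<Rightarrow> real^'n \<Rightarrow> real" where
  "ddu i \<equiv> weak_deriv \<Omega> (mi_single i 2) u"

lemma du_L2: "du i \<in> L2_fun (lebesgue_on \<Omega>)" and ddu_L2: "ddu i \<in> L2_fun (lebesgue_on \<Omega>)"
  using sobolev_H_weak_deriv(1)[OF u] by simp_all

lemma second_weak_deriv:
  "\<exists>h\<in>L2_fun (lebesgue_on \<Omega>). is_weak_deriv \<Omega> (mi_single j 1) (du i) h"
proof -
  have du: "is_weak_deriv \<Omega> (mi_single i 1) u (du i)" by (rule sobolev_H_weak_deriv(2)[OF u]) simp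
  let ?\<alpha> = "\<lambda>l. mi_single i 1 l + mi_single j 1 l"
  have le: "mi_order ?\<alpha> \<le> 2" using mi_order_pair[of i j] by simp
  show ?thesis
    using weak_deriv_of_weak_deriv[OF du sobolev_H_weak_deriv(2)[OF u le]] sobolev_H_weak_deriv(1)[OF u le] by blast
qed

text \<open>Reconciles two choices: \<open>weak_laplacian\<close> uses the derivatives chosen for
  the multi-indices \<open>mi_single i 2\<close> of \<open>u\<close>, and Green's formula takes
  first derivatives of the chosen \<open>du i\<close>.\<close>

lemma ddu_weak_deriv: "is_weak_deriv \<Omega> (mi_single i 1) (du i) (ddu i)"
proof (rule weak_deriv_of_weak_deriv)
  show "is_weak_deriv \<Omega> (mi_single i 1) u (du i)" by (rule sobolev_H_weak_deriv(2)[OF u]) simp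
  have "(\<lambda>l. mi_single i 1 l + mi_single i 1 l) = mi_single i 2" by (auto simp: mi_single_def)
  then show "is_weak_deriv \<Omega> (\<lambda>l. mi_single i 1 l + mi_single i 1 l) u (ddu i)"
    using sobolev_H_weak_deriv(2)[OF u, of "mi_single i 2"] by simp
qed

lemma du_in_H1:
  assumes T: "T \<in> elements"
  shows "solid_polytope.in_H1 T (du i)"
proof -
  interpret T: solid_polytope T by (rule element_solid[OF T])
  note sub = open_interior open_domain interior_element_subset_domain[OF T]
  have "\<exists>G\<in>L2_fun T.vol. is_weak_deriv (interior T) (mi_single j 1) (du i) G" for j
    using second_weak_deriv[of j i] L2_subset[OF _ sub] is_weak_deriv_subset[OF _ sub] by blast
  then show ?thesis unfolding T.in_H1_def using L2_subset[OF du_L2 sub] by blast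
qed

text \<open>Defined for every facet of every element, so that \<open>inner_bd\<close> becomes the
  part of the total sum that belongs to the surrogate boundary.\<close>

definition flux :: "(real^'n \<Rightarrow> real) \<Rightarrow> (real^'n) set \<Rightarrow> (real^'n) set \<Rightarrow> real" where
  "flux w T F = (LINT y|side_measure T F. sobolev_flux \<Omega> u T F y * discrete_bd k w T F y)"

lemma flux_eq:
  assumes T: "T \<in> elements" and F: "F facet_of T" and w: "w \<in> fe_space k \<Omega> \<T>"
  shows "flux w T F = (\<Sum>i\<in>UNIV. outer_normal T F $ i * (LINT y|side_measure T F. trace T F (du i) y * elem_poly k T w y))"
proof -
  interpret T: solid_polytope T by (rule element_solid[OF T])
  let ?p = "elem_poly k T w"
  have p: "smooth ?p" by (rule smooth_polys[OF elem_poly(1)[OF w T]])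
  have int: "integrable (side_measure T F) (\<lambda>y. trace T F (du i) y * ?p y)" for i
    by (intro L2_mult_integrable T.trace_L2[OF F du_in_H1[OF T]] T.smooth_L2_side[OF F p])
  have "flux w T F = (LINT y|side_measure T F. (\<Sum>i\<in>UNIV. T.normal F $ i * (trace T F (du i) y * ?p y)))"
    unfolding flux_def sobolev_flux_def discrete_bd_def
    by (simp add: inner_vec_def sum_distrib_left sum_distrib_right mult_ac)
  also have "\<dots> = (\<Sum>i\<in>UNIV. T.normal F $ i * (LINT y|side_measure T F. trace T F (du i) y * ?p y))"
    using int by simp
  finally show ?thesis .
qed

text \<open>Almost every point of \<open>F\<close> is beside \<open>F\<close> for both elements,
  hence interior to \<open>T \<union> T'\<close> and in the domain, where both polynomials coincide
  with \<open>w\<close>. So a single smooth weight can be used on both sides and the traces of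
  \<open>du i\<close> cancel.\<close>

lemma flux_cancel:
  assumes T: "T \<in> elements" "T' \<in> elements" "T \<noteq> T'" and F: "F facet_of T" "F facet_of T'" and w: "w \<in> fe_space k \<Omega> \<T>"
  shows "flux w T' F = - flux w T F"
proof -
  interpret T: solid_polytope T by (rule element_solid[OF T(1)])
  interpret T': solid_polytope T' by (rule element_solid[OF T(2)])
  note solid = T.solid_polytope_axioms T'.solid_polytope_axioms
  note shared = shared_facet[OF T F]
  let ?p = "elem_poly k T w" and ?p' = "elem_poly k T' w"
  have p: "smooth ?p" by (rule smooth_polys[OF elem_poly(1)[OF w T(1)]])
  have sm: "side_measure T' F = side_measure T F" by (rule side_measure_opposite[OF solid F shared(2,3)])
  have AE: "AE y in side_measure T' F. ?p' y = ?p y"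
    using T.AE_side_measure_beside[OF F(1)] T'.AE_side_measure_beside[OF F(2)] T.AE_side_measure_in_facet[OF F(1)] unfolding sm
  proof eventually_elim
    case (elim y)
    have "T.beside F \<inter> T'.beside F \<subseteq> T \<union> T'"
    proof
      fix x assume "x \<in> T.beside F \<inter> T'.beside F"
      then show "x \<in> T \<union> T'"
        using T.beside_in_polytope[OF F(1), of x] T'.beside_in_polytope[OF F(2), of x]
        by (cases "T.normal F \<bullet> x \<le> T.offset F") (auto simp: shared)
    qed
    then have "T.beside F \<inter> T'.beside F \<subseteq> interior (T \<union> T')"
      by (intro interior_maximal open_Int T.open_beside T'.open_beside)
    then have "y \<in> domain" using elim interior_Un_elements_subset[OF T(1,2)] by blast
    moreover have "y \<in> T" "y \<in> T'" using elim T.in_facet_iff[OF F(1)] T'.in_facet_iff[OF F(2)] by auto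
    ultimately show ?case using elem_poly(2)[OF w T(1), of y] elem_poly(2)[OF w T(2), of y] by simp
  qed
  have "interior (T \<union> T') \<subseteq> \<Omega>" using interior_Un_elements_subset[OF T(1,2)] surrogate_subset by blast
  note cancel = trace_cancel_shared_facet[OF solid F shared open_domain this du_in_H1[OF T(1)] du_in_H1[OF T(2)] du_L2 ddu_weak_deriv ddu_L2 p]
  have "(LINT y|side_measure T' F. trace T' F (du i) y * ?p' y) = (LINT y|side_measure T' F. trace T' F (du i) y * ?p y)" for i
    using AE by (intro integral_cong_AE_complete[OF T'.side_measure_complete]) (auto elim: eventually_mono)
  then have "flux w T' F = (\<Sum>i\<in>UNIV. outer_normal T' F $ i * (LINT y|side_measure T' F. trace T' F (du i) y * ?p y))"
    using flux_eq[OF T(2) F(2) w] by simp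
  also have "\<dots> = (\<Sum>i\<in>UNIV. - (outer_normal T F $ i * (LINT y|side_measure T F. trace T F (du i) y * ?p y)))"
    using cancel by (intro sum.cong refl) (simp add: eq_neg_iff_add_eq_0 add.commute)
  also have "\<dots> = - flux w T F" using flux_eq[OF T(1) F(1) w] by (simp add: sum_negf)
  finally show ?thesis .
qed

text \<open>The map \<open>\<sigma>\<close> passes from an inner side of an element to the same side
  of its neighbour. It is an involution that reverses the sign of the flux, so the sum over the
  inner sides equals its own negative.\<close>

lemma sum_flux:
  assumes w: "w \<in> fe_space k \<Omega> \<T>"
  shows "(\<Sum>T\<in>elements. \<Sum>F | F facet_of T. flux w T F) = inner_bd \<Omega> \<T> (sobolev_flux \<Omega> u) (discrete_bd k w)"
proof -
  let ?P = "SIGMA T:elements. {F. F facet_of T}"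
  let ?B = "boundary_sides \<Omega> \<T>"
  have fin: "finite ?P" using finite_elements solid_polytope.finite_facets[OF element_solid] by (intro finite_SigmaI) auto
  have B: "?B \<subseteq> ?P" by (auto simp: boundary_sides_def)
  let ?J = "\<lambda>(T, F). flux w T F"
  define \<sigma> where "\<sigma> = (\<lambda>(T, F). (THE T'. T' \<in> elements \<and> T' \<noteq> T \<and> F facet_of T', F))"
  have \<sigma>: "\<exists>T'. \<sigma> (T, F) = (T', F) \<and> T' \<in> elements \<and> T' \<noteq> T \<and> F facet_of T' \<and> (T', F) \<in> ?P - ?B \<and> \<sigma> (T', F) = (T, F)"
    if TF: "(T, F) \<in> ?P - ?B" for T F
  proof -
    have T: "T \<in> elements" "F facet_of T" and nb: "\<not> F \<subseteq> surrogate_boundary \<Omega> \<T>"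
      using TF by (auto simp: boundary_sides_def)
    define T' where "T' = (THE T'. T' \<in> elements \<and> T' \<noteq> T \<and> F facet_of T')"
    have T': "T' \<in> elements \<and> T' \<noteq> T \<and> F facet_of T'"
      unfolding T'_def by (rule theI'[OF exists_neighbour[OF T nb]])
    have "(THE S. S \<in> elements \<and> S \<noteq> T' \<and> F facet_of S) = T"
      by (rule the1_equality[OF exists_neighbour[OF _ _ nb]]) (use T T' in auto)
    then show ?thesis using T' nb T by (intro exI[of _ T']) (auto simp: \<sigma>_def T'_def boundary_sides_def)
  qed
  have "(\<Sum>s\<in>?P - ?B. ?J s) = (\<Sum>s\<in>?P - ?B. - ?J s)"
  proof (rule sum.reindex_bij_witness[of _ \<sigma> \<sigma>])
    fix s assume s: "s \<in> ?P - ?B"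
    obtain T F where TF: "s = (T, F)" by (cases s)
    obtain T' where T': "\<sigma> (T, F) = (T', F)" "T' \<in> elements" "T' \<noteq> T" "F facet_of T'" "(T', F) \<in> ?P - ?B" "\<sigma> (T', F) = (T, F)"
      using \<sigma> s unfolding TF by blast
    show "\<sigma> (\<sigma> s) = s" "\<sigma> s \<in> ?P - ?B" using T' TF by auto
    then show "\<sigma> (\<sigma> s) = s" "\<sigma> s \<in> ?P - ?B" .
    have "flux w T' F = - flux w T F"
      using s T' by (intro flux_cancel w) (auto simp: TF)
    then show "- ?J (\<sigma> s) = ?J s" using T' TF by simp
  qed
  then have zero: "(\<Sum>s\<in>?P - ?B. ?J s) = 0" by (simp add: sum_negf)
  have "(\<Sum>T\<in>elements. \<Sum>F | F facet_of T. flux w T F) = (\<Sum>s\<in>?P. ?J s)"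
    using finite_elements solid_polytope.finite_facets[OF element_solid] by (intro sum.Sigma) auto
  also have "\<dots> = (\<Sum>s\<in>?B. ?J s)"
    using sum.subset_diff[OF B fin, of ?J] zero by simp
  finally show ?thesis by (simp add: inner_bd_def flux_def)
qed

text \<open>Green's formula on each element with \<open>du i\<close>, \<open>ddu i\<close> and the
  polynomial of \<open>w\<close>, summed over coordinates and elements. The volume terms with
  \<open>ddu i\<close> add up to the integral of \<open>- f * w\<close>, and the boundary terms are
  collected by \<open>sum_flux\<close>.\<close>

lemma Green_surrogate:
  assumes w: "w \<in> fe_space k \<Omega> \<T>"
  shows "inner_vol \<Omega> \<T> (weak_gradient \<Omega> u) (gradient w) - inner_bd \<Omega> \<T> (sobolev_flux \<Omega> u) (discrete_bd k w)
    = inner_vol \<Omega> \<T> f w"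
proof -
  let ?p = "\<lambda>T. elem_poly k T w"
  let ?vol = "\<lambda>T. lebesgue_on (interior T)"
  have p: "smooth (?p T)" if "T \<in> elements" for T by (rule smooth_polys[OF elem_poly(1)[OF w that]])
  have L2: "du i \<in> L2_fun (?vol T)" "ddu i \<in> L2_fun (?vol T)" if "T \<in> elements" for T i
    by (rule L2_subset[OF _ open_interior open_domain interior_element_subset_domain[OF that]], rule du_L2 ddu_L2)+
  have int: "integrable (?vol T) (\<lambda>x. du i x * partial_deriv i (?p T) x)" "integrable (?vol T) (\<lambda>x. ddu i x * ?p T x)"
    if T: "T \<in> elements" for T i
    by (intro L2_mult_integrable L2[OF T] solid_polytope.smooth_L2_vol[OF element_solid[OF T]] smooth_partial_deriv p[OF T])+
  have AE_int: "AE x in ?vol T. x \<in> interior T" for T :: "(real^'n) set"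
    by (rule AE_I2) (simp add: space_restrict_space)
  have 1: "inner_vol \<Omega> \<T> (weak_gradient \<Omega> u) (gradient w)
      = (\<Sum>T\<in>elements. LINT x|?vol T. (\<Sum>i\<in>UNIV. du i x * partial_deriv i (?p T) x))"
    unfolding inner_vol_def
  proof (rule integral_surrogate)
    fix T assume T: "T \<in> elements"
    show "AE x in ?vol T. weak_gradient \<Omega> u x \<bullet> gradient w x = (\<Sum>i\<in>UNIV. du i x * partial_deriv i (?p T) x)"
      using AE_int[of T]
    proof eventually_elim
      case (elim x)
      show ?case by (simp add: inner_vec_def weak_gradient_def gradient_elem_poly[OF w T elim])
    qed
    show "integrable (?vol T) (\<lambda>x. \<Sum>i\<in>UNIV. du i x * partial_deriv i (?p T) x)"
      using int[OF T] by simp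
  qed
  have 2: "inner_vol \<Omega> \<T> f w = (\<Sum>T\<in>elements. LINT x|?vol T. - (\<Sum>i\<in>UNIV. ddu i x * ?p T x))"
    unfolding inner_vol_def
  proof (rule integral_surrogate)
    fix T assume T: "T \<in> elements"
    have "AE x in lebesgue_on \<Omega>. - weak_laplacian \<Omega> u x = f x" using poisson by (simp add: poisson_solution_def)
    then have "AE x in ?vol T. - weak_laplacian \<Omega> u x = f x"
      by (rule AE_lebesgue_on_subset[OF _ interior_element_subset_domain[OF T]]) (use open_domain in auto)
    then show "AE x in ?vol T. f x \<bullet> w x = - (\<Sum>i\<in>UNIV. ddu i x * ?p T x)"
      using AE_int[of T]
    proof eventually_elim
      case (elim x)
      then have "x \<in> T" "x \<in> domain" using interior_subset interior_element_subset[OF T] by blast+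
      then have "w x = ?p T x" by (rule elem_poly(2)[OF w T])
      moreover have "f x = - (\<Sum>i\<in>UNIV. ddu i x)" using elim(1) by (simp add: weak_laplacian_def)
      ultimately show ?case by (simp add: sum_distrib_right)
    qed
    show "integrable (?vol T) (\<lambda>x. - (\<Sum>i\<in>UNIV. ddu i x * ?p T x))"
      using int[OF T] by simp
  qed
  have "(LINT x|?vol T. (\<Sum>i\<in>UNIV. du i x * partial_deriv i (?p T) x)) - (LINT x|?vol T. - (\<Sum>i\<in>UNIV. ddu i x * ?p T x))
      = (\<Sum>F | F facet_of T. flux w T F)" if T: "T \<in> elements" for T
  proof -
    interpret T: solid_polytope T by (rule element_solid[OF T])
    have "(LINT x|T.vol. (\<Sum>i\<in>UNIV. du i x * partial_deriv i (?p T) x)) - (LINT x|T.vol. - (\<Sum>i\<in>UNIV. ddu i x * ?p T x))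
        = (\<Sum>i\<in>UNIV. (LINT x|T.vol. du i x * partial_deriv i (?p T) x) + (LINT x|T.vol. ddu i x * ?p T x))"
      using int[OF T] by (simp add: sum.distrib)
    also have "\<dots> = (\<Sum>i\<in>UNIV. \<Sum>F\<in>T.facets. T.normal F $ i * (LINT y|side_measure T F. trace T F (du i) y * ?p T y))"
      using is_weak_deriv_subset[OF ddu_weak_deriv open_interior open_domain interior_element_subset_domain[OF T]]
      by (intro sum.cong refl T.Green du_in_H1[OF T] L2[OF T] p[OF T])
    also have "\<dots> = (\<Sum>F\<in>T.facets. flux w T F)"
      by (subst sum.swap) (intro sum.cong refl flux_eq[OF T _ w, symmetric], simp)
    finally show ?thesis .
  qed
  then have "inner_vol \<Omega> \<T> (weak_gradient \<Omega> u) (gradient w) - inner_vol \<Omega> \<T> f w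
      = (\<Sum>T\<in>elements. \<Sum>F | F facet_of T. flux w T F)"
    unfolding 1 2 sum_subtractf[symmetric] by (intro sum.cong refl)
  then show ?thesis using sum_flux[OF w] by simp
qed

text \<open>The boundary condition holds at every point of \<open>frontier \<Omega>\<close>, so the
  equality survives the composition with \<open>M\<close>, even if the image of a side under
  \<open>M\<close> is small in the surface measure of \<open>\<Omega>\<close>.\<close>

lemma ahat_consistent:
  assumes w: "w \<in> fe_space k \<Omega> \<T>" and M: "M \<in> surrogate_boundary \<Omega> \<T> \<rightarrow> frontier \<Omega>"
  shows "ahat_form k \<Omega> \<T> M (Sobolev u) w = l_form k \<Omega> \<T> M f uD w"
proof -
  have "inner_bd \<Omega> \<T> (\<lambda>T F. boundary_value \<Omega> u \<circ> M) (discrete_flux k w)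
      = inner_bd \<Omega> \<T> (\<lambda>T F. uD \<circ> M) (discrete_flux k w)"
    unfolding inner_bd_def
  proof (rule sum.cong[OF refl], clarify)
    fix T F assume "(T, F) \<in> boundary_sides \<Omega> \<T>"
    then have T: "T \<in> elements" and F: "F facet_of T" and FB: "F \<subseteq> surrogate_boundary \<Omega> \<T>"
      by (auto simp: boundary_sides_def)
    interpret T: solid_polytope T by (rule element_solid[OF T])
    show "(LINT x|side_measure T F. (boundary_value \<Omega> u \<circ> M) x * discrete_flux k w T F x)
        = (LINT x|side_measure T F. (uD \<circ> M) x * discrete_flux k w T F x)"
    proof (rule integral_cong_AE_complete[OF T.side_measure_complete])
      show "AE x in side_measure T F. (boundary_value \<Omega> u \<circ> M) x * discrete_flux k w T F x = (uD \<circ> M) x * discrete_flux k w T F x"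
        using T.AE_side_measure_in_facet[OF F]
      proof eventually_elim
        case (elim x)
        then have "M x \<in> frontier \<Omega>" using M FB by blast
        then show ?case using poisson by (simp add: poisson_solution_def)
      qed
    qed
  qed
  with Green_surrogate[OF w] show ?thesis by (simp add: ahat_form_def l_form_def)
qed

end

lemma sobolev_H_mono: "m \<le> m' \<Longrightarrow> sobolev_H m' \<Omega> \<subseteq> sobolev_H m \<Omega>"
  by (auto simp: sobolev_H_def)

theorem mainTheorem4:
  fixes \<Omega> D :: "(real^'n::finite) set"
    and \<T> :: "(real^'n) set set"
    and M :: "real^'n \<Rightarrow> real^'n"
    and u f uD :: "real^'n \<Rightarrow> real"
    and \<sigma> \<kappa> :: real
    and k :: nat
  assumes dim: "CARD('n) = 2 \<or> CARD('n) = 3"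
    and Omega: "open \<Omega>" "connected \<Omega>" "bounded \<Omega>" "lipschitz_boundary \<Omega>"
    and D: "closed_domain D" "closure \<Omega> \<subseteq> D"
    and mesh: "conforming_mesh D \<T>" "shape_regular \<sigma> \<T>" "quasi_uniform \<kappa> \<T>"
    and M_maps: "M \<in> surrogate_boundary \<Omega> \<T> \<rightarrow> frontier \<Omega>"
    and M_meas: "\<And>T F. (T, F) \<in> boundary_sides \<Omega> \<T> \<Longrightarrow> M \<in> borel_measurable (side_measure T F)"
    and k: "k \<ge> 1"
    and u: "u \<in> sobolev_H (k + 1) \<Omega>" "poisson_solution \<Omega> f uD u"
  shows "(\<forall>v\<in>fe_space k \<Omega> \<T>. \<forall>w\<in>fe_space k \<Omega> \<T>.
            ahat_form k \<Omega> \<T> M (Discrete v) w = a_form k \<Omega> \<T> M v w)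
       \<and> (\<forall>w\<in>fe_space k \<Omega> \<T>.
            ahat_form k \<Omega> \<T> M (Sobolev u) w = l_form k \<Omega> \<T> M f uD w)
       \<and> (\<forall>uh\<in>fe_space k \<Omega> \<T>.
            (\<forall>w\<in>fe_space k \<Omega> \<T>. a_form k \<Omega> \<T> M uh w = l_form k \<Omega> \<T> M f uD w) \<longrightarrow>
            (\<forall>w\<in>fe_space k \<Omega> \<T>.
               ahat_form k \<Omega> \<T> M (Discrete uh) w - ahat_form k \<Omega> \<T> M (Sobolev u) w = 0))"
proof -
  \<comment> \<open>Green's formula for \<open>\<nabla>u\<close> takes two weak derivatives of
    \<open>u\<close>; \<open>k \<ge> 1\<close> supplies them.\<close>
  have "u \<in> sobolev_H 2 \<Omega>" using u(1) sobolev_H_mono[of 2 "k + 1"] k by auto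
  then interpret surrogate_poisson \<Omega> D \<T> k u f uD
    using Omega mesh u by unfold_locales auto
  have "ahat_form k \<Omega> \<T> M (Discrete v) w = a_form k \<Omega> \<T> M v w" if "v \<in> fe_space k \<Omega> \<T>" for v w
    by (rule ahat_discrete[OF that])
  moreover have "ahat_form k \<Omega> \<T> M (Sobolev u) w = l_form k \<Omega> \<T> M f uD w" if "w \<in> fe_space k \<Omega> \<T>" for w
    by (rule ahat_consistent[OF that M_maps])
  ultimately show ?thesis by simp
qed

end
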